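(* Let $\mathcal{D}$ be an open disk centred at the origin with radius $r_0>0$, let $\varphi,\widetilde\varphi$ be the cut-off functions described in the context, let $\mathcal{Z}$ be the zero process of the standard planar Gaussian analytic function $f$ and $\mathcal{Z}_n$ the zero process of its degree-$n$ truncation $f_n$. Then: (i) The random variables $$S_l(n):=\int\frac{\widetilde\varphi(z)}{z^l}\,d[\mathcal{Z}_n](z)+\sum_{j=1}^\infty\int\frac{\varphi_{2^j}(z)}{z^l}\,d[\mathcal{Z}_n](z)=\sum_{\omega\in\mathcal{Z}_n\cap\mathcal{D}^c}\frac1{\omega^l}\qquad(l\ge1)$$ and $$\widetilde S_l(n):=\int\frac{\widetilde\varphi(z)}{|z|^l}\,d[\mathcal{Z}_n](z)+\sum_{j=1}^\infty\int\frac{\varphi_{2^j}(z)}{|z|^l}\,d[\mathcal{Z}_n](z)=\sum_{\omega\in\mathcal{Z}_n\cap\mathcal{D}^c}\frac1{|\omega|^l}\qquad(l\ge3)$$ have a finite first moment which, for every fixed $l$, is bounded above uniformly in $n$. (ii) There exists $k_0=k_0(\varphi)\ge1$, not depending on $n$ and $l$, such that for $k\ge k_0$ the tails $$\tau_l^n(2^k):=\sum_{j=k}^\infty\int\frac{\varphi_{2^j}(z)}{z^l}\,d[\mathcal{Z}_n](z)\ \ (l\ge1),\qquad \widetilde\tau_l^n(2^k):=\sum_{j=k}^\infty\int\frac{\varphi_{2^j}(z)}{|z|^l}\,d[\mathcal{Z}_n](z)\ \ (l\ge3)$$ satisfy $$\mathbb{E}\big[|\tau_l^n(2^k)|\big]\le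 C_1(\varphi,l)/2^{kl/2},\qquad \mathbb{E}\big[|\widetilde\tau_l^n(2^k)|\big]\le C_2(\varphi,l)/2^{k(l-2)/2},$$ with $C_1(\varphi,l),C_2(\varphi,l)$ not depending on $n$ or $k$. The same holds for the zero process $\mathcal{Z}$ of $f$: the random variables $$S_l:=\int\frac{\widetilde\varphi(z)}{z^l}\,d[\mathcal{Z}](z)+\sum_{j=1}^\infty\int\frac{\varphi_{2^j}(z)}{z^l}\,d[\mathcal{Z}](z)\ \ (l\ge1),\qquad \widetilde S_l:=\int\frac{\widetilde\varphi(z)}{|z|^l}\,d[\mathcal{Z}](z)+\sum_{j=1}^\infty\int\frac{\varphi_{2^j}(z)}{|z|^l}\,d[\mathcal{Z}](z)=\sum_{\omega\in\mathcal{Z}\cap\mathcal{D}^c}\frac1{|\omega|^l}\ \ (l\ge3)$$ have finite first moments, and for $k\ge k_0$ the tails $$\tau_l(2^k):=\sum_{j=k}^\infty\int\frac{\varphi_{2^j}(z)}{z^l}\,d[\mathcal{Z}](z)\ \ (l\ge1),\qquad \widetilde\tau_l(2^k):=\sum_{j=k}^\infty\int\frac{\varphi_{2^j}(z)}{|z|^l}\,d[\mathcal{Z}](z)\ \ (l\ge3)$$ satisfy $$\mathbb{E}\big[|\tau_l(2^k)|\big]\le C_1(\varphi,l)/2^{kl/2},\qquad \mathbb{E}\big[|\widetilde\tau_l(2^k)|\big]\le C_2(\varphi,l)/2^{k(l-2)/2};$$ here, for $\mathcal{Z}$, the symbol $\sum_{\omega\in\mathcal{Z}\cap\mathcal{D}^c}\omega^{-l}$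 denotes by definition the quantity $S_l=\int\frac{\widetilde\varphi(z)}{z^l}d[\mathcal{Z}](z)+\sum_{j\ge1}\int\frac{\varphi_{2^j}(z)}{z^l}d[\mathcal{Z}](z)$.
   Context: $(\xi_k)_{k\ge0}$ are i.i.d. standard complex Gaussians, $f(z)=\sum_{k\ge0}\frac{\xi_k}{\sqrt{k!}}z^k$, $f_n(z)=\sum_{k=0}^n\frac{\xi_k}{\sqrt{k!}}z^k$. For a point process $\Pi$, $[\Pi]=\sum_{z\in\Pi}\delta_z$. $\varphi$ is a non-negative radial $C_c^\infty$ function on $\mathbb{C}$ supported on $\{r_0\le|z|\le3r_0\}$, with (writing $\varphi$ as a function of $|z|$) $\varphi=1$ on $[\frac{3r_0}2,2r_0]$ and $\varphi(r_0+r)=1-\varphi(2r_0+2r)$ for $0\le r\le\frac12r_0$. $\widetilde\varphi$ is the radial function with $\widetilde\varphi(z)=1$ for $r_0\le|z|\le\frac{3r_0}2$ and $\widetilde\varphi=\varphi$ otherwise. For $L>0$, $\psi_L(z):=\psi(z/L)$. The functions $\widetilde\varphi$ and $\varphi_{2^j}$, $j\ge1$, form a partition of unity on $\mathcal{D}^c$. *)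

theory Defs
  imports "HOL-Probability.Probability" "HOL-Complex_Analysis.Complex_Analysis"
begin

section \<open>The planar Gaussian analytic function and its truncations\<close>

text \<open>
  The functions are given by their coefficient sequence \<open>a\<close>; the random function is obtained by
  inserting a realisation of the Gaussian sequence. That realisation defines an entire function
  almost surely; on the exceptional null event the function is set to \<open>0\<close>, so that every
  linear statistic of its zeros is measurable on the original probability space, not merely on its
  completion.
\<close>

definition gaf_trunc :: "nat \<Rightarrow> (nat \<Rightarrow> complex) \<Rightarrow> complex \<Rightarrow> complex" where
  "gaf_trunc n a z = (\<Sum>k\<le>n. a k / complex_of_real (sqrt (fact k)) * z ^ k)"

definition gaf :: "(nat \<Rightarrow> complex) \<Rightarrow> complex \<Rightarrow> complex" where
  "gaf a z =
     (if \<forall>w. summable (\<lambda>k. a k / complex_of_real (sqrt (fact k)) * w ^ k)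
      then \<Sum>k. a k / complex_of_real (sqrt (fact k)) * z ^ k else 0)"

definition std_complex_gaussian :: "'a measure \<Rightarrow> ('a \<Rightarrow> complex) \<Rightarrow> bool" where
  "std_complex_gaussian M X \<longleftrightarrow> distributed M lborel X (\<lambda>z. ennreal (exp (- (cmod z)\<^sup>2) / pi))"

section \<open>Zero processes\<close>

definition zeros :: "(complex \<Rightarrow> complex) \<Rightarrow> complex set" where
  "zeros F = {z. F z = 0}"

text \<open>
  The sum of point masses at the zeros of \<open>F\<close>, each zero being repeated according to its
  multiplicity. (The zeros of the random functions considered here are almost surely simple.)
\<close>

definition zero_process :: "(complex \<Rightarrow> complex) \<Rightarrow> complex measure" where
  "zero_process F =
     distr (point_measure (zeros F) (\<lambda>z. ennreal (of_int (zorder F z)))) borel (\<lambda>z. z)"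

section \<open>Cut-off functions\<close>

primrec C_k :: "nat \<Rightarrow> ('a::real_normed_vector \<Rightarrow> 'b::real_normed_vector) \<Rightarrow> bool" where
  "C_k 0 g \<longleftrightarrow> continuous_on UNIV g"
| "C_k (Suc k) g \<longleftrightarrow>
     (\<forall>x. g differentiable (at x)) \<and> (\<forall>v. C_k k (\<lambda>x. frechet_derivative g (at x) v))"

definition C_infinity :: "('a::real_normed_vector \<Rightarrow> 'b::real_normed_vector) \<Rightarrow> bool" where
  "C_infinity g \<longleftrightarrow> (\<forall>k. C_k k g)"

text \<open>
  The value of a radial function at modulus \<open>t\<close> is its value at the complex number \<open>t\<close>.
\<close>

definition radial_cutoff :: "real \<Rightarrow> (complex \<Rightarrow> real) \<Rightarrow> bool" where
  "radial_cutoff r0 \<phi> \<longleftrightarrow>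
     C_infinity \<phi> \<and>
     (\<forall>z. 0 \<le> \<phi> z) \<and>
     (\<forall>z w. cmod z = cmod w \<longrightarrow> \<phi> z = \<phi> w) \<and>
     (\<forall>z. \<phi> z \<noteq> 0 \<longrightarrow> r0 \<le> cmod z \<and> cmod z \<le> 3 * r0) \<and>
     (\<forall>t. 3 * r0 / 2 \<le> t \<and> t \<le> 2 * r0 \<longrightarrow> \<phi> (complex_of_real t) = 1) \<and>
     (\<forall>r. 0 \<le> r \<and> r \<le> r0 / 2 \<longrightarrow>
        \<phi> (complex_of_real (r0 + r)) = 1 - \<phi> (complex_of_real (2 * r0 + 2 * r)))"

definition inner_cutoff :: "real \<Rightarrow> (complex \<Rightarrow> real) \<Rightarrow> complex \<Rightarrow> real" where
  "inner_cutoff r0 \<phi> z = (if r0 \<le> cmod z \<and> cmod z \<le> 3 * r0 / 2 then 1 else \<phi> z)"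

definition dilate :: "real \<Rightarrow> (complex \<Rightarrow> real) \<Rightarrow> complex \<Rightarrow> real" where
  "dilate L \<psi> z = \<psi> (z / complex_of_real L)"

section \<open>Sums over the zeros\<close>

text \<open>
  Below, \<open>h\<close> is \<open>z \<mapsto> 1 / z ^ l\<close> or \<open>z \<mapsto> 1 / cmod z ^ l\<close>.
\<close>

definition dyadic_block ::
    "(complex \<Rightarrow> real) \<Rightarrow> nat \<Rightarrow> (complex \<Rightarrow> 'b) \<Rightarrow> (complex \<Rightarrow> complex) \<Rightarrow>
     'b::{banach, second_countable_topology}" where
  "dyadic_block \<phi> j h F = (LINT z|zero_process F. dilate (2 ^ j) \<phi> z *\<^sub>R h z)"

definition zero_sum ::
    "real \<Rightarrow> (complex \<Rightarrow> real) \<Rightarrow> (complex \<Rightarrow> 'b) \<Rightarrow> (complex \<Rightarrow> complex) \<Rightarrow>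
     'b::{banach, second_countable_topology}" where
  "zero_sum r0 \<phi> h F =
     (LINT z|zero_process F. inner_cutoff r0 \<phi> z *\<^sub>R h z) +
     (\<Sum>j. dyadic_block \<phi> (Suc j) h F)"

definition zero_tail ::
    "(complex \<Rightarrow> real) \<Rightarrow> nat \<Rightarrow> (complex \<Rightarrow> 'b) \<Rightarrow> (complex \<Rightarrow> complex) \<Rightarrow>
     'b::{banach, second_countable_topology}" where
  "zero_tail \<phi> k h F = (\<Sum>j. dyadic_block \<phi> (k + j) h F)"

end

theory Submission
  imports Defs "HOL-Real_Asymp.Real_Asymp"
begin

text \<open>
  For \<open>l \<ge> 1\<close> a block \<open>\<Sum> \<phi>\<^sub>L(a) / a\<^sup>l\<close> over the zeros \<open>a\<close> of \<open>F\<close> equals a radial integral of the \<open>l\<close>-th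
  Fourier coefficients of \<open>ln \<bar>F\<bar>\<close> on circles, against a weight of total mass \<open>O(L\<^sup>-\<^sup>l)\<close>. Since a
  Fourier coefficient of order \<open>l \<ge> 1\<close> ignores radial functions, \<open>ln \<bar>F\<bar>\<close> may be replaced by
  \<open>ln \<bar>F\<bar> - ln T\<close> with \<open>T(r) = \<Sum> r\<^sup>k / \<surd>k!\<close>. The mean modulus of this difference is only \<open>O(1 + ln r)\<close>:
  it is bounded above because \<open>E \<bar>F\<bar> \<le> C T\<close>, and below by conditioning on all coefficients except the one of
  the maximal term, whose density is bounded. Hence a block has mean modulus \<open>O((1 + ln L) / L\<^sup>l)\<close>, uniformly
  in the truncation. For \<open>1 / \<bar>a\<bar>\<^sup>l\<close> it suffices to count zeros by a Jensen-type inequality, which gives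
  \<open>O(L\<^sup>2\<^sup>-\<^sup>l)\<close>.
\<close>

section \<open>Zeros of entire functions\<close>

text \<open>Counting zeros alone gives \<open>L ^ (2 - l)\<close> for a block, which does not sum
  over dyadic \<open>L\<close> when \<open>l\<close> is 1 or 2; the cancellation among complex
  powers must be used, and the Fourier representation extracts it. The majorant must run over the
  same indices as the function: for a truncation, the full series is far too large once
  \<open>r\<close> is large compared with the root of the degree. Hence all estimates concern an
  index set \<open>A\<close> that contains 0 and, where the maximal term enters, is closed
  downwards; \<open>{..n}\<close> and \<open>UNIV\<close> are covered at once, with constants
  independent of \<open>A\<close>. The innermost cut-off jumps at radius \<open>r0\<close>, so block
  0 has no such representation and is bounded by the zero count. Measurability is a separate matter:
  no zero is selected measurably; the statistics are limits of Stieltjes sums of contour integrals,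
  which Fubini shows to be measurable. Halving the exponent in the tail rates leaves enough decay to
  absorb the logarithm and to sum the blocks.\<close>

locale entire_nonzero =
  fixes F :: "complex \<Rightarrow> complex"
  assumes holo: "F holomorphic_on UNIV" and nonzero: "\<exists>z. F z \<noteq> 0"
begin

lemma finite_zeros: "finite (zeros F \<inter> cball 0 R)"
proof (cases "F constant_on UNIV")
  case True
  then have "zeros F = {}"
    using nonzero by (auto simp: constant_on_def zeros_def)
  then show ?thesis by simp
next
  case False
  have "finite {z \<in> cball 0 R. F z = 0}"
    by (rule holomorphic_compact_finite_zeros[OF holo _ _ _ _ False]) auto
  then show ?thesis
    by (rule finite_subset[rotated]) (auto simp: zeros_def)
qed

lemma zorder_pos: "a \<in> zeros F \<Longrightarrow> zorder F a > 0"
  and zorder_nonneg: "zorder F a \<ge> 0"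
  and local_factor: "\<exists>r>0. zor_poly F a holomorphic_on cball a r \<and>
    (\<forall>w\<in>cball a r. F w = zor_poly F a w * (w - a) ^ nat (zorder F a) \<and> zor_poly F a w \<noteq> 0)"
proof -
  have "\<exists>w\<in>UNIV. F w \<noteq> 0" using nonzero by auto
  note * = zorder_exist_zero[OF holo open_UNIV connected_UNIV UNIV_I this, of a]
  have ord: "if F a = 0 then zorder F a > 0 else zorder F a = 0"
    using * by (rule conjunct1)
  then show "zorder F a \<ge> 0" by (simp split: if_splits)
  show "zorder F a > 0" if "a \<in> zeros F"
    using ord that by (simp add: zeros_def)
  show "\<exists>r>0. zor_poly F a holomorphic_on cball a r \<and>
    (\<forall>w\<in>cball a r. F w = zor_poly F a w * (w - a) ^ nat (zorder F a) \<and> zor_poly F a w \<noteq> 0)"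
    using * by blast
qed

text \<open>Bounded support leaves finitely many zeros, so the integral over the weighted counting
  measure collapses to a finite sum, the form in which it is handled from here on.\<close>

lemma integral_zero_process:
  fixes h :: "complex \<Rightarrow> 'b::{banach, second_countable_topology}"
  assumes [measurable]: "h \<in> borel_measurable borel" and supp: "\<And>z. h z \<noteq> 0 \<Longrightarrow> cmod z \<le> R"
  shows "(LINT z|zero_process F. h z)
    = (\<Sum>a\<in>zeros F \<inter> cball 0 R. of_int (zorder F a) *\<^sub>R h a)"
proof -
  have "(LINT z|zero_process F. h z)
      = (LINT z|point_measure (zeros F) (\<lambda>z. ennreal (of_int (zorder F z))). h z)"
    unfolding zero_process_def
    by (subst integral_distr) (auto simp: point_measure_def)
  also have "\<dots> = (LINT z|count_space (zeros F). of_int (zorder F z) *\<^sub>R h z)"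
    unfolding point_measure_def
    by (subst integral_density) (auto simp: AE_count_space zorder_nonneg)
  also have "\<dots> = (\<Sum>a | a \<in> zeros F \<and> of_int (zorder F a) *\<^sub>R h a \<noteq> 0. of_int (zorder F a) *\<^sub>R h a)"
    by (rule lebesgue_integral_count_space_finite_support)
      (rule finite_subset[OF _ finite_zeros[of R]], use supp in auto)
  also have "\<dots> = (\<Sum>a\<in>zeros F \<inter> cball 0 R. of_int (zorder F a) *\<^sub>R h a)"
    using supp by (intro sum.mono_neutral_left finite_zeros) auto
  finally show ?thesis .
qed

text \<open>Near \<open>a\<close>, \<open>F = g * (w - a) ^ N\<close> with \<open>g\<close>
  nonvanishing, so \<open>F' / F - N / (w - a)\<close> is holomorphic there and the residue picks up
  \<open>N\<close>. The origin is excluded because \<open>z powi m\<close> can itself be singular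
  there.\<close>

lemma residue_logderiv:
  assumes "a \<noteq> 0"
  shows "residue (\<lambda>z. z powi m * (deriv F z / F z)) a = of_int (zorder F a) * a powi m"
proof -
  define g where "g = zor_poly F a"
  obtain r where r: "r > 0" and g1: "g holomorphic_on cball a r"
    and F: "\<And>w. w \<in> cball a r \<Longrightarrow> F w = g w * (w - a) ^ nat (zorder F a) \<and> g w \<noteq> 0"
    using local_factor[of a] unfolding g_def by blast
  have g: "g holomorphic_on cball a r" "g a \<noteq> 0" using g1 F[of a] r by auto
  define N where "N = nat (zorder F a)"
  have N: "of_int (zorder F a) = (of_nat N :: complex)"
    using zorder_nonneg[of a] by (simp add: N_def)
  define s where "s = min r (cmod a)"
  have s: "s > 0" "ball a s \<subseteq> cball a r" using r assms by (auto simp: s_def)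
  have "0 \<notin> ball a s" by (auto simp: s_def)
  have gs: "g holomorphic_on ball a s"
    using g(1) s(2) by (rule holomorphic_on_subset)
  have Fs: "F holomorphic_on ball a s" using holo by (rule holomorphic_on_subset) auto
  have nzF: "F w \<noteq> 0" if "w \<in> ball a s - {a}" for w
    using F[of w] that s(2) by auto
  have dF: "deriv F w = deriv g w * (w - a) ^ N + g w * (of_nat N * (w - a) ^ (N - 1))"
    if w: "w \<in> ball a s" for w
  proof -
    have "(g has_field_derivative deriv g w) (at w)"
      using holomorphic_derivI[OF gs open_ball w] .
    then have "((\<lambda>w. g w * (w - a) ^ N) has_field_derivative
        deriv g w * (w - a) ^ N + g w * (of_nat N * (w - a) ^ (N - 1))) (at w)"
      by (auto intro!: derivative_eq_intros)
    then have "(F has_field_derivative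
        deriv g w * (w - a) ^ N + g w * (of_nat N * (w - a) ^ (N - 1))) (at w)"
      by (rule has_field_derivative_transform_within_open[OF _ open_ball w])
        (use F s(2) in \<open>auto simp: N_def\<close>)
    then show ?thesis by (rule DERIV_imp_deriv)
  qed
  show ?thesis
  proof (rule residue_simple'[of "ball a s"])
    show "(\<lambda>z. z powi m * (deriv F z / F z)) holomorphic_on ball a s - {a}"
      using nzF \<open>0 \<notin> ball a s\<close>
      by (intro holomorphic_intros holomorphic_on_subset[OF Fs] holomorphic_on_subset[OF holomorphic_deriv[OF Fs]]) auto
    have "((\<lambda>w. w powi m * (deriv g w / g w * (w - a) + of_nat N)) \<longlongrightarrow>
        a powi m * (deriv g a / g a * (a - a) + of_nat N)) (at a)"
    proof -
      have "isCont g a" "isCont (deriv g) a"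
        using gs holomorphic_deriv[OF gs open_ball] s(1)
        by (auto simp: continuous_on_eq_continuous_at dest!: holomorphic_on_imp_continuous_on)
      then show ?thesis
        using g(2) assms by (intro tendsto_intros isContD) (auto simp: isCont_def)
    qed
    moreover have "\<forall>\<^sub>F w in at a. w powi m * (deriv g w / g w * (w - a) + of_nat N)
        = w powi m * (deriv F w / F w) * (w - a)"
      using eventually_at_in_open[OF open_ball centre_in_ball[THEN iffD2, OF s(1)]]
    proof (rule eventually_mono)
      fix w assume w: "w \<in> ball a s - {a}"
      then have "g w \<noteq> 0" "F w = g w * (w - a) ^ N" using F[of w] s(2) by (auto simp: N_def)
      moreover have "deriv F w * (w - a) = (deriv g w * (w - a) + g w * of_nat N) * (w - a) ^ N"
      proof -
        define u where "u = w - a"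
        have "deriv F w = deriv g w * u ^ N + g w * (of_nat N * u ^ (N - 1))"
          using dF[of w] w by (simp add: u_def)
        then show ?thesis
          unfolding u_def[symmetric] by (cases N) (simp_all add: algebra_simps)
      qed
      moreover have "(w - a) ^ N \<noteq> 0" using w by auto
      ultimately show "w powi m * (deriv g w / g w * (w - a) + of_nat N)
        = w powi m * (deriv F w / F w) * (w - a)"
        by (simp add: divide_simps del: power_eq_0_iff)
    qed
    ultimately show "((\<lambda>w. w powi m * (deriv F w / F w) * (w - a)) \<longlongrightarrow> of_int (zorder F a) * a powi m) (at a)"
      using N by (force elim!: Lim_transform_eventually simp: mult.commute)
  qed (use s in auto)
qed

definition moment :: "int \<Rightarrow> real \<Rightarrow> complex" where
  "moment m r = (\<Sum>a\<in>{a\<in>zeros F. a \<noteq> 0 \<and> cmod a < r}. of_int (zorder F a) * a powi m)"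

text \<open>Never evaluated: it drops out of differences of moments, and the radial integration with
  vanishing boundary values eliminates it as well.\<close>

definition moment_offset :: "int \<Rightarrow> complex" where
  "moment_offset m = residue (\<lambda>z. z powi m * (deriv F z / F z)) 0"

lemma finite_zeros_less: "finite {a\<in>zeros F. a \<noteq> 0 \<and> cmod a < r}"
  by (rule finite_subset[OF _ finite_zeros[of r]]) auto

lemma contour_integral_logderiv:
  assumes r: "r > 0" and no_zero: "\<And>a. a \<in> zeros F \<Longrightarrow> cmod a \<noteq> r"
  shows "contour_integral (circlepath 0 r) (\<lambda>z. z powi m * (deriv F z / F z))
    = 2 * pi * \<i> * (moment_offset m + moment m r)"
proof -
  let ?f = "\<lambda>z. z powi m * (deriv F z / F z)"
  let ?Z = "{a\<in>zeros F. a \<noteq> 0 \<and> cmod a < r}"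
  \<comment> \<open>Holomorphy is needed on the larger disc \<open>ball 0 (r+1)\<close>, so zeros
    beyond the circle are removed too; their winding number is 0. The origin is always removed
    because of \<open>z powi m\<close>.\<close>
  define Z' where "Z' = insert 0 (zeros F \<inter> cball 0 (r+1))"
  have fin: "finite Z'" by (simp add: Z'_def finite_zeros)
  have "contour_integral (circlepath 0 r) ?f
      = 2 * pi * \<i> * (\<Sum>p\<in>Z'. winding_number (circlepath 0 r) p * residue ?f p)"
  proof (rule Residue_theorem[of "ball 0 (r+1)"])
    show "?f holomorphic_on ball 0 (r+1) - Z'"
      by (intro holomorphic_intros holomorphic_on_subset[OF holo]
          holomorphic_on_subset[OF holomorphic_deriv[OF holo]])
        (auto simp: Z'_def zeros_def)
    show "path_image (circlepath 0 r) \<subseteq> ball 0 (r+1) - Z'"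
      using r no_zero by (auto simp: Z'_def)
    show "\<forall>z. z \<notin> ball 0 (r + 1) \<longrightarrow> winding_number (circlepath 0 r) z = 0"
    proof (intro allI impI)
      fix z :: complex assume "z \<notin> ball 0 (r+1)"
      then show "winding_number (circlepath 0 r) z = 0"
        using r by (intro winding_number_zero_outside[of _ "cball 0 r"]) (auto simp: dist_norm)
    qed
  qed (use r fin in auto)
  also have "(\<Sum>p\<in>Z'. winding_number (circlepath 0 r) p * residue ?f p)
      = (\<Sum>p\<in>insert 0 ?Z. residue ?f p)"
  proof (rule sum.mono_neutral_cong_right)
    show "\<forall>i\<in>Z' - insert 0 ?Z. winding_number (circlepath 0 r) i * residue ?f i = 0"
    proof
      fix z assume z: "z \<in> Z' - insert 0 ?Z"
      then have "cmod z > r" using no_zero[of z] by (force simp: Z'_def)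
      then have "winding_number (circlepath 0 r) z = 0"
        using r by (intro winding_number_zero_outside[of _ "cball 0 r"]) (auto simp: dist_norm)
      then show "winding_number (circlepath 0 r) z * residue ?f z = 0" by simp
    qed
    show "winding_number (circlepath 0 r) z * residue ?f z = residue ?f z"
      if "z \<in> insert 0 ?Z" for z
      using that r by (subst winding_number_circlepath) (auto simp: dist_norm)
  qed (auto simp: Z'_def finite_zeros)
  also have "\<dots> = moment_offset m + moment m r"
    using finite_zeros_less[of r] by (auto simp: moment_def moment_offset_def residue_logderiv simp del: times_divide_eq_right)
  finally show ?thesis .
qed

end

section \<open>Fourier coefficients of the logarithm of the modulus on circles\<close>

definition circ :: "real \<Rightarrow> real \<Rightarrow> complex" where
  "circ r t = of_real r * exp (2 * of_real pi * \<i> * of_real t)"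

definition wave :: "int \<Rightarrow> real \<Rightarrow> complex" where
  "wave l t = exp (2 * of_real pi * \<i> * of_int l * of_real t)"

lemma circ_eq_circlepath: "circ r = circlepath 0 r"
  by (simp add: circlepath circ_def fun_eq_iff)

lemma norm_circ [simp]: "cmod (circ r t) = \<bar>r\<bar>"
  by (simp add: circ_def norm_mult norm_exp_eq_Re)

lemma circ_eq_0_iff [simp]: "circ r t = 0 \<longleftrightarrow> r = 0"
  by (simp add: circ_def)

lemma norm_wave [simp]: "cmod (wave l t) = 1"
  by (simp add: wave_def norm_exp_eq_Re)

lemma cnj_wave: "cnj (wave l t) = wave (- l) t"
  by (simp add: wave_def exp_cnj)

lemma circ_powi: "circ r t powi l = of_real r powi l * wave l t"
proof -
  have "exp (2 * of_real pi * \<i> * of_real t) powi l = wave l t"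
    unfolding wave_def exp_power_int by (simp add: mult_ac)
  then show ?thesis by (simp add: circ_def power_int_mult_distrib)
qed

lemma continuous_on_circ [continuous_intros]:
  assumes "continuous_on A f" "continuous_on A g"
  shows "continuous_on A (\<lambda>x. circ (f x) (g x))"
  unfolding circ_def by (intro continuous_intros assms)

lemma continuous_on_wave [continuous_intros]: "continuous_on A g \<Longrightarrow> continuous_on A (\<lambda>x. wave l (g x))"
  unfolding wave_def by (intro continuous_intros)

lemma circ_has_vector_derivative:
  "((\<lambda>t. circ r t) has_vector_derivative 2 * of_real pi * \<i> * circ r t) (at t within A)"
  unfolding circ_def
  by (rule has_vector_derivative_real_field) (auto intro!: derivative_eq_intros)

lemma wave_has_vector_derivative:
  "(wave l has_vector_derivative 2 * of_real pi * \<i> * of_int l * wave l t) (at t within A)"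
  unfolding wave_def
  by (rule has_vector_derivative_real_field) (auto intro!: derivative_eq_intros)

lemma integral_wave: "l \<noteq> 0 \<Longrightarrow> integral {0..1} (wave l) = 0"
proof -
  assume l: "l \<noteq> 0"
  have "((\<lambda>t. 2 * of_real pi * \<i> * of_int l * wave l t) has_integral wave l 1 - wave l 0) {0..1}"
    by (rule fundamental_theorem_of_calculus) (auto intro: wave_has_vector_derivative)
  moreover have "wave l 1 = 1" "wave l 0 = 1"
    using exp_integer_2pi[of "of_int l"] by (auto simp: wave_def mult_ac)
  ultimately have "((\<lambda>t. 2 * of_real pi * \<i> * of_int l * wave l t) has_integral 0) {0..1}" by simp
  from has_integral_mult_right[OF this, of "1 / (2 * of_real pi * \<i> * of_int l)"] l
  have "(wave l has_integral 0) {0..1}" by (simp add: field_simps)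
  then show ?thesis by (rule integral_unique)
qed

context entire_nonzero
begin

definition logderiv_circ :: "real \<Rightarrow> real \<Rightarrow> complex" where
  "logderiv_circ r t = circ r t * (deriv F (circ r t) / F (circ r t))"

lemma continuous_on_F [continuous_intros]:
  "continuous_on A g \<Longrightarrow> continuous_on A (\<lambda>x. F (g x))"
  using continuous_on_compose2[OF holomorphic_on_imp_continuous_on[OF holo]] by blast

lemma continuous_on_deriv_F [continuous_intros]:
  "continuous_on A g \<Longrightarrow> continuous_on A (\<lambda>x. deriv F (g x))"
  using continuous_on_compose2[OF holomorphic_on_imp_continuous_on[OF holomorphic_deriv[OF holo open_UNIV]]]
  by blast

lemma F_circ_nonzero:
  assumes "r > 0" "\<And>a. a \<in> zeros F \<Longrightarrow> cmod a \<noteq> r"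
  shows "F (circ r t) \<noteq> 0"
  using assms(2)[of "circ r t"] assms(1) by (auto simp: zeros_def)

lemma continuous_on_logderiv_circ:
  assumes "r > 0" "\<And>a. a \<in> zeros F \<Longrightarrow> cmod a \<noteq> r"
  shows "continuous_on A (logderiv_circ r)"
  unfolding logderiv_circ_def
  by (intro continuous_intros) (use F_circ_nonzero[OF assms] in auto)

lemma integral_logderiv_circ:
  assumes r: "r > 0" "\<And>a. a \<in> zeros F \<Longrightarrow> cmod a \<noteq> r"
  shows "integral {0..1} (\<lambda>t. circ r t powi m * logderiv_circ r t) = moment_offset m + moment m r"
proof -
  have "2 * pi * \<i> * (moment_offset m + moment m r)
      = contour_integral (circlepath 0 r) (\<lambda>z. z powi m * (deriv F z / F z))"
    using r by (rule contour_integral_logderiv[symmetric])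
  also have "\<dots> = integral {0..1} (\<lambda>t. 2 * pi * \<i> * (circ r t powi m * logderiv_circ r t))"
    unfolding contour_integral_integral circ_eq_circlepath[symmetric]
    by (intro integral_cong)
      (simp add: circ_eq_circlepath vector_derivative_circlepath logderiv_circ_def, simp add: circlepath mult_ac)
  also have "\<dots> = 2 * pi * \<i> * integral {0..1} (\<lambda>t. circ r t powi m * logderiv_circ r t)"
    by (rule integral_mult_right)
  finally show ?thesis by simp
qed

text \<open>
  Integrating by parts turns the Fourier coefficient of \<open>ln \<bar>F\<bar>\<close> into one of the real part of
  \<open>2 \<pi> \<i> z F' / F\<close>, hence into two contour integrals.
\<close>

lemma fourier_ln_norm:
  assumes r: "r > 0" "\<And>a. a \<in> zeros F \<Longrightarrow> cmod a \<noteq> r" and l: "l > 0"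
  shows "2 * of_int l * integral {0..1} (\<lambda>t. of_real (ln (cmod (F (circ r t)))) * wave (- l) t)
    = of_real r powi l * (moment_offset (- l) + moment (- l) r)
      - of_real r powi (- l) * cnj (moment_offset l + moment l r)"
proof -
  define Q where "Q = logderiv_circ r"
  define L where "L t = ln (cmod (F (circ r t)))" for t
  note nz = F_circ_nonzero[OF r]
  have contQ: "continuous_on A Q" for A
    unfolding Q_def using r by (rule continuous_on_logderiv_circ)
  have contL: "continuous_on A L" for A
    unfolding L_def by (intro continuous_intros) (use nz in auto)
  have dL: "(L has_real_derivative Re (2 * of_real pi * \<i> * Q t)) (at t within A)" for t A
  proof -
    have dF: "(F has_field_derivative deriv F (circ r t)) (at (circ r t))"
      using holo by (rule holomorphic_derivI) auto
    have "((F \<circ> circ r) has_vector_derivative 2 * of_real pi * \<i> * circ r t * deriv F (circ r t)) (at t within A)"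
      by (rule field_vector_diff_chain_at[OF circ_has_vector_derivative dF, THEN has_vector_derivative_at_within])
    define w where "w = F (circ r t)"
    define v where "v = 2 * of_real pi * \<i> * circ r t * deriv F (circ r t)"
    have w: "w \<noteq> 0" using nz by (simp add: w_def)
    have "((\<lambda>t. F (circ r t)) has_derivative (\<lambda>h. h *\<^sub>R v)) (at t within A)"
      using \<open>((F \<circ> circ r) has_vector_derivative _) _\<close>
      by (simp add: has_vector_derivative_def o_def v_def)
    then have "((\<lambda>t. cmod (F (circ r t))) has_derivative (\<lambda>h. inner (h *\<^sub>R v) (sgn w))) (at t within A)"
      unfolding w_def by (rule has_derivative_compose[OF _ has_derivative_norm]) (use nz in auto)
    then have "((\<lambda>t. cmod (F (circ r t))) has_real_derivative inner v (sgn w)) (at t within A)"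
      by (simp add: has_field_derivative_def mult.commute[of _ "inner v (sgn w)"])
    from DERIV_ln_divide[THEN DERIV_chain2, OF _ this]
    have "((\<lambda>t. ln (cmod (F (circ r t)))) has_real_derivative 1 / cmod w * inner v (sgn w)) (at t within A)"
      using nz by (simp add: w_def)
    \<comment> \<open>The logarithm of the modulus has derivative \<open>Re (v / w)\<close>, the
      real part of the logarithmic derivative, here rewritten from real inner products.\<close>
    moreover have "1 / cmod w * inner v (sgn w) = Re (2 * of_real pi * \<i> * Q t)"
    proof -
      have "inner v w / (cmod w)\<^sup>2 = Re (v / w)"
        using w by (simp add: Re_divide inner_complex_def cmod_power2 field_simps)
      moreover have "1 / cmod w * inner v (sgn w) = inner v w / (cmod w)\<^sup>2"
        by (simp add: sgn_div_norm power2_eq_square divide_inverse mult_ac)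
      moreover have "v / w = 2 * of_real pi * \<i> * Q t"
        by (simp add: v_def w_def Q_def logderiv_circ_def)
      ultimately show ?thesis by simp
    qed
    ultimately show ?thesis
      unfolding L_def by simp
  qed
  have "((\<lambda>t. of_real (L t) * (2 * of_real pi * \<i> * of_int (- l) * wave (- l) t)
        + of_real (Re (2 * of_real pi * \<i> * Q t)) * wave (- l) t)
      has_integral of_real (L 1) * wave (- l) 1 - of_real (L 0) * wave (- l) 0) {0..1}"
    by (rule fundamental_theorem_of_calculus[OF zero_le_one
        has_vector_derivative_mult[OF has_vector_derivative_of_real[OF dL] wave_has_vector_derivative]])
  \<comment> \<open>Both factors have period 1 in \<open>t\<close>, so the boundary terms cancel and
    the derivative of the product integrates to 0.\<close>
  moreover have "circ r 1 = circ r 0" "wave (-l) 1 = 1" "wave (-l) 0 = 1"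
    using exp_integer_2pi[of "of_int (-l)"] by (auto simp: circ_def wave_def mult_ac)
  ultimately have *: "((\<lambda>t. of_real (L t) * (2 * of_real pi * \<i> * of_int (- l) * wave (- l) t)
        + of_real (Re (2 * of_real pi * \<i> * Q t)) * wave (- l) t) has_integral 0) {0..1}"
    by (simp add: L_def)
  have int_Q: "(\<lambda>t. Q t * wave (- l) t) integrable_on {0..1}"
    "(\<lambda>t. cnj (Q t) * wave (- l) t) integrable_on {0..1}"
    "(\<lambda>t. of_real (L t) * wave (- l) t) integrable_on {0..1}"
    by (intro integrable_continuous_real continuous_intros contQ contL)+
  have eq: "of_real (L t) * (2 * of_real pi * \<i> * of_int (- l) * wave (- l) t)
        + of_real (Re (2 * of_real pi * \<i> * Q t)) * wave (- l) t
      = (of_real pi * \<i>) * (Q t * wave (- l) t - cnj (Q t) * wave (- l) t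
          - 2 * of_int l * (of_real (L t) * wave (- l) t))" for t
  proof -
    \<comment> \<open>Splitting the real part into \<open>Q\<close> and its conjugate produces the
      two moments: \<open>Q\<close> gives the order \<open>- l\<close>, the conjugate gives the
      conjugated moment of order \<open>l\<close>.\<close>
    have "of_real (Re (2 * of_real pi * \<i> * Q t)) = of_real pi * \<i> * (Q t - cnj (Q t))"
      by (auto simp: complex_eq_iff)
    note * = this
    show ?thesis unfolding * by (simp add: algebra_simps)
  qed
  have "0 = integral {0..1} (\<lambda>t. (of_real pi * \<i>) * (Q t * wave (- l) t - cnj (Q t) * wave (- l) t
          - 2 * of_int l * (of_real (L t) * wave (- l) t)))"
    using integral_unique[OF *] unfolding eq by simp
  also have "\<dots> = (of_real pi * \<i>) * integral {0..1} (\<lambda>t. Q t * wave (- l) t - cnj (Q t) * wave (- l) t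
          - 2 * of_int l * (of_real (L t) * wave (- l) t))"
    by (rule integral_mult_right)
  finally have "0 = integral {0..1} (\<lambda>t. Q t * wave (- l) t - cnj (Q t) * wave (- l) t
          - 2 * of_int l * (of_real (L t) * wave (- l) t))" by simp
  also have "\<dots> = integral {0..1} (\<lambda>t. Q t * wave (- l) t) - integral {0..1} (\<lambda>t. cnj (Q t) * wave (- l) t)
      - 2 * of_int l * integral {0..1} (\<lambda>t. of_real (L t) * wave (- l) t)"
    by (rule integral_unique, intro has_integral_diff has_integral_mult_right integrable_integral int_Q)
  finally have main: "2 * of_int l * integral {0..1} (\<lambda>t. of_real (L t) * wave (- l) t)
      = integral {0..1} (\<lambda>t. Q t * wave (- l) t) - integral {0..1} (\<lambda>t. cnj (Q t) * wave (- l) t)"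
    by (simp add: algebra_simps)
  have waveE: "wave k t = of_real r powi (- k) * circ r t powi k" for k t
    using r(1) by (simp add: circ_powi power_int_minus field_simps)
  have "integral {0..1} (\<lambda>t. Q t * wave (- l) t)
      = integral {0..1} (\<lambda>t. of_real r powi l * (circ r t powi (- l) * Q t))"
    using waveE[of "- l"] by (simp add: mult_ac)
  also have "\<dots> = of_real r powi l * (moment_offset (- l) + moment (- l) r)"
    using integral_logderiv_circ[OF r, of "- l"] by (simp add: Q_def)
  finally have 1: "integral {0..1} (\<lambda>t. Q t * wave (- l) t)
      = of_real r powi l * (moment_offset (- l) + moment (- l) r)" .
  have "integral {0..1} (\<lambda>t. cnj (Q t) * wave (- l) t) = integral {0..1} (\<lambda>t. cnj (Q t * wave l t))"
    by (simp add: cnj_wave)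
  also have "\<dots> = cnj (integral {0..1} (\<lambda>t. Q t * wave l t))"
    by (rule integral_cnj[symmetric])
  also have "integral {0..1} (\<lambda>t. Q t * wave l t)
      = integral {0..1} (\<lambda>t. of_real r powi (- l) * (circ r t powi l * Q t))"
    using waveE[of l] by (simp add: mult_ac)
  also have "\<dots> = of_real r powi (- l) * (moment_offset l + moment l r)"
    using integral_logderiv_circ[OF r, of l] by (simp add: Q_def)
  finally have 2: "integral {0..1} (\<lambda>t. cnj (Q t) * wave (- l) t)
      = of_real r powi (- l) * cnj (moment_offset l + moment l r)"
    by (simp flip: of_real_power_int)
  show ?thesis using main 1 2 by (simp add: L_def)
qed

section \<open>Jensen-type bound for the number of zeros\<close>

definition zero_count :: "real \<Rightarrow> nat" where
  "zero_count R = (\<Sum>a\<in>zeros F \<inter> cball 0 R. nat (zorder F a))"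

text \<open>In the disc the product has the same zeros as \<open>F\<close> with the same orders, so
  the quotient extends holomorphically.\<close>

lemma factor_zeros:
  assumes "R > 0"
  obtains G where "G holomorphic_on ball 0 R"
    "\<And>z. z \<in> ball 0 R \<Longrightarrow> F z = G z * (\<Prod>a\<in>zeros F \<inter> ball 0 R. (z - a) ^ nat (zorder F a))"
proof -
  define Z where "Z = zeros F \<inter> ball 0 R"
  define P where "P z = (\<Prod>a\<in>Z. (z - a) ^ nat (zorder F a))" for z
  have fin: "finite Z"
    by (rule finite_subset[OF _ finite_zeros[of R]]) (auto simp: Z_def)
  have P: "P holomorphic_on UNIV"
    unfolding P_def by (intro holomorphic_intros)
  have P0: "P z = 0 \<longleftrightarrow> z \<in> Z" for z
    using fin zorder_pos by (auto simp: P_def prod_zero_iff Z_def)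
  have zeq: "zorder P z = zorder F z" if "z \<in> ball 0 R" for z
  proof (cases "z \<in> Z")
    case True
    show ?thesis
    proof (rule zorder_eqI[OF open_UNIV UNIV_I])
      show "(\<lambda>w. \<Prod>a\<in>Z - {z}. (w - a) ^ nat (zorder F a)) holomorphic_on UNIV"
        by (intro holomorphic_intros)
      show "(\<Prod>a\<in>Z - {z}. (z - a) ^ nat (zorder F a)) \<noteq> 0"
        using fin by (auto simp: prod_zero_iff)
      show "P w = (\<Prod>a\<in>Z - {z}. (w - a) ^ nat (zorder F a)) * (w - z) powi zorder F z" for w
        using fin True zorder_nonneg[of z]
        by (simp add: P_def prod.remove[of Z z] power_int_def mult.commute)
    qed
  next
    case False
    then have "F z \<noteq> 0" "P z \<noteq> 0" using that P0[of z] by (auto simp: Z_def zeros_def)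
    then show ?thesis
      using P holo by (simp add: zorder_eq_0I analytic_on_open[of UNIV, simplified] analytic_on_subset[of _ UNIV])
  qed
  have FP: "P z = 0 \<longleftrightarrow> F z = 0" if "z \<in> ball 0 R" for z
    using P0[of z] that by (simp add: Z_def zeros_def)
  have "\<exists>G. G holomorphic_on ball 0 R \<and> (\<forall>z\<in>ball 0 R. F z = G z * P z)"
  proof (rule holomorphic_zorder_factorization[OF holomorphic_on_subset[OF holo subset_UNIV]
          open_ball connected_ball holomorphic_on_subset[OF P subset_UNIV] FP zeq])
    fix G assume "G holomorphic_on ball 0 R" "\<And>z. z \<in> ball 0 R \<Longrightarrow> F z = G z * P z"
    then show ?thesis by blast
  qed
  then show ?thesis using that by (auto simp: P_def Z_def)
qed

text \<open>Divide \<open>F\<close> by the factors of its zeros in \<open>cball 0 R\<close> and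
  apply the maximum principle to the quotient on \<open>cball 0 (3 * R)\<close>. Each factor has
  modulus at least \<open>2 * R\<close> on the outer circle and at most \<open>R\<close> at the
  origin, so each zero, with multiplicity, gains a factor 2.\<close>

lemma zero_count_bound:
  assumes R: "R > 0" and M: "\<And>z. cmod z = 3 * R \<Longrightarrow> cmod (F z) \<le> M"
  shows "cmod (F 0) * 2 ^ zero_count R \<le> M"
proof -
  obtain G where G: "G holomorphic_on ball 0 (4 * R)"
    and FG: "\<And>z. z \<in> ball 0 (4 * R) \<Longrightarrow>
      F z = G z * (\<Prod>a\<in>zeros F \<inter> ball 0 (4 * R). (z - a) ^ nat (zorder F a))"
    using factor_zeros[of "4 * R"] R by auto
  define Z where "Z = zeros F \<inter> ball 0 (4 * R)"
  define Z1 where "Z1 = zeros F \<inter> cball 0 R"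
  have fin: "finite Z" by (rule finite_subset[OF _ finite_zeros[of "4 * R"]]) (auto simp: Z_def)
  have Z1: "Z1 \<subseteq> Z" "finite Z1" using R finite_zeros by (auto simp: Z_def Z1_def)
  \<comment> \<open>Only the zeros of the small disc stay divided out; the remaining factors are put
    back. The radius \<open>4 * R\<close> leaves room for the closed disc of radius
    \<open>3 * R\<close>.\<close>
  define H where "H z = G z * (\<Prod>a\<in>Z - Z1. (z - a) ^ nat (zorder F a))" for z
  have H: "H holomorphic_on ball 0 (4 * R)"
    unfolding H_def by (intro holomorphic_intros G)
  have FH: "F z = H z * (\<Prod>a\<in>Z1. (z - a) ^ nat (zorder F a))" if "z \<in> ball 0 (4 * R)" for z
    using FG[OF that] prod.subset_diff[OF Z1(1) fin, of "\<lambda>a. (z - a) ^ nat (zorder F a)"]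
    by (simp add: H_def Z_def)
  have sub: "cball 0 (3 * R) \<subseteq> ball (0::complex) (4 * R)" using R by auto
  have "cmod (H 0) \<le> M / (2 * R) ^ zero_count R"
  proof (rule maximum_modulus_frontier[of H "cball 0 (3 * R)"])
    show "H holomorphic_on interior (cball 0 (3 * R))"
      using H by (rule holomorphic_on_subset) (use R in auto)
    show "continuous_on (closure (cball 0 (3 * R))) H"
      using holomorphic_on_imp_continuous_on[OF H] sub by (auto intro: continuous_on_subset)
    fix z :: complex assume "z \<in> frontier (cball 0 (3 * R))"
    then have z: "cmod z = 3 * R" using R by (simp add: frontier_cball dist_norm)
    have "(2 * R) ^ zero_count R = (\<Prod>a\<in>Z1. (2 * R) ^ nat (zorder F a))"
      by (simp add: zero_count_def Z1_def power_sum)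
    also have "\<dots> \<le> (\<Prod>a\<in>Z1. cmod (z - a) ^ nat (zorder F a))"
    proof (intro prod_mono conjI power_mono)
      fix a assume "a \<in> Z1"
      then show "2 * R \<le> cmod (z - a)"
        using norm_triangle_ineq2[of z a] z by (simp add: Z1_def)
    qed (use R in auto)
    finally have "cmod (H z) * (2 * R) ^ zero_count R \<le> cmod (F z)"
      using FH[of z] z R by (simp add: norm_mult prod_norm[symmetric] norm_power mult_left_mono)
    also have "\<dots> \<le> M" using M z by simp
    finally show "cmod (H z) \<le> M / (2 * R) ^ zero_count R"
      using R by (simp add: field_simps)
  qed (use R in auto)
  moreover have "cmod (F 0) \<le> cmod (H 0) * R ^ zero_count R"
  proof -
    have "(\<Prod>a\<in>Z1. cmod a ^ nat (zorder F a)) \<le> (\<Prod>a\<in>Z1. R ^ nat (zorder F a))"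
      by (intro prod_mono conjI power_mono) (auto simp: Z1_def)
    also have "\<dots> = R ^ zero_count R" by (simp add: zero_count_def Z1_def power_sum)
    finally show ?thesis
      using FH[of 0] R by (simp add: norm_mult prod_norm[symmetric] norm_power mult_left_mono)
  qed
  ultimately have "cmod (F 0) \<le> M / (2 * R) ^ zero_count R * R ^ zero_count R"
    using R by (meson mult_right_mono order_trans zero_le_power less_imp_le)
  then show ?thesis
    using R by (simp add: power_mult_distrib field_simps)
qed

end

section \<open>Smooth radial statistics of the zeros\<close>

context entire_nonzero
begin

text \<open>A wave of nonzero order has mean zero, so any number \<open>s\<close> independent of the
  angle may be subtracted before absolute values are taken; \<open>s\<close> will be the logarithm
  of the majorant at radius \<open>r\<close>.\<close>

lemma norm_fourier_le:
  assumes r: "r > 0" "\<And>a. a \<in> zeros F \<Longrightarrow> cmod a \<noteq> r" and l: "l \<noteq> 0"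
  shows "ennreal (cmod (integral {0..1} (\<lambda>t. of_real (ln (cmod (F (circ r t)))) * wave l t)))
    \<le> (\<integral>\<^sup>+t\<in>{0..1}. ennreal \<bar>ln (cmod (F (circ r t))) - s\<bar> \<partial>lborel)"
proof -
  define L where "L t = ln (cmod (F (circ r t)))" for t
  have contL: "continuous_on {0..1} L"
    unfolding L_def by (intro continuous_intros) (use F_circ_nonzero[OF r] in auto)
  define f where "f t = of_real (L t - s) * wave l t" for t
  have "integral {0..1} (\<lambda>t. of_real (L t) * wave l t - of_real s * wave l t)
      = integral {0..1} (\<lambda>t. of_real (L t) * wave l t) - integral {0..1} (\<lambda>t. of_real s * wave l t)"
    by (intro integral_diff integrable_continuous_real continuous_intros contL)
  also have "integral {0..1} (\<lambda>t. of_real s * wave l t) = 0"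
    using integral_wave[OF l] by simp
  finally have "integral {0..1} (\<lambda>t. of_real (L t) * wave l t) = integral {0..1} f"
    by (simp add: f_def[abs_def] left_diff_distrib)
  also have int: "set_integrable lborel {0..1} f"
    unfolding f_def by (intro borel_integrable_atLeastAtMost' continuous_intros contL)
  then have "integral {0..1} f = (LINT t:{0..1}|lborel. f t)"
    by (rule set_borel_integral_eq_integral(2)[symmetric])
  also have "ennreal (cmod \<dots>) \<le> (\<integral>\<^sup>+t. ennreal (cmod (indicator {0..1} t *\<^sub>R f t)) \<partial>lborel)"
    unfolding set_lebesgue_integral_def
    by (rule integral_norm_bound_ennreal) (use int in \<open>simp add: set_integrable_def\<close>)
  also have "\<dots> = (\<integral>\<^sup>+t\<in>{0..1}. ennreal \<bar>L t - s\<bar> \<partial>lborel)"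
    by (intro nn_integral_cong) (auto simp: f_def norm_mult indicator_def simp flip: of_real_diff)
  finally show ?thesis by (simp add: L_def)
qed

text \<open>
  With \<open>w r = r * u'' r + (1 - 2 * l) * u' r\<close>, both \<open>w\<close> and \<open>w / r\<^sup>2\<^sup>l\<close> are exact derivatives, namely of
  \<open>r * u' - 2 * l * u\<close> and \<open>r * u' / r\<^sup>2\<^sup>l\<close>. Therefore integrating \<open>w / r\<^sup>l\<close> against the Fourier
  coefficient of \<open>ln \<bar>F\<bar>\<close> kills the offsets and leaves \<open>u \<bar>a\<bar> / a\<^sup>l\<close> for every zero \<open>a\<close>.
\<close>

lemma radial_statistic_le:
  fixes u u1 u2 s :: "real \<Rightarrow> real" and l :: nat
  assumes AB: "0 < A" "A \<le> B" and l: "l > 0"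
    and u: "\<And>r. r \<in> {A..B} \<Longrightarrow> (u has_real_derivative u1 r) (at r within {A..B})"
    and u1: "\<And>r. r \<in> {A..B} \<Longrightarrow> (u1 has_real_derivative u2 r) (at r within {A..B})"
    and u2: "continuous_on {A..B} u2"
    and bd: "u A = 0" "u B = 0" "u1 A = 0" "u1 B = 0"
  shows "ennreal (cmod (\<Sum>a | a \<in> zeros F \<and> A \<le> cmod a \<and> cmod a \<le> B.
        of_int (zorder F a) * (of_real (u (cmod a)) / a ^ l)))
    \<le> (\<integral>\<^sup>+r\<in>{A..B}. \<integral>\<^sup>+t\<in>{0..1}. ennreal (\<bar>r * u2 r + (1 - 2 * real l) * u1 r\<bar> / r ^ l *
        \<bar>ln (cmod (F (circ r t))) - s r\<bar>) \<partial>lborel \<partial>lborel)"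
proof -
  define w where "w r = r * u2 r + (1 - 2 * real l) * u1 r" for r
  \<comment> \<open>Radial shape of \<open>2 * l\<close> times a Fourier coefficient: per unit of
    multiplicity, a zero \<open>a\<close> inside the circle contributes \<open>k\<close> with
    \<open>\<alpha> = 1 / a ^ l\<close> and \<open>\<beta> = cnj a ^ l\<close>; the offsets
    contribute \<open>k\<close> with constants of their own.\<close>
  define k :: "complex \<Rightarrow> complex \<Rightarrow> real \<Rightarrow> complex" where "k \<alpha> \<beta> r = of_real r ^ l * \<alpha> - \<beta> / of_real r ^ l" for \<alpha> \<beta> r
  define W where "W r = complex_of_real (w r / r ^ l)" for r
  have cont_u1: "continuous_on {A..B} u1"
    by (meson DERIV_continuous_on u1)
  have cont_w: "continuous_on {A..B} w"
    unfolding w_def by (intro continuous_intros u2 cont_u1)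
  have cont_W: "continuous_on {A..B} W"
    unfolding W_def by (intro continuous_intros cont_w) (use AB in auto)
  \<comment> \<open>Multiplying \<open>k\<close> by \<open>w / r ^ l\<close> gives
    \<open>w * \<alpha> - w / r ^ (2 * l) * \<beta>\<close>, where both weights have explicit
    primitives. Their values at \<open>B\<close> vanish by \<open>bd\<close>, so only those at
    \<open>c\<close> remain.\<close>
  have FTC: "((\<lambda>r. W r * k \<alpha> \<beta> r) has_integral
      - (of_real (c * u1 c - 2 * real l * u c) * \<alpha> - of_real (c * u1 c / c ^ (2 * l)) * \<beta>)) {c..B}"
    if c: "A \<le> c" "c \<le> B" for c \<alpha> \<beta>
  proof -
    have sub: "{c..B} \<subseteq> {A..B}" using c by auto
    have 1: "(w has_integral (B * u1 B - 2 * real l * u B) - (c * u1 c - 2 * real l * u c)) {c..B}"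
    proof (rule fundamental_theorem_of_calculus)
      fix r assume "r \<in> {c..B}"
      then have "r \<in> {A..B}" using c by auto
      note [derivative_intros] = DERIV_subset[OF u[OF this] sub] DERIV_subset[OF u1[OF this] sub]
      show "((\<lambda>r. r * u1 r - 2 * real l * u r) has_vector_derivative w r) (at r within {c..B})"
        unfolding has_real_derivative_iff_has_vector_derivative[symmetric]
        by (auto intro!: derivative_eq_intros simp: w_def algebra_simps)
    qed (use c in auto)
    have 2: "((\<lambda>r. w r / r ^ (2 * l)) has_integral B * u1 B / B ^ (2 * l) - c * u1 c / c ^ (2 * l)) {c..B}"
    proof (rule fundamental_theorem_of_calculus)
      fix r assume "r \<in> {c..B}"
      then have r: "r \<in> {A..B}" "r > 0" using c AB by auto
      obtain n where n: "2 * l = Suc n" using l by (cases "2 * l") auto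
      then have "2 * real l = real (Suc n)" by (metis of_nat_mult of_nat_numeral)
      then have w: "w r = u1 r + r * u2 r - real (Suc n) * u1 r"
        by (simp add: w_def algebra_simps)
      have d1: "((\<lambda>r. r * u1 r) has_real_derivative u1 r + r * u2 r) (at r within {c..B})"
        using DERIV_mult[OF DERIV_ident DERIV_subset[OF u1[OF r(1)] sub]] by (simp add: mult_ac)
      have d2: "((\<lambda>r. r ^ Suc n) has_real_derivative real (Suc n) * r ^ n) (at r within {c..B})"
        using DERIV_power[OF DERIV_ident, where n = "Suc n"] by simp
      have eq: "((u1 r + r * u2 r) * r ^ Suc n - r * u1 r * (real (Suc n) * r ^ n)) / (r ^ Suc n * r ^ Suc n)
          = w r / r ^ Suc n"
      proof -
        have "(u1 r + r * u2 r) * r ^ Suc n - r * u1 r * (real (Suc n) * r ^ n) = w r * r ^ Suc n"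
          unfolding w by (simp add: algebra_simps)
        then show ?thesis using r by simp
      qed
      have "((\<lambda>r. r * u1 r / r ^ (2 * l)) has_real_derivative w r / r ^ (2 * l)) (at r within {c..B})"
        using DERIV_divide[OF d1 d2] r unfolding n eq[symmetric] by simp
      then show "((\<lambda>r. r * u1 r / r ^ (2 * l)) has_vector_derivative w r / r ^ (2 * l)) (at r within {c..B})"
        unfolding has_real_derivative_iff_has_vector_derivative .
    qed (use c in auto)
    have "((\<lambda>r. of_real (w r) * \<alpha> - of_real (w r / r ^ (2 * l)) * \<beta>) has_integral
       of_real ((B * u1 B - 2 * real l * u B) - (c * u1 c - 2 * real l * u c)) * \<alpha>
       - of_real (B * u1 B / B ^ (2 * l) - c * u1 c / c ^ (2 * l)) * \<beta>) {c..B}"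
      by (intro has_integral_diff has_integral_mult_left has_integral_of_real 1 2)
    then have "((\<lambda>r. of_real (w r) * \<alpha> - of_real (w r / r ^ (2 * l)) * \<beta>) has_integral
      - (of_real (c * u1 c - 2 * real l * u c) * \<alpha> - of_real (c * u1 c / c ^ (2 * l)) * \<beta>)) {c..B}"
      using bd by (simp add: algebra_simps)
    then show ?thesis
    proof (rule has_integral_eq[rotated])
      fix r assume "r \<in> {c..B}"
      then have "r > 0" using c AB by auto
      then show "of_real (w r) * \<alpha> - of_real (w r / r ^ (2 * l)) * \<beta> = W r * k \<alpha> \<beta> r"
        by (simp add: W_def k_def field_simps mult_2_right[of l] mult_2[of l] power_add)
    qed
  qed
  \<comment> \<open>This \<open>k\<close> vanishes at \<open>r = cmod a\<close>. Freezing the radius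
    at \<open>cmod a\<close> until the circle has passed the zero therefore switches its
    contribution on continuously.\<close>
  define \<kappa> where "\<kappa> a r = k (1 / a ^ l) (cnj a ^ l) (max r (cmod a))" for a r
  have \<kappa>0: "k (1 / a ^ l) (cnj a ^ l) (cmod a) = 0" if "a \<noteq> 0" for a
  proof -
    have "of_real (cmod a) ^ l * of_real (cmod a) ^ l = a ^ l * cnj a ^ l"
      using complex_norm_square[of a] by (simp add: power2_eq_square flip: power_mult_distrib)
    then show ?thesis using that by (simp add: k_def field_simps)
  qed
  have \<kappa>_int: "((\<lambda>r. W r * \<kappa> a r) has_integral
      (if A \<le> cmod a \<and> cmod a \<le> B then 2 * of_nat l * (of_real (u (cmod a)) / a ^ l) else 0)) {A..B}"
    if a: "a \<noteq> 0" for a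
  proof -
    consider "cmod a < A" | "A \<le> cmod a" "cmod a \<le> B" | "B < cmod a" by linarith
    then show ?thesis
    proof cases
      case 1
      then have "((\<lambda>r. W r * \<kappa> a r) has_integral 0) {A..B}"
        by (intro has_integral_eq[OF _ FTC[of A "1 / a ^ l" "cnj a ^ l", unfolded bd, simplified]])
          (use AB in \<open>auto simp: \<kappa>_def max_def\<close>)
      then show ?thesis using 1 by simp
    next
      case 3
      have "((\<lambda>r. 0::complex) has_integral 0) {A..B}" by simp
      then have "((\<lambda>r. W r * \<kappa> a r) has_integral 0) {A..B}"
        by (rule has_integral_eq[rotated]) (use 3 \<kappa>0[OF a] in \<open>auto simp: \<kappa>_def max_def\<close>)
      then show ?thesis using 3 by simp
    next
      case 2
      define c where "c = cmod a"
      have "((\<lambda>r. 0::complex) has_integral 0) {A..c}" by simp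
      then have left: "((\<lambda>r. W r * \<kappa> a r) has_integral 0) {A..c}"
        by (rule has_integral_eq[rotated]) (use \<kappa>0[OF a] in \<open>auto simp: \<kappa>_def max_def c_def\<close>)
      \<comment> \<open>The two \<open>u1\<close> terms cancel because
        \<open>c ^ (2 * l) = a ^ l * cnj a ^ l\<close>; only the value of \<open>u\<close>
        survives.\<close>
      have "- (of_real (c * u1 c - 2 * real l * u c) * (1 / a ^ l) - of_real (c * u1 c / c ^ (2 * l)) * cnj a ^ l)
          = 2 * of_nat l * (of_real (u c) / a ^ l)"
      proof -
        have "of_real (c ^ (2 * l)) = a ^ l * cnj a ^ l"
          using complex_norm_square[of a] by (simp add: c_def power_mult power_mult_distrib)
        then show ?thesis using a by (simp add: field_simps)
      qed
      then have "((\<lambda>r. W r * k (1 / a ^ l) (cnj a ^ l) r) has_integral 2 * of_nat l * (of_real (u c) / a ^ l)) {c..B}"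
        using FTC[of c "1 / a ^ l" "cnj a ^ l"] 2 by (simp only: c_def)
      then have right: "((\<lambda>r. W r * \<kappa> a r) has_integral 2 * of_nat l * (of_real (u c) / a ^ l)) {c..B}"
        by (rule has_integral_eq[rotated]) (auto simp: \<kappa>_def max_def c_def)
      from has_integral_combine[OF _ _ left right] 2 show ?thesis by (simp add: c_def)
    qed
  qed
  \<comment> \<open>The margin in \<open>B + 1\<close> keeps zeros on the circle of radius
    \<open>B\<close> inside the strict inequality.\<close>
  define Z where "Z = {a \<in> zeros F. a \<noteq> 0 \<and> cmod a < B + 1}"
  have finZ: "finite Z" unfolding Z_def by (rule finite_zeros_less)
  define \<alpha> \<beta> where "\<alpha> = moment_offset (- int l)" and "\<beta> = cnj (moment_offset (int l))"
  define m where "m a = complex_of_int (zorder F a)" for a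
  define \<Phi> where "\<Phi> r = W r * (k \<alpha> \<beta> r + (\<Sum>a\<in>Z. m a * \<kappa> a r)) / (2 * of_nat l)" for r
  let ?S = "\<Sum>a | a \<in> zeros F \<and> A \<le> cmod a \<and> cmod a \<le> B. of_int (zorder F a) * (of_real (u (cmod a)) / a ^ l)"
  have "((\<lambda>r. (W r * k \<alpha> \<beta> r + (\<Sum>a\<in>Z. m a * (W r * \<kappa> a r))) * (1 / (2 * of_nat l))) has_integral
      (0 + (\<Sum>a\<in>Z. m a * (if A \<le> cmod a \<and> cmod a \<le> B then 2 * of_nat l * (of_real (u (cmod a)) / a ^ l) else 0)))
        * (1 / (2 * of_nat l))) {A..B}"
    using FTC[of A \<alpha> \<beta>] AB bd
    by (intro has_integral_mult_left has_integral_add has_integral_sum finZ has_integral_mult_right \<kappa>_int)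
      (auto simp: Z_def)
  moreover have "(\<Sum>a\<in>Z. m a * (if A \<le> cmod a \<and> cmod a \<le> B then 2 * of_nat l * (of_real (u (cmod a)) / a ^ l) else 0))
      = 2 * of_nat l * ?S"
    unfolding sum_distrib_left
    by (rule sum.mono_neutral_cong_right) (use finZ AB in \<open>auto simp: Z_def m_def\<close>)
  moreover have "(\<lambda>r. (W r * k \<alpha> \<beta> r + (\<Sum>a\<in>Z. m a * (W r * \<kappa> a r))) * (1 / (2 * of_nat l))) = \<Phi>"
  proof -
    have "W r * (k \<alpha> \<beta> r + (\<Sum>a\<in>Z. m a * \<kappa> a r)) = W r * k \<alpha> \<beta> r + (\<Sum>a\<in>Z. m a * (W r * \<kappa> a r))" for r
      by (simp add: distrib_left sum_distrib_left mult_ac)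
    then show ?thesis by (simp add: \<Phi>_def fun_eq_iff)
  qed
  ultimately have \<Phi>_int: "(\<Phi> has_integral ?S) {A..B}" using l by simp
  have "continuous_on {A..B} \<Phi>"
    unfolding \<Phi>_def \<kappa>_def k_def
    by (intro continuous_intros cont_W) (use AB l in \<open>auto simp: max_def split: if_splits\<close>)
  then have int: "set_integrable lborel {A..B} \<Phi>"
    by (rule borel_integrable_atLeastAtMost')
  have "?S = (LINT r:{A..B}|lborel. \<Phi> r)"
    using set_borel_integral_eq_integral(2)[OF int] integral_unique[OF \<Phi>_int] by simp
  also have "ennreal (cmod \<dots>) \<le> (\<integral>\<^sup>+r. ennreal (cmod (indicator {A..B} r *\<^sub>R \<Phi> r)) \<partial>lborel)"
    unfolding set_lebesgue_integral_def
    by (rule integral_norm_bound_ennreal) (use int in \<open>simp add: set_integrable_def\<close>)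
  also have "\<dots> \<le> (\<integral>\<^sup>+r\<in>{A..B}. \<integral>\<^sup>+t\<in>{0..1}. ennreal (\<bar>w r\<bar> / r ^ l *
        \<bar>ln (cmod (F (circ r t))) - s r\<bar>) \<partial>lborel \<partial>lborel)"
  proof (rule nn_integral_mono_AE)
    \<comment> \<open>Only for radii whose circle meets a zero can \<Phi> differ from
      \<open>W\<close> times the Fourier coefficient; there are finitely many of them.\<close>
    have "finite (cmod ` Z)" using finZ by simp
    then have "AE r in lborel. r \<notin> cmod ` Z"
      by (intro AE_not_in finite_imp_null_set_lborel)
    then show "AE r in lborel. ennreal (cmod (indicator {A..B} r *\<^sub>R \<Phi> r))
        \<le> (\<integral>\<^sup>+t\<in>{0..1}. ennreal (\<bar>w r\<bar> / r ^ l * \<bar>ln (cmod (F (circ r t))) - s r\<bar>) \<partial>lborel) * indicator {A..B} r"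
    proof eventually_elim
      case (elim r)
      show ?case
      proof (cases "r \<in> {A..B}")
        case True
        have r: "r > 0" "\<And>a. a \<in> zeros F \<Longrightarrow> cmod a \<noteq> r"
        proof -
          show "r > 0" using True AB by simp
          show "cmod a \<noteq> r" if "a \<in> zeros F" for a
          proof
            assume eq: "cmod a = r"
            then have "a \<in> Z" using that True AB by (auto simp: Z_def)
            then show False using elim eq by blast
          qed
        qed
        let ?c = "integral {0..1} (\<lambda>t. of_real (ln (cmod (F (circ r t)))) * wave (- int l) t)"
        have mom: "moment (- int l) r = (\<Sum>a\<in>{a\<in>zeros F. a \<noteq> 0 \<and> cmod a < r}. m a * (1 / a ^ l))"
          "cnj (moment (int l) r) = (\<Sum>a\<in>{a\<in>zeros F. a \<noteq> 0 \<and> cmod a < r}. m a * cnj a ^ l)"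
          by (simp_all add: moment_def m_def power_int_minus divide_inverse)
        have "(\<Sum>a\<in>Z. m a * \<kappa> a r) = (\<Sum>a\<in>{a\<in>zeros F. a \<noteq> 0 \<and> cmod a < r}. m a * k (1 / a ^ l) (cnj a ^ l) r)"
        proof (rule sum.mono_neutral_cong_right[OF finZ])
          show "\<forall>a\<in>Z - {a \<in> zeros F. a \<noteq> 0 \<and> cmod a < r}. m a * \<kappa> a r = 0"
            using \<kappa>0 by (auto simp: Z_def \<kappa>_def max_def)
        qed (use True in \<open>auto simp: Z_def \<kappa>_def max_def\<close>)
        also have "\<dots> = of_real r ^ l * moment (- int l) r - cnj (moment (int l) r) / of_real r ^ l"
          unfolding mom by (simp add: k_def sum_distrib_left sum_divide_distrib sum_subtractf right_diff_distrib mult_ac)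
        finally have "k \<alpha> \<beta> r + (\<Sum>a\<in>Z. m a * \<kappa> a r)
            = of_real r powi int l * (moment_offset (- int l) + moment (- int l) r)
              - of_real r powi (- int l) * cnj (moment_offset (int l) + moment (int l) r)"
          by (simp add: k_def \<alpha>_def \<beta>_def power_int_minus divide_inverse algebra_simps)
        also have "\<dots> = 2 * of_nat l * ?c"
          using fourier_ln_norm[OF r, of "int l"] l by simp
        finally have "\<Phi> r = W r * ?c" using l by (simp add: \<Phi>_def)
        then have "ennreal (cmod (\<Phi> r)) = ennreal (cmod (W r)) * ennreal (cmod ?c)"
          by (simp add: norm_mult ennreal_mult)
        also have "\<dots> \<le> ennreal (\<bar>w r\<bar> / r ^ l) * (\<integral>\<^sup>+t\<in>{0..1}. ennreal \<bar>ln (cmod (F (circ r t))) - s r\<bar> \<partial>lborel)"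
          using r l by (intro mult_mono norm_fourier_le) (auto simp: W_def norm_divide norm_power)
        also have "\<dots> = (\<integral>\<^sup>+t. ennreal (\<bar>w r\<bar> / r ^ l) * (ennreal \<bar>ln (cmod (F (circ r t))) - s r\<bar> * indicator {0..1} t) \<partial>lborel)"
        proof (rule nn_integral_cmult[symmetric])
          have [measurable]: "(\<lambda>t. F (circ r t)) \<in> borel_measurable borel"
            by (intro borel_measurable_continuous_onI continuous_intros)
          show "(\<lambda>t. ennreal \<bar>ln (cmod (F (circ r t))) - s r\<bar> * indicator {0..1} t) \<in> borel_measurable lborel"
            by measurable
        qed
        also have "\<dots> = (\<integral>\<^sup>+t\<in>{0..1}. ennreal (\<bar>w r\<bar> / r ^ l * \<bar>ln (cmod (F (circ r t))) - s r\<bar>) \<partial>lborel)"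
          using r by (intro nn_integral_cong, subst ennreal_mult) (auto simp: mult.assoc)
        finally show ?thesis using True by simp
      qed simp
    qed
  qed
  finally show ?thesis by (simp add: w_def)
qed

end

section \<open>The dyadic partition of unity\<close>

text \<open>The symmetry relation pairs the radii in \<open>[r0, 3 * r0 / 2]\<close> with those in
  \<open>[2 * r0, 3 * r0]\<close>; paired values are nonnegative with sum 1, so neither exceeds
  1.\<close>

lemma radial_cutoff_le_1:
  assumes "radial_cutoff r0 \<phi>" "r0 > 0"
  shows "\<phi> z \<le> 1"
proof -
  have nn: "\<And>z. 0 \<le> \<phi> z" and rad: "\<And>z w. cmod z = cmod w \<Longrightarrow> \<phi> z = \<phi> w"
    and supp: "\<And>z. \<phi> z \<noteq> 0 \<Longrightarrow> r0 \<le> cmod z \<and> cmod z \<le> 3 * r0"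
    and one: "\<And>t. 3 * r0 / 2 \<le> t \<Longrightarrow> t \<le> 2 * r0 \<Longrightarrow> \<phi> (complex_of_real t) = 1"
    and sym: "\<And>r. 0 \<le> r \<Longrightarrow> r \<le> r0 / 2 \<Longrightarrow>
        \<phi> (complex_of_real (r0 + r)) = 1 - \<phi> (complex_of_real (2 * r0 + 2 * r))"
    using assms(1) unfolding radial_cutoff_def by blast+
  define t where "t = cmod z"
  have z: "\<phi> z = \<phi> (of_real t)" by (rule rad) (simp add: t_def)
  consider "\<phi> z = 0" | "r0 \<le> t" "t \<le> 3 * r0 / 2" | "3 * r0 / 2 \<le> t" "t \<le> 2 * r0"
    | "2 * r0 \<le> t" "t \<le> 3 * r0"
    using supp[of z] unfolding t_def by argo
  then show ?thesis
  proof cases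
    case 2
    then show ?thesis using sym[of "t - r0"] nn[of "of_real (2 * r0 + 2 * (t - r0))"] z by simp
  next
    case 4
    then have "r0 + (t / 2 - r0) = t / 2" "2 * r0 + 2 * (t / 2 - r0) = t" by auto
    then show ?thesis using sym[of "t / 2 - r0"] nn[of "of_real (t / 2)"] z 4 by simp
  qed (use z one in auto)
qed

definition annular_cutoff :: "real \<Rightarrow> (complex \<Rightarrow> real) \<Rightarrow> nat \<Rightarrow> complex \<Rightarrow> real" where
  "annular_cutoff r0 \<phi> j = (case j of 0 \<Rightarrow> inner_cutoff r0 \<phi> | Suc i \<Rightarrow> dilate (2 ^ Suc i) \<phi>)"

context
  fixes r0 :: real and \<phi> :: "complex \<Rightarrow> real"
  assumes cut: "radial_cutoff r0 \<phi>" and r0: "r0 > 0"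
begin

lemma cutoff_nonneg: "0 \<le> \<phi> z"
  and cutoff_radial: "cmod z = cmod w \<Longrightarrow> \<phi> z = \<phi> w"
  and cutoff_support: "\<phi> z \<noteq> 0 \<Longrightarrow> r0 \<le> cmod z \<and> cmod z \<le> 3 * r0"
  and cutoff_eq_1: "3 * r0 / 2 \<le> t \<Longrightarrow> t \<le> 2 * r0 \<Longrightarrow> \<phi> (complex_of_real t) = 1"
  and cutoff_sym: "0 \<le> r \<Longrightarrow> r \<le> r0 / 2 \<Longrightarrow>
        \<phi> (complex_of_real (r0 + r)) = 1 - \<phi> (complex_of_real (2 * r0 + 2 * r))"
  using cut unfolding radial_cutoff_def by blast+

lemma annular_cutoff_bounds: "0 \<le> annular_cutoff r0 \<phi> j z" "annular_cutoff r0 \<phi> j z \<le> 1"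
  using cutoff_nonneg radial_cutoff_le_1[OF cut r0]
  by (auto simp: annular_cutoff_def inner_cutoff_def dilate_def split: nat.split)

lemma annular_cutoff_support:
  assumes "annular_cutoff r0 \<phi> j z \<noteq> 0"
  shows "2 ^ j * r0 \<le> cmod z" "cmod z \<le> 2 ^ j * (3 * r0)"
proof -
  have "2 ^ j * r0 \<le> cmod z \<and> cmod z \<le> 2 ^ j * (3 * r0)"
  proof (cases j)
    case 0
    then show ?thesis
      using assms cutoff_support[of z] r0
      by (auto simp: annular_cutoff_def inner_cutoff_def split: if_splits)
  next
    case (Suc i)
    then have "\<phi> (z / of_real (2 ^ j)) \<noteq> 0" using assms by (simp add: annular_cutoff_def dilate_def)
    from cutoff_support[OF this] show ?thesis by (simp add: norm_divide norm_power field_simps)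
  qed
  then show "2 ^ j * r0 \<le> cmod z" "cmod z \<le> 2 ^ j * (3 * r0)" by auto
qed

text \<open>After division by \<open>2 ^ i\<close> the functions \<open>i\<close> and
  \<open>i - 1\<close> are evaluated at moduli \<open>s\<close> and \<open>2 * s\<close>, which is
  exactly the pairing in the symmetry relation of \<phi>.\<close>

lemma annular_cutoff_eq:
  assumes t: "2 ^ i * r0 \<le> cmod z" "cmod z < 2 ^ i * (2 * r0)"
  shows "annular_cutoff r0 \<phi> i z + (if i = 0 then 0 else annular_cutoff r0 \<phi> (i - 1) z) = 1"
proof -
  define s where "s = cmod z / 2 ^ i"
  have s: "r0 \<le> s" "s < 2 * r0" using t by (auto simp: s_def field_simps)
  have \<phi>i: "\<phi> (z / of_real (2 ^ i)) = \<phi> (of_real s)"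
    by (rule cutoff_radial) (simp add: s_def norm_divide norm_power)
  show ?thesis
  proof (cases i)
    case 0
    have "\<phi> z = 1" if "3 * r0 / 2 < s"
      using \<phi>i cutoff_eq_1[of s] s that 0 by simp
    then show ?thesis
      using s 0 by (auto simp: annular_cutoff_def inner_cutoff_def s_def)
  next
    case (Suc k)
    have "\<phi> (z / of_real (2 ^ k)) = \<phi> (of_real (2 * s))"
      by (rule cutoff_radial) (simp add: s_def norm_divide norm_power norm_mult Suc)
    \<comment> \<open>Term 0 is the modified inner function; at moduli of at least
      \<open>2 * r0\<close> it agrees with \<phi>.\<close>
    moreover have "annular_cutoff r0 \<phi> k z = \<phi> (z / of_real (2 ^ k))"
    proof (cases k)
      case 0
      then have "2 * r0 \<le> cmod z" using t Suc by simp
      then show ?thesis using 0 r0 by (simp add: annular_cutoff_def inner_cutoff_def)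
    qed (simp add: annular_cutoff_def dilate_def)
    moreover have "\<phi> (of_real s) + \<phi> (of_real (2 * s)) = 1"
    proof (cases "s \<le> 3 * r0 / 2")
      case True
      have "r0 + (s - r0) = s" "2 * r0 + 2 * (s - r0) = 2 * s" by auto
      then show ?thesis using cutoff_sym[of "s - r0"] s True by simp
    next
      case False
      then have "\<phi> (of_real (2 * s)) = 0"
        using cutoff_support[of "of_real (2 * s)"] r0 by (cases "\<phi> (of_real (2 * s)) = 0") auto
      then show ?thesis using cutoff_eq_1[of s] s False by simp
    qed
    ultimately show ?thesis
      using \<phi>i Suc by (simp add: annular_cutoff_def dilate_def)
  qed
qed

text \<open>The outer to inner ratio of a support is 3, below 4, so a point of the
  \<open>i\<close>-th dyadic annulus meets at most the functions \<open>i\<close> and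
  \<open>i - 1\<close>.\<close>

lemma annular_cutoff_sums:
  assumes "r0 \<le> cmod z"
  shows "(\<lambda>j. annular_cutoff r0 \<phi> j z) sums 1" "finite {j. annular_cutoff r0 \<phi> j z \<noteq> 0}"
proof -
  have "\<exists>n. cmod z < 2 ^ n * r0"
    using real_arch_pow[of 2 "cmod z / r0"] r0 by (auto simp: field_simps)
  then obtain n where n: "cmod z < 2 ^ n * r0" and min: "\<And>m. m < n \<Longrightarrow> \<not> cmod z < 2 ^ m * r0"
    using exists_least_iff[of "\<lambda>n. cmod z < 2 ^ n * r0"] by blast
  from n assms obtain i where i: "n = Suc i" by (cases n) auto
  have t: "2 ^ i * r0 \<le> cmod z" "cmod z < 2 ^ i * (2 * r0)"
    using n min[of i] i by auto
  have z: "annular_cutoff r0 \<phi> j z = 0" if "j \<noteq> i" "j \<noteq> i - 1" for j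
  proof (rule ccontr)
    assume *: "annular_cutoff r0 \<phi> j z \<noteq> 0"
    have "(2::real) ^ j \<le> 2 ^ (i - 2) \<and> i \<ge> 2 \<or> (2::real) ^ j \<ge> 2 ^ Suc i"
    proof (cases "j < i")
      case True
      then have "j \<le> i - 2" "i \<ge> 2" using that by auto
      then show ?thesis by (auto intro: power_increasing)
    next
      case False
      then have "Suc i \<le> j" using that by auto
      then have "(2::real) ^ Suc i \<le> 2 ^ j" by (intro power_increasing) auto
      then show ?thesis by blast
    qed
    then show False
    proof (elim disjE conjE)
      assume 1: "(2::real) ^ j \<le> 2 ^ (i - 2)" "i \<ge> 2"
      then obtain k where k: "i = Suc (Suc k)" using le_Suc_ex[OF 1(2)] by auto
      then have "(3 * r0) * 2 ^ j \<le> (3 * r0) * 2 ^ k" using 1 r0 by (intro mult_left_mono) auto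
      moreover have "0 < r0 * 2 ^ k" using r0 by simp
      ultimately have "2 ^ j * (3 * r0) < 2 ^ i * r0"
        using k by (simp add: algebra_simps)
      then show False using annular_cutoff_support(2)[OF *] t by linarith
    next
      assume "(2::real) ^ j \<ge> 2 ^ Suc i"
      then have "2 ^ j * r0 \<ge> 2 ^ Suc i * r0" using r0 by (intro mult_right_mono) auto
      then show False using annular_cutoff_support(1)[OF *] t by simp
    qed
  qed
  show "finite {j. annular_cutoff r0 \<phi> j z \<noteq> 0}"
    by (rule finite_subset[of _ "{i, i - 1}"]) (use z in auto)
  have "(\<lambda>j. annular_cutoff r0 \<phi> j z) sums (\<Sum>j\<in>{i, i - 1}. annular_cutoff r0 \<phi> j z)"
    by (rule sums_finite) (use z in auto)
  also have "(\<Sum>j\<in>{i, i - 1}. annular_cutoff r0 \<phi> j z) = 1"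
    using annular_cutoff_eq[OF t] by (cases "i = 0") auto
  finally show "(\<lambda>j. annular_cutoff r0 \<phi> j z) sums 1" .
qed

lemma continuous_on_cutoff: "continuous_on UNIV \<phi>"
  using cut unfolding radial_cutoff_def C_infinity_def by (metis C_k.simps(1))

lemma annular_cutoff_measurable [measurable]: "annular_cutoff r0 \<phi> j \<in> borel_measurable borel"
proof -
  have [measurable]: "\<phi> \<in> borel_measurable borel"
    by (rule borel_measurable_continuous_onI[OF continuous_on_cutoff])
  show ?thesis
    unfolding annular_cutoff_def inner_cutoff_def[abs_def] dilate_def[abs_def] by (cases j; simp)
qed

text \<open>Supplies the derivatives and boundary conditions for \<open>radial_statistic_le\<close>.
  The points \<open>r0 / 2\<close> and \<open>4 * r0\<close> lie strictly outside the support, so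
  \<phi> vanishes in a neighbourhood of each and its derivative vanishes there too.\<close>

lemma cutoff_profile:
  obtains g1 g2 where
    "\<And>t. ((\<lambda>t. \<phi> (of_real t)) has_real_derivative g1 t) (at t)"
    "\<And>t. (g1 has_real_derivative g2 t) (at t)"
    "continuous_on UNIV g2"
    "g1 (r0 / 2) = 0" "g1 (4 * r0) = 0"
proof -
  have C2: "C_k 2 \<phi>" using cut unfolding radial_cutoff_def C_infinity_def by blast
  define h1 where "h1 x = frechet_derivative \<phi> (at x) 1" for x
  define h2 where "h2 x = frechet_derivative h1 (at x) 1" for x
  have C: "\<phi> differentiable (at x)" "h1 differentiable (at x)" "continuous_on UNIV h2" for x
    using C2 unfolding numeral_2_eq_2 h1_def h2_def[unfolded h1_def] by auto
  have d: "((\<lambda>t. h (of_real t)) has_real_derivative frechet_derivative h (at (of_real t)) 1) (at t)"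
    if "\<And>x. h differentiable (at x)" for h :: "complex \<Rightarrow> real" and t :: real
  proof -
    have D: "(h has_derivative frechet_derivative h (at (of_real t))) (at (of_real t))"
      using that frechet_derivative_works by blast
    have "((\<lambda>t. h (of_real t)) has_derivative (\<lambda>x. frechet_derivative h (at (of_real t)) (of_real x))) (at t)"
      by (rule has_derivative_compose[where g = h and f = of_real, OF _ D]) (auto intro!: derivative_eq_intros)
    moreover have "frechet_derivative h (at (of_real t)) (of_real x)
        = frechet_derivative h (at (of_real t)) 1 * x" for x
      using linear_scale[OF has_derivative_linear[OF D], of x 1] by (simp add: scaleR_conv_of_real mult.commute)
    ultimately show ?thesis by (simp add: has_field_derivative_def mult_commute_abs)
  qed
  have d1: "((\<lambda>t. \<phi> (of_real t)) has_real_derivative h1 (of_real t)) (at t)" for t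
    unfolding h1_def by (rule d) (rule C)
  have zero: "h1 (of_real t) = 0" if t: "t \<in> S" and S: "open S" "\<And>s. s \<in> S \<Longrightarrow> \<phi> (of_real s) = 0" for t S
  proof -
    have "((\<lambda>t. \<phi> (of_real t)) has_real_derivative 0) (at t)"
      using has_field_derivative_transform_within_open[OF DERIV_const S(1) t, of 0 "\<lambda>t. \<phi> (of_real t)"] S(2) by auto
    then show ?thesis using d1 DERIV_unique by blast
  qed
  have out: "\<phi> (of_real s) = 0" if "\<not> (r0 \<le> \<bar>s\<bar> \<and> \<bar>s\<bar> \<le> 3 * r0)" for s :: real
    using cutoff_support[of "of_real s"] that by fastforce
  show ?thesis
  proof (rule that[of "\<lambda>t. h1 (of_real t)" "\<lambda>t. h2 (of_real t)"])
    show "((\<lambda>t. \<phi> (of_real t)) has_real_derivative h1 (of_real t)) (at t)" for t by (rule d1)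
    show "((\<lambda>t. h1 (of_real t)) has_real_derivative h2 (of_real t)) (at t)" for t
      unfolding h2_def by (rule d) (rule C)
    show "continuous_on UNIV (\<lambda>t::real. h2 (of_real t))"
      by (rule continuous_on_compose2[OF C(3)]) (auto intro: continuous_intros)
    show "h1 (of_real (r0 / 2)) = 0"
      by (rule zero[of _ "{-r0<..<r0}"]) (use r0 out in auto)
    show "h1 (of_real (4 * r0)) = 0"
      by (rule zero[of _ "{3 * r0<..}"]) (use r0 out in auto)
  qed
qed

end

section \<open>Gaussian estimates\<close>

text \<open>A bound for the mean modulus of a standard complex Gaussian: for
  \<open>n <= cmod z <= n + 1\<close> the integrand is at most
  \<open>(n + 1) * exp (- n ^ 2) / pi\<close>, and the enclosing disc has area
  \<open>pi * (n + 1) ^ 2\<close>.\<close>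

definition gauss_const :: real where
  "gauss_const = (\<Sum>n. real (Suc n) ^ 3 * exp (- (real n)\<^sup>2))"

lemma summable_gauss_const: "summable (\<lambda>n. real (Suc n) ^ 3 * exp (- (real n)\<^sup>2))"
proof (rule summable_comparison_test_bigo)
  show "summable (\<lambda>n. norm (1 / real n ^ 2))"
    using inverse_power_summable[of 2, where 'a = real] by (simp add: field_simps)
  show "(\<lambda>n. real (Suc n) ^ 3 * exp (- (real n)\<^sup>2)) \<in> O(\<lambda>n. 1 / real n ^ 2)"
    by real_asymp
qed

lemma gauss_const_nonneg: "gauss_const \<ge> 0"
  unfolding gauss_const_def by (intro suminf_nonneg summable_gauss_const) simp

text \<open>
  Bounds \<open>- ln \<bar>v\<bar>\<close> from above and is infinite at \<open>0\<close>, where \<open>ln\<close> has the junk value \<open>0\<close>.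
\<close>

definition log_sing :: "complex \<Rightarrow> ennreal" where
  "log_sing v = (\<Sum>m. indicator (cball 0 (exp (- real m))) v)"

lemma log_sing_measurable [measurable]: "log_sing \<in> borel_measurable borel"
proof -
  have [measurable]: "cball (0::complex) s \<in> sets borel" for s
    by (rule borel_closed) simp
  show ?thesis unfolding log_sing_def[abs_def] by measurable
qed

lemma log_sing_0: "log_sing 0 = \<infinity>"
proof -
  have "of_nat n \<le> log_sing 0" for n
  proof -
    have "(\<Sum>m<n. indicator (cball 0 (exp (- real m))) (0::complex)) \<le> log_sing 0"
      unfolding log_sing_def by (rule sum_le_suminf) auto
    then show ?thesis by simp
  qed
  then have "\<not> log_sing 0 \<le> of_nat n" for n
    using order_trans[of "of_nat (Suc n)" "log_sing 0" "of_nat n :: ennreal"] by (simp only: of_nat_le_iff) auto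
  then show ?thesis using ennreal_Ex_less_of_nat[of "log_sing 0"]
    by (metis infinity_ennreal_def less_imp_le top.not_eq_extremum)
qed

text \<open>At least \<open>- ln (cmod v)\<close> many indices \<open>m\<close> satisfy
  \<open>cmod v <= exp (- m)\<close>.\<close>

lemma ln_le_log_sing: "v \<noteq> 0 \<Longrightarrow> ennreal (- ln (cmod v)) \<le> log_sing v"
proof -
  assume v: "v \<noteq> 0"
  define N where "N = nat \<lceil>- ln (cmod v)\<rceil>"
  have "ennreal (- ln (cmod v)) \<le> ennreal (real N)"
    unfolding N_def by (intro ennreal_leI) linarith
  also have "\<dots> = (\<Sum>m<N. indicator (cball 0 (exp (- real m))) v)"
  proof -
    have "indicator (cball 0 (exp (- real m))) v = (1::ennreal)" if "m < N" for m
    proof -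
      have "real m \<le> - ln (cmod v)" using that unfolding N_def by linarith
      then have "exp (ln (cmod v)) \<le> exp (- real m)" by simp
      then show ?thesis using v by (simp add: indicator_def)
    qed
    then show ?thesis by (simp add: ennreal_of_nat_eq_real_of_nat)
  qed
  also have "\<dots> \<le> log_sing v"
    unfolding log_sing_def by (rule sum_le_suminf) auto
  finally show ?thesis .
qed

definition gauss_dens :: "complex \<Rightarrow> ennreal" where
  "gauss_dens z = ennreal (exp (- (cmod z)\<^sup>2) / pi)"

lemma gauss_dens_measurable [measurable]: "gauss_dens \<in> borel_measurable borel"
  unfolding gauss_dens_def[abs_def] by measurable

lemma emeasure_cball_complex: "s \<ge> 0 \<Longrightarrow> emeasure lborel (cball (c::complex) s) = ennreal (pi * s\<^sup>2)"
  by (simp add: emeasure_cball unit_ball_vol_2)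

text \<open>The density is at most \<open>1 / pi\<close>, so a disc of radius
  \<open>exp (- m)\<close> has probability at most \<open>exp (- 2 * m)\<close> wherever it is
  centred, and the geometric series stays below 2. Uniformity in \<open>w\<close> is what permits
  conditioning later.\<close>

lemma gauss_dens_log_sing: "(\<integral>\<^sup>+z. gauss_dens z * log_sing (z + w) \<partial>lborel) \<le> 2"
proof -
  have "(\<integral>\<^sup>+z. gauss_dens z * log_sing (z + w) \<partial>lborel)
      \<le> (\<integral>\<^sup>+z. (\<Sum>m. ennreal (1 / pi) * indicator (cball (- w) (exp (- real m))) z) \<partial>lborel)"
  proof (intro nn_integral_mono)
    fix z
    have "gauss_dens z \<le> ennreal (1 / pi)"
      unfolding gauss_dens_def by (intro ennreal_leI divide_right_mono) auto
    then have "gauss_dens z * log_sing (z + w) \<le> ennreal (1 / pi) * log_sing (z + w)"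
      by (rule mult_right_mono) simp
    also have "\<dots> = (\<Sum>m. ennreal (1 / pi) * indicator (cball (- w) (exp (- real m))) z)"
      unfolding log_sing_def
      by (subst ennreal_suminf_cmult[symmetric])
        (intro suminf_cong, auto simp: indicator_def dist_norm norm_minus_commute algebra_simps split: if_splits)
    finally show "gauss_dens z * log_sing (z + w) \<le> \<dots>" .
  qed
  also have "\<dots> = (\<Sum>m. \<integral>\<^sup>+z. ennreal (1 / pi) * indicator (cball (- w) (exp (- real m))) z \<partial>lborel)"
    by (intro nn_integral_suminf borel_measurable_times_ennreal borel_measurable_indicator)
      (auto intro: borel_closed)
  also have "\<dots> = (\<Sum>m. ennreal (exp (- 2) ^ m))"
  proof (intro suminf_cong)
    fix m
    have "(\<integral>\<^sup>+z. ennreal (1 / pi) * indicator (cball (- w) (exp (- real m))) z \<partial>lborel)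
        = ennreal (1 / pi) * ennreal (pi * (exp (- real m))\<^sup>2)"
      by (subst nn_integral_cmult_indicator) (simp_all add: emeasure_cball_complex)
    also have "\<dots> = ennreal ((exp (- real m))\<^sup>2)"
      by (subst ennreal_mult[symmetric]) auto
    also have "(exp (- real m))\<^sup>2 = exp (- 2) ^ m"
      by (simp add: exp_of_nat_mult[symmetric] power2_eq_square exp_add[symmetric])
    finally show "(\<integral>\<^sup>+z. ennreal (1 / pi) * indicator (cball (- w) (exp (- real m))) z \<partial>lborel)
        = ennreal (exp (- 2) ^ m)" .
  qed
  also have "\<dots> = ennreal (1 / (1 - exp (- 2)))"
    by (subst suminf_ennreal2) (auto intro!: summable_geometric simp: suminf_geometric)
  also have "\<dots> \<le> ennreal 2"
  proof (rule ennreal_leI)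
    have "1 + 2 \<le> exp (2::real)" by (rule exp_ge_add_one_self)
    then have "exp (- 2) \<le> (1::real) / 2" by (simp add: exp_minus field_simps)
    then show "1 / (1 - exp (- 2)) \<le> (2::real)" by (simp add: field_simps)
  qed
  finally show ?thesis by simp
qed

lemma gauss_dens_norm: "(\<integral>\<^sup>+z. gauss_dens z * ennreal (cmod z) \<partial>lborel) \<le> ennreal gauss_const"
proof -
  have "(\<integral>\<^sup>+z. gauss_dens z * ennreal (cmod z) \<partial>lborel)
      \<le> (\<integral>\<^sup>+z. (\<Sum>n. ennreal (real (Suc n) * exp (- (real n)\<^sup>2) / pi) * indicator (cball 0 (real (Suc n))) (z::complex)) \<partial>lborel)"
  proof (intro nn_integral_mono)
    fix z :: complex
    define n where "n = nat \<lfloor>cmod z\<rfloor>"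
    have "real n = of_int \<lfloor>cmod z\<rfloor>" by (simp add: n_def)
    then have n: "real n \<le> cmod z" "cmod z \<le> real (Suc n)" by linarith+
    have "gauss_dens z * ennreal (cmod z) = ennreal (cmod z * exp (- (cmod z)\<^sup>2) / pi)"
      by (simp add: gauss_dens_def mult.commute flip: ennreal_mult)
    also have "\<dots> \<le> ennreal (real (Suc n) * exp (- (real n)\<^sup>2) / pi)"
      using n by (intro ennreal_leI divide_right_mono mult_mono) (auto intro: power_mono)
    also have "\<dots> = ennreal (real (Suc n) * exp (- (real n)\<^sup>2) / pi) * indicator (cball 0 (real (Suc n))) z"
      using n(2) by (simp add: indicator_def)
    also have "\<dots> \<le> (\<Sum>n. ennreal (real (Suc n) * exp (- (real n)\<^sup>2) / pi) * indicator (cball 0 (real (Suc n))) z)"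
    proof -
      have "f n \<le> suminf f" for f :: "nat \<Rightarrow> ennreal"
        using sum_le_suminf[of f "{n}"] by simp
      then show ?thesis .
    qed
    finally show "gauss_dens z * ennreal (cmod z) \<le> \<dots>" .
  qed
  also have "\<dots> = (\<Sum>n. \<integral>\<^sup>+z. ennreal (real (Suc n) * exp (- (real n)\<^sup>2) / pi) * indicator (cball 0 (real (Suc n))) (z::complex) \<partial>lborel)"
    by (intro nn_integral_suminf borel_measurable_times_ennreal borel_measurable_indicator)
      (auto intro: borel_closed)
  also have "\<dots> = (\<Sum>n. ennreal (real (Suc n) ^ 3 * exp (- (real n)\<^sup>2)))"
  proof (intro suminf_cong)
    fix n
    have "(\<integral>\<^sup>+z. ennreal (real (Suc n) * exp (- (real n)\<^sup>2) / pi) * indicator (cball 0 (real (Suc n))) (z::complex) \<partial>lborel)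
      = ennreal (real (Suc n) * exp (- (real n)\<^sup>2) / pi) * ennreal (pi * (real (Suc n))\<^sup>2)"
      by (subst nn_integral_cmult_indicator) (simp_all add: emeasure_cball_complex del: of_nat_Suc)
    also have "\<dots> = ennreal (real (Suc n) ^ 3 * exp (- (real n)\<^sup>2))"
      by (subst ennreal_mult[symmetric]) (auto simp: power2_eq_square power3_eq_cube mult_ac simp del: of_nat_Suc)
    finally show "(\<integral>\<^sup>+z. ennreal (real (Suc n) * exp (- (real n)\<^sup>2) / pi) * indicator (cball 0 (real (Suc n))) (z::complex) \<partial>lborel)
      = ennreal (real (Suc n) ^ 3 * exp (- (real n)\<^sup>2))" .
  qed
  also have "\<dots> = ennreal gauss_const"
    unfolding gauss_const_def by (rule suminf_ennreal2[OF _ summable_gauss_const]) simp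
  finally show ?thesis .
qed

section \<open>The deterministic majorant and its maximal term\<close>

definition majorant_term :: "nat set \<Rightarrow> real \<Rightarrow> nat \<Rightarrow> real" where
  "majorant_term A r k = (if k \<in> A then r ^ k / sqrt (fact k) else 0)"

definition majorant :: "nat set \<Rightarrow> real \<Rightarrow> real" where
  "majorant A r = (\<Sum>k. majorant_term A r k)"

lemma majorant_term_nonneg: "r \<ge> 0 \<Longrightarrow> majorant_term A r k \<ge> 0"
  by (simp add: majorant_term_def)

text \<open>The inequality \<open>2 * p * q <= p ^ 2 + q ^ 2\<close>, after a factor
  \<open>2 ^ k\<close> is borrowed under the root of the first factor so that the second becomes a
  geometric sequence.\<close>

lemma majorant_term_le:
  assumes "r \<ge> 0"
  shows "majorant_term A r k \<le> ((2 * r\<^sup>2) ^ k / fact k + (1 / 2) ^ k) / 2"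
proof -
  define p where "p = sqrt ((2 * r\<^sup>2) ^ k / fact k)"
  define q where "q = sqrt ((1 / 2) ^ k)"
  have "p * q = sqrt ((r ^ k)\<^sup>2 / fact k)"
    unfolding p_def q_def real_sqrt_mult[symmetric]
    by (simp add: power_mult_distrib power_divide power2_eq_square)
  also have "\<dots> = r ^ k / sqrt (fact k)"
    using assms by (simp add: real_sqrt_divide)
  finally have pq: "r ^ k / sqrt (fact k) = p * q" ..
  have "2 * (p * q) \<le> p\<^sup>2 + q\<^sup>2" using sum_squares_bound[of p q] by simp
  also have "\<dots> = (2 * r\<^sup>2) ^ k / fact k + (1 / 2) ^ k"
    by (simp add: p_def q_def)
  finally show ?thesis by (auto simp: majorant_term_def pq)
qed

lemma majorant_dominating_sums:
  "(\<lambda>k. ((2 * r\<^sup>2) ^ k / fact k + (1 / 2) ^ k) / 2) sums ((exp (2 * r\<^sup>2) + 2) / 2 :: real)"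
proof -
  have "(\<lambda>k. (2 * r\<^sup>2) ^ k / fact k) sums exp (2 * r\<^sup>2)"
    using exp_converges[of "2 * r\<^sup>2"] by (simp add: divide_inverse mult.commute)
  moreover have "(\<lambda>k. (1 / 2 :: real) ^ k) sums 2"
    using geometric_sums[of "1 / 2 :: real"] by simp
  ultimately show ?thesis by (intro sums_divide sums_add)
qed

lemma summable_majorant: "r \<ge> 0 \<Longrightarrow> summable (majorant_term A r)"
proof (rule summable_comparison_test'[OF sums_summable[OF majorant_dominating_sums[of r]]])
  fix k assume "r \<ge> 0"
  then show "norm (majorant_term A r k) \<le> ((2 * r\<^sup>2) ^ k / fact k + (1 / 2) ^ k) / 2"
    using majorant_term_le[of r A k] majorant_term_nonneg[of r A k] by (simp only: real_norm_def abs_of_nonneg)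
qed

lemma majorant_ge_1: "r \<ge> 0 \<Longrightarrow> 0 \<in> A \<Longrightarrow> majorant A r \<ge> 1"
  using sum_le_suminf[OF summable_majorant, of r "{0}" A] majorant_term_nonneg[of r A]
  by (simp add: majorant_def majorant_term_def[of A r 0])

text \<open>This quadratic growth is what bounds the mean number of zeros in a disc of radius
  \<open>R\<close> by \<open>O(1 + R ^ 2)\<close>.\<close>

lemma ln_majorant_le: "r \<ge> 0 \<Longrightarrow> 0 \<in> A \<Longrightarrow> ln (majorant A r) \<le> 2 * r\<^sup>2 + 1"
proof -
  assume r: "r \<ge> 0" and A: "0 \<in> A"
  have "majorant A r \<le> (exp (2 * r\<^sup>2) + 2) / 2"
    unfolding majorant_def
    using sums_unique[OF majorant_dominating_sums[of r]] sums_summable[OF majorant_dominating_sums[of r]]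
    by (metis (no_types, lifting) suminf_le majorant_term_le r summable_majorant)
  also have "\<dots> \<le> exp (2 * r\<^sup>2) * 2"
  proof -
    have *: "(e + 2) / 2 \<le> e * 2" if "e \<ge> 1" for e :: real using that by simp
    show ?thesis by (rule *) simp
  qed
  also have "\<dots> \<le> exp (2 * r\<^sup>2) * exp 1"
    using exp_ge_add_one_self[of 1] by (intro mult_left_mono) auto
  finally have "majorant A r \<le> exp (2 * r\<^sup>2 + 1)" by (simp add: exp_add)
  then have "ln (majorant A r) \<le> ln (exp (2 * r\<^sup>2 + 1))"
    using majorant_ge_1[OF r A] by (subst ln_le_cancel_iff) auto
  then show ?thesis by simp
qed

text \<open>
  Beyond index \<open>4 r\<^sup>2\<close> the terms decay geometrically with ratio at most \<open>1 / 2\<close>, so the largest of the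
  first terms controls the whole series.
\<close>

lemma maximal_term:
  assumes r: "r > 0" and A: "0 \<in> A" and down: "\<And>i j. i \<le> j \<Longrightarrow> j \<in> A \<Longrightarrow> i \<in> A"
  obtains k where "k \<in> A" "majorant A r \<le> (4 * r\<^sup>2 + 3) * (r ^ k / sqrt (fact k))"
proof -
  define c where "c k = r ^ k / sqrt (fact k)" for k
  \<comment> \<open>Consecutive terms have ratio \<open>r / sqrt (i + 1)\<close>, which is at most 1
    / 2 once \<open>i >= 4 * r ^ 2\<close>.\<close>
  define m where "m = nat \<lceil>4 * r\<^sup>2\<rceil>"
  have m: "4 * r\<^sup>2 \<le> real m" "real m \<le> 4 * r\<^sup>2 + 1" 
  proof -
    have "0 \<le> \<lceil>4 * r\<^sup>2\<rceil>" using ceiling_mono[of 0 "4 * r\<^sup>2"] by simp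
    then have "real m = of_int \<lceil>4 * r\<^sup>2\<rceil>" by (simp add: m_def)
    then show "4 * r\<^sup>2 \<le> real m" "real m \<le> 4 * r\<^sup>2 + 1" by linarith+
  qed
  have fin: "finite (A \<inter> {..m})" "A \<inter> {..m} \<noteq> {}" using A by auto
  obtain k where k: "k \<in> A \<inter> {..m}" and max: "\<And>i. i \<in> A \<inter> {..m} \<Longrightarrow> c i \<le> c k"
  proof -
    have "Max (c ` (A \<inter> {..m})) \<in> c ` (A \<inter> {..m})" using fin by (intro Max_in) auto
    then obtain k where "k \<in> A \<inter> {..m}" "c k = Max (c ` (A \<inter> {..m}))" by force
    then show ?thesis using that fin by (metis Max_ge finite_imageI imageI)
  qed
  have ck: "c k > 0" using r by (simp add: c_def)
  have step: "c (Suc i) \<le> c i / 2" if "i \<ge> m" for i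
  proof -
    have "4 * r\<^sup>2 \<le> real (Suc i)" using m(1) that by simp
    then have "sqrt (4 * r\<^sup>2) \<le> sqrt (real (Suc i))" by (rule real_sqrt_le_mono)
    then have "2 * r \<le> sqrt (real (Suc i))" using r by (simp add: real_sqrt_mult)
    then have *: "r / sqrt (real (Suc i)) \<le> 1 / 2" by (simp add: field_simps del: of_nat_Suc)
    have "c (Suc i) = c i * (r / sqrt (real (Suc i)))"
      by (simp add: c_def real_sqrt_mult mult_ac del: of_nat_Suc)
    also have "\<dots> \<le> c i * (1 / 2)" using * r by (intro mult_left_mono) (auto simp: c_def)
    finally show ?thesis by simp
  qed
  have dec: "c (m + i) \<le> c m * (1 / 2) ^ i" for i
  proof (induction i)
    case (Suc i)
    have "c (m + Suc i) \<le> c (m + i) / 2" using step[of "m + i"] by simp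
    also have "\<dots> \<le> c m * (1 / 2) ^ i / 2" using Suc by simp
    finally show ?case by simp
  qed simp
  have tail: "majorant_term A r (Suc m + i) \<le> c k * (1 / 2) ^ Suc i" for i
  proof (cases "Suc m + i \<in> A")
    case True
    \<comment> \<open>Downward closure enters here: an index of \<open>A\<close> beyond
      \<open>m\<close> forces \<open>m\<close> into \<open>A\<close>, so the tail is compared with a
      term that took part in the maximum.\<close>
    then have "m \<in> A" using down by (meson le_add1 le_Suc_eq le_trans lessI less_imp_le)
    then have "c m \<le> c k" using max[of m] by simp
    have "c (m + Suc i) \<le> c m * (1 / 2) ^ Suc i" by (rule dec)
    also have "\<dots> \<le> c k * (1 / 2) ^ Suc i" using \<open>c m \<le> c k\<close> by (intro mult_right_mono) auto
    finally show ?thesis using True by (simp add: majorant_term_def c_def)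
  qed (use ck in \<open>simp add: majorant_term_def\<close>)
  have sm: "summable (majorant_term A r)" using r by (intro summable_majorant) simp
  have half: "(\<lambda>i. c k * (1 / 2) ^ Suc i) sums (c k * 1)"
    by (intro sums_mult power_half_series)
  have "majorant A r = (\<Sum>i. majorant_term A r (i + Suc m)) + (\<Sum>i<Suc m. majorant_term A r i)"
    unfolding majorant_def using suminf_split_initial_segment[OF sm, of "Suc m"] .
  also have "(\<Sum>i. majorant_term A r (i + Suc m)) \<le> c k"
  proof -
    have "(\<Sum>i. majorant_term A r (i + Suc m)) \<le> (\<Sum>i. c k * (1 / 2) ^ Suc i)"
      using tail by (intro suminf_le summable_ignore_initial_segment[OF sm] sums_summable[OF half])
        (simp add: add.commute)
    then show ?thesis using half by (simp add: sums_iff)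
  qed
  also have "(\<Sum>i<Suc m. majorant_term A r i) \<le> (\<Sum>i<Suc m. c k)"
    using max ck by (intro sum_mono) (auto simp: majorant_term_def c_def less_Suc_eq_le)
  \<comment> \<open>The first \<open>m + 1\<close> terms cost \<open>c k\<close> each, and the
    geometric tail costs one more.\<close>
  also have "c k + (\<Sum>i<Suc m. c k) = (real m + 2) * c k" by (simp add: algebra_simps)
  also have "\<dots> \<le> (4 * r\<^sup>2 + 3) * c k" using m ck by (intro mult_right_mono) auto
  finally show ?thesis using that[of k] k by (simp add: c_def)
qed

lemma gaf_holomorphic: "gaf a holomorphic_on UNIV"
proof (cases "\<forall>w. summable (\<lambda>k. a k / complex_of_real (sqrt (fact k)) * w ^ k)")
  case True
  then have "gaf a = (\<lambda>z. \<Sum>k. a k / complex_of_real (sqrt (fact k)) * z ^ k)"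
    by (simp add: gaf_def fun_eq_iff)
  moreover have "(\<lambda>z. \<Sum>k. a k / complex_of_real (sqrt (fact k)) * z ^ k) holomorphic_on UNIV"
    unfolding holomorphic_on_def
  proof
    fix z
    show "(\<lambda>z. \<Sum>k. a k / complex_of_real (sqrt (fact k)) * z ^ k) field_differentiable at z within UNIV"
      using termdiffs_strong_converges_everywhere[of "\<lambda>k. a k / complex_of_real (sqrt (fact k))" z] True
      unfolding field_differentiable_def by auto
  qed
  ultimately show ?thesis by simp
next
  case False
  then have "gaf a = (\<lambda>z. 0)" by (auto simp: gaf_def fun_eq_iff)
  then show ?thesis by simp
qed

text \<open>Lets one family indexed by sets \<open>A\<close> cover the truncations and the full
  series, so that each estimate is proved once and with common constants.\<close>

lemma gaf_trunc_eq_gaf: "gaf_trunc n a = gaf (\<lambda>k. if k \<in> {..n} then a k else 0)"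
proof
  fix z
  let ?f = "\<lambda>w k. (if k \<in> {..n} then a k else 0) / complex_of_real (sqrt (fact k)) * w ^ k"
  have *: "?f w sums (\<Sum>k\<in>{..n}. ?f w k)" for w
    by (rule sums_finite) auto
  then have "gaf (\<lambda>k. if k \<in> {..n} then a k else 0) z = (\<Sum>k\<in>{..n}. ?f z k)"
    unfolding gaf_def by (metis (no_types, lifting) sums_summable sums_unique)
  also have "\<dots> = gaf_trunc n a z"
    unfolding gaf_trunc_def by (intro sum.cong) auto
  finally show "gaf_trunc n a z = gaf (\<lambda>k. if k \<in> {..n} then a k else 0) z" ..
qed

section \<open>The random entire function\<close>

lemma two_mult_ennreal: "a \<ge> 0 \<Longrightarrow> 2 * ennreal a = ennreal (2 * a)"
  using ennreal_mult[of 2 a] by simp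

locale gaussian_sequence = prob_space M for M :: "'a measure" +
  fixes \<xi> :: "nat \<Rightarrow> 'a \<Rightarrow> complex"
  assumes indep: "indep_vars (\<lambda>_. borel) \<xi> UNIV"
    and gauss: "std_complex_gaussian M (\<xi> k)"
begin

lemma measurable_xi [measurable]: "\<xi> k \<in> borel_measurable M"
  using gauss[of k] by (auto simp: std_complex_gaussian_def distributed_def)

lemma nn_integral_xi:
  assumes "g \<in> borel_measurable borel"
  shows "(\<integral>\<^sup>+x. g (\<xi> k x) \<partial>M) = (\<integral>\<^sup>+z. gauss_dens z * g z \<partial>lborel)"
  using distributed_nn_integral[of M lborel "\<xi> k" _ g] gauss[of k] assms
  unfolding std_complex_gaussian_def gauss_dens_def by simp

lemma nn_integral_norm_xi: "(\<integral>\<^sup>+x. ennreal (cmod (\<xi> k x)) \<partial>M) \<le> ennreal gauss_const"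
  using nn_integral_xi[of "\<lambda>z. ennreal (cmod z)" k] gauss_dens_norm by simp

text \<open>Independence makes the joint law a product; for each fixed value \<open>w\<close> of
  \<open>Y\<close> the inner integral is at most 2, uniformly in \<open>w\<close>.\<close>

lemma indep_log_sing:
  assumes "indep_var borel (\<xi> k) borel Y"
  shows "(\<integral>\<^sup>+x. log_sing (\<xi> k x + Y x) \<partial>M) \<le> 2"
proof -
  have Y[measurable]: "Y \<in> borel_measurable M" using indep_var_rv2[OF assms] .
  interpret X: prob_space "distr M borel (\<xi> k)" by (rule prob_space_distr) simp
  interpret Y: prob_space "distr M borel Y" by (rule prob_space_distr) simp
  interpret pair_sigma_finite "distr M borel (\<xi> k)" "distr M borel Y" ..
  have "(\<integral>\<^sup>+x. log_sing (\<xi> k x + Y x) \<partial>M)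
      = (\<integral>\<^sup>+p. log_sing (fst p + snd p) \<partial>distr M (borel \<Otimes>\<^sub>M borel) (\<lambda>x. (\<xi> k x, Y x)))"
    by (subst nn_integral_distr) auto
  also have "\<dots> = (\<integral>\<^sup>+p. log_sing (fst p + snd p) \<partial>(distr M borel (\<xi> k) \<Otimes>\<^sub>M distr M borel Y))"
    using assms by (simp add: indep_var_distribution_eq)
  also have "\<dots> = (\<integral>\<^sup>+w. \<integral>\<^sup>+z. log_sing (z + w) \<partial>distr M borel (\<xi> k) \<partial>distr M borel Y)"
    by (subst nn_integral_snd[symmetric]) auto
  also have "\<dots> \<le> (\<integral>\<^sup>+w. 2 \<partial>distr M borel Y)"
  proof (rule nn_integral_mono)
    fix w
    have "(\<integral>\<^sup>+z. log_sing (z + w) \<partial>distr M borel (\<xi> k)) = (\<integral>\<^sup>+x. log_sing (\<xi> k x + w) \<partial>M)"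
      by (subst nn_integral_distr) auto
    also have "\<dots> = (\<integral>\<^sup>+z. gauss_dens z * log_sing (z + w) \<partial>lborel)"
      by (rule nn_integral_xi) measurable
    finally show "(\<integral>\<^sup>+z. log_sing (z + w) \<partial>distr M borel (\<xi> k)) \<le> 2"
      using gauss_dens_log_sing by simp
  qed
  also have "\<dots> = 2" using Y.emeasure_space_1 by simp
  finally show ?thesis .
qed

definition gaf_term :: "nat set \<Rightarrow> 'a \<Rightarrow> complex \<Rightarrow> nat \<Rightarrow> complex" where
  "gaf_term A x z k = (if k \<in> A then \<xi> k x else 0) / complex_of_real (sqrt (fact k)) * z ^ k"

definition random_gaf :: "nat set \<Rightarrow> 'a \<Rightarrow> complex \<Rightarrow> complex" where
  "random_gaf A x = gaf (\<lambda>k. if k \<in> A then \<xi> k x else 0)"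

text \<open>Extended-valued, hence meaningful and measurable on the whole sample space, also where
  the series diverges.\<close>

definition abs_gaf :: "nat set \<Rightarrow> 'a \<Rightarrow> real \<Rightarrow> ennreal" where
  "abs_gaf A x r = (\<Sum>k. ennreal (cmod (\<xi> k x) * majorant_term A r k))"

lemma norm_gaf_term: "cmod (gaf_term A x z k) = cmod (\<xi> k x) * majorant_term A (cmod z) k"
  by (simp add: gaf_term_def majorant_term_def norm_mult norm_divide norm_power)

lemma measurable_abs_gaf [measurable]: "(\<lambda>x. abs_gaf A x r) \<in> borel_measurable M"
  unfolding abs_gaf_def by measurable

lemma nn_integral_abs_gaf:
  assumes r: "r \<ge> 0"
  shows "(\<integral>\<^sup>+x. abs_gaf A x r \<partial>M) \<le> ennreal (gauss_const * majorant A r)"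
proof -
  note nn = majorant_term_nonneg[OF r]
  have "(\<integral>\<^sup>+x. abs_gaf A x r \<partial>M) = (\<Sum>k. \<integral>\<^sup>+x. ennreal (cmod (\<xi> k x) * majorant_term A r k) \<partial>M)"
    unfolding abs_gaf_def by (rule nn_integral_suminf) measurable
  also have "\<dots> \<le> (\<Sum>k. ennreal (gauss_const * majorant_term A r k))"
  proof (intro suminf_le)
    fix k
    have "(\<integral>\<^sup>+x. ennreal (cmod (\<xi> k x) * majorant_term A r k) \<partial>M)
        = (\<integral>\<^sup>+x. ennreal (cmod (\<xi> k x)) \<partial>M) * ennreal (majorant_term A r k)"
      using nn by (subst nn_integral_multc[symmetric]) (auto simp: ennreal_mult)
    also have "\<dots> \<le> ennreal gauss_const * ennreal (majorant_term A r k)"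
      by (intro mult_right_mono nn_integral_norm_xi) auto
    finally show "(\<integral>\<^sup>+x. ennreal (cmod (\<xi> k x) * majorant_term A r k) \<partial>M)
        \<le> ennreal (gauss_const * majorant_term A r k)"
      using nn gauss_const_nonneg by (simp add: ennreal_mult)
  qed auto
  also have "\<dots> = ennreal (gauss_const * majorant A r)"
    unfolding majorant_def using nn gauss_const_nonneg summable_majorant[OF r]
    by (subst suminf_ennreal2) (auto intro!: summable_mult simp: suminf_mult)
  finally show ?thesis .
qed

text \<open>Integer radii give absolute convergence at every point and for every index set at once.
  The nonzero constant term keeps the function away from 0 at the origin, without which the
  Jensen-type bound would be empty.\<close>

definition entire_event :: "'a \<Rightarrow> bool" where
  "entire_event x \<longleftrightarrow> (\<forall>n::nat. abs_gaf UNIV x (real n) < \<infinity>) \<and> \<xi> 0 x \<noteq> 0"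

text \<open>\<open>log_sing\<close> has finite mean under the Gaussian law but is infinite at
  0.\<close>

lemma AE_xi_nonzero: "AE x in M. \<xi> k x \<noteq> 0"
proof -
  have "(\<integral>\<^sup>+x. log_sing (\<xi> k x) \<partial>M) \<le> 2"
    using nn_integral_xi[of log_sing k] gauss_dens_log_sing[of 0] by simp
  then have "(\<integral>\<^sup>+x. log_sing (\<xi> k x) \<partial>M) \<noteq> \<infinity>" by (auto simp: top_unique)
  then have "AE x in M. log_sing (\<xi> k x) \<noteq> \<infinity>"
    by (intro nn_integral_PInf_AE) auto
  then show ?thesis by eventually_elim (auto simp: log_sing_0)
qed

lemma AE_entire_event: "AE x in M. entire_event x"
proof -
  have "AE x in M. abs_gaf UNIV x (real n) < \<infinity>" for n
  proof -
    have "(\<integral>\<^sup>+x. abs_gaf UNIV x (real n) \<partial>M) \<noteq> \<infinity>"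
      using nn_integral_abs_gaf[of "real n" UNIV] by (auto simp: top_unique)
    then have "AE x in M. abs_gaf UNIV x (real n) \<noteq> \<infinity>"
      by (intro nn_integral_PInf_AE) auto
    then show ?thesis by (simp add: less_top)
  qed
  then show ?thesis
    unfolding entire_event_def AE_conj_iff AE_all_countable using AE_xi_nonzero by blast
qed

lemma entire_event_summable:
  assumes "entire_event x"
  shows "summable (\<lambda>k. cmod (gaf_term A x z k))"
proof -
  define n where "n = nat \<lceil>cmod z\<rceil>"
  have n: "cmod z \<le> real n" unfolding n_def by linarith
  have "abs_gaf UNIV x (real n) < \<infinity>" using assms by (simp add: entire_event_def)
  then have "summable (\<lambda>k. cmod (\<xi> k x) * majorant_term UNIV (real n) k)"
    unfolding abs_gaf_def by (intro summable_suminf_not_top) (auto simp: majorant_term_nonneg)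
  then show ?thesis
  proof (rule summable_comparison_test'[where N = 0])
    fix k
    have "majorant_term A (cmod z) k \<le> majorant_term UNIV (real n) k"
      using n by (auto simp: majorant_term_def intro!: divide_right_mono power_mono)
    then show "norm (cmod (gaf_term A x z k)) \<le> cmod (\<xi> k x) * majorant_term UNIV (real n) k"
      by (auto simp: norm_gaf_term majorant_term_nonneg abs_mult mult_left_mono)
  qed
qed

lemma random_gaf_eq_suminf:
  assumes "entire_event x"
  shows "random_gaf A x z = (\<Sum>k. gaf_term A x z k)"
  using summable_norm_cancel[OF entire_event_summable[OF assms, of A]]
  unfolding random_gaf_def gaf_def gaf_term_def by simp

lemma abs_gaf_eq:
  assumes "entire_event x"
  shows "abs_gaf A x (cmod z) = ennreal (\<Sum>k. cmod (gaf_term A x z k))"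
  unfolding abs_gaf_def norm_gaf_term[where z = z, symmetric]
  by (rule suminf_ennreal2) (auto intro: entire_event_summable[OF assms])

lemma norm_random_gaf_le:
  assumes "entire_event x"
  shows "ennreal (cmod (random_gaf A x z)) \<le> abs_gaf A x (cmod z)"
  using summable_norm[OF entire_event_summable[OF assms]]
  unfolding random_gaf_eq_suminf[OF assms] abs_gaf_eq[OF assms] by (intro ennreal_leI)

lemma random_gaf_0:
  assumes "entire_event x" "0 \<in> A"
  shows "random_gaf A x 0 = \<xi> 0 x"
proof -
  have "(\<lambda>k. gaf_term A x 0 k) sums (\<Sum>k\<in>{0}. gaf_term A x 0 k)"
    by (rule sums_finite) (auto simp: gaf_term_def)
  then show ?thesis
    using assms by (simp add: random_gaf_eq_suminf sums_iff gaf_term_def)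
qed

lemma entire_nonzero_random_gaf:
  assumes "entire_event x" "0 \<in> A"
  shows "entire_nonzero (random_gaf A x)"
proof
  show "random_gaf A x holomorphic_on UNIV"
    unfolding random_gaf_def by (rule gaf_holomorphic)
  have "random_gaf A x 0 \<noteq> 0"
    using random_gaf_0[OF assms] assms(1) by (simp add: entire_event_def)
  then show "\<exists>z. random_gaf A x z \<noteq> 0" by blast
qed

text \<open>
  Writing the value at \<open>z\<close> as a multiple of \<open>\<xi> k + Y\<close> with \<open>Y\<close> independent of \<open>\<xi> k\<close>, where \<open>k\<close> is the
  index of the maximal term, the logarithm can only be very negative if \<open>\<xi> k\<close> is close to \<open>- Y\<close>.
\<close>

lemma nn_integral_ln_random_gaf:
  assumes r: "r > 0" "cmod z = r" and A: "0 \<in> A" "\<And>i j. i \<le> j \<Longrightarrow> j \<in> A \<Longrightarrow> i \<in> A"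
  shows "(\<integral>\<^sup>+x. ennreal \<bar>ln (cmod (random_gaf A x z)) - ln (majorant A r)\<bar> \<partial>M)
    \<le> ennreal (gauss_const + 2 + ln (4 * r\<^sup>2 + 3))"
proof -
  obtain k where k: "k \<in> A" and max: "majorant A r \<le> (4 * r\<^sup>2 + 3) * (r ^ k / sqrt (fact k))"
    using maximal_term[OF r(1) A] .
  define T where "T = majorant A r"
  have T: "T \<ge> 1" unfolding T_def using r A by (intro majorant_ge_1) auto
  define b where "b = z ^ k / complex_of_real (sqrt (fact k))"
  have b: "b \<noteq> 0" "cmod b = r ^ k / sqrt (fact k)"
    using r by (auto simp: b_def norm_divide norm_power)
  define Y where "Y x = (\<Sum>i. if i = k then 0 else gaf_term A x z i) / b" for x
  have indepY: "indep_var borel (\<xi> k) borel Y"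
  proof -
    \<comment> \<open>Exhibits \<open>Y\<close> as a measurable function of the coefficients other
      than \<open>\<xi> k\<close>, so that independence of disjoint groups of coordinates
      applies.\<close>
    define g where "g \<omega> = (\<Sum>i. if i = k \<or> i \<notin> A then 0 else \<omega> i / complex_of_real (sqrt (fact i)) * z ^ i) / b" for \<omega> :: "nat \<Rightarrow> complex"
    have g[measurable]: "g \<in> borel_measurable (Pi\<^sub>M (- {k}) (\<lambda>_. borel))"
    proof -
      have "(\<lambda>\<omega>::nat \<Rightarrow> complex. if i = k \<or> i \<notin> A then 0 else \<omega> i / complex_of_real (sqrt (fact i)) * z ^ i)
          \<in> borel_measurable (Pi\<^sub>M (- {k}) (\<lambda>_. borel))" for i
        by (cases "i = k") auto
      then show ?thesis unfolding g_def by measurable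
    qed
    have h[measurable]: "(\<lambda>\<omega>. \<omega> k) \<in> borel_measurable (Pi\<^sub>M {k} (\<lambda>_. borel :: complex measure))"
      by measurable
    have "indep_var borel ((\<lambda>\<omega>. \<omega> k) \<circ> (\<lambda>\<omega>. restrict (\<lambda>i. \<xi> i \<omega>) {k})) borel (g \<circ> (\<lambda>\<omega>. restrict (\<lambda>i. \<xi> i \<omega>) (- {k})))"
      by (rule indep_var_compose[OF indep_var_restrict[OF indep] h g]) auto
    moreover have "(\<lambda>\<omega>. \<omega> k) \<circ> (\<lambda>\<omega>. restrict (\<lambda>i. \<xi> i \<omega>) {k}) = \<xi> k" by auto
    moreover have "g \<circ> (\<lambda>\<omega>. restrict (\<lambda>i. \<xi> i \<omega>) (- {k})) = Y"
    proof
      fix x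
      have "(\<Sum>i. if i = k \<or> i \<notin> A then 0 else restrict (\<lambda>i. \<xi> i x) (- {k}) i / complex_of_real (sqrt (fact i)) * z ^ i)
          = (\<Sum>i. if i = k then 0 else gaf_term A x z i)"
        by (intro suminf_cong) (auto simp: gaf_term_def)
      then show "(g \<circ> (\<lambda>\<omega>. restrict (\<lambda>i. \<xi> i \<omega>) (- {k}))) x = Y x"
        by (simp add: g_def Y_def)
    qed
    ultimately show ?thesis by simp
  qed
  have [measurable]: "Y \<in> borel_measurable M" using indep_var_rv2[OF indepY] .
  have split: "random_gaf A x z = b * (\<xi> k x + Y x)" if x: "entire_event x" for x
  proof -
    have sm: "summable (gaf_term A x z)"
      by (rule summable_norm_cancel[OF entire_event_summable[OF x]])
    have 1: "(\<lambda>i. if i = k then gaf_term A x z k else 0) sums gaf_term A x z k"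
      using sums_single[of k "\<lambda>_. gaf_term A x z k"] by (simp add: eq_commute)
    have "(\<lambda>i. gaf_term A x z i - (if i = k then gaf_term A x z k else 0)) sums (suminf (gaf_term A x z) - gaf_term A x z k)"
      by (intro sums_diff summable_sums sm 1)
    also have "(\<lambda>i. gaf_term A x z i - (if i = k then gaf_term A x z k else 0)) = (\<lambda>i. if i = k then 0 else gaf_term A x z i)"
      by auto
    finally have "Y x = (random_gaf A x z - gaf_term A x z k) / b"
      by (simp add: Y_def sums_iff random_gaf_eq_suminf[OF x])
    moreover have "gaf_term A x z k = b * \<xi> k x" using k by (simp add: gaf_term_def b_def)
    ultimately show ?thesis using b by (simp add: field_simps)
  qed
  have lnb: "ln T - ln (cmod b) \<le> ln (4 * r\<^sup>2 + 3)" "cmod b > 0"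
  proof -
    show b0: "cmod b > 0" using b(1) by (rule zero_less_norm_iff[THEN iffD2])
    have "4 * r\<^sup>2 + 3 > 0" using zero_le_power2[of r] by linarith
    then have "ln ((4 * r\<^sup>2 + 3) * cmod b) = ln (4 * r\<^sup>2 + 3) + ln (cmod b)"
      using b0 by (intro ln_mult_pos)
    moreover have "ln T \<le> ln ((4 * r\<^sup>2 + 3) * cmod b)"
      using max T unfolding T_def b(2) by (subst ln_le_cancel_iff) auto
    ultimately show "ln T - ln (cmod b) \<le> ln (4 * r\<^sup>2 + 3)" by simp
  qed
  have ln43: "ln (4 * r\<^sup>2 + 3) \<ge> 0" using zero_le_power2[of r] by (intro ln_ge_zero) linarith
  have "(\<integral>\<^sup>+x. ennreal \<bar>ln (cmod (random_gaf A x z)) - ln T\<bar> \<partial>M)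
      \<le> (\<integral>\<^sup>+x. abs_gaf A x r * ennreal (1 / T) + ennreal (ln (4 * r\<^sup>2 + 3)) + log_sing (\<xi> k x + Y x) \<partial>M)"
  proof (rule nn_integral_mono_AE)
    show "AE x in M. ennreal \<bar>ln (cmod (random_gaf A x z)) - ln T\<bar>
        \<le> abs_gaf A x r * ennreal (1 / T) + ennreal (ln (4 * r\<^sup>2 + 3)) + log_sing (\<xi> k x + Y x)"
      using AE_entire_event
    proof eventually_elim
      case (elim x)
      define v where "v = \<xi> k x + Y x"
      define F where "F = random_gaf A x z"
      have F: "F = b * v" using split[OF elim] by (simp add: F_def v_def)
      show ?case
      \<comment> \<open>At a zero of the function the right-hand side is infinite, so the convention
        \<open>ln 0 = 0\<close> on the left does no harm.\<close>
      proof (cases "v = 0")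
        case True
        then show ?thesis by (simp add: v_def[symmetric] log_sing_0)
      next
        case False
        then have F0: "cmod F > 0" using F b by simp
        \<comment> \<open>Upper side: \<open>ln x <= x\<close> at \<open>x = cmod F / T\<close>, a
          quantity whose mean is at most \<open>gauss_const\<close>.\<close>
        have "ln (cmod F) - ln T = ln (cmod F / T)" using F0 T by (simp add: ln_div)
        also have "\<dots> \<le> cmod F / T"
          using ln_le_minus_one[of "cmod F / T"] F0 T by simp
        finally have up: "ln (cmod F) - ln T \<le> cmod F * (1 / T)" by simp
        \<comment> \<open>Lower side: \<open>cmod b\<close> is at least
          \<open>T / (4 * r ^ 2 + 3)\<close> by the choice of \<open>k\<close>, which leaves only
          the singular part \<open>ln (cmod v)\<close>.\<close>
        have "ln (cmod F) = ln (cmod b) + ln (cmod v)"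
          using F b(1) False by (simp add: norm_mult ln_mult_pos)
        then have low: "ln T - ln (cmod F) \<le> ln (4 * r\<^sup>2 + 3) + max 0 (- ln (cmod v))"
          using lnb by simp
        have "ennreal \<bar>ln (cmod F) - ln T\<bar> \<le> ennreal (cmod F * (1 / T) + ln (4 * r\<^sup>2 + 3) + max 0 (- ln (cmod v)))"
        proof (rule ennreal_leI)
          have "cmod F * (1 / T) \<ge> 0" using T by simp
          then show "\<bar>ln (cmod F) - ln T\<bar> \<le> cmod F * (1 / T) + ln (4 * r\<^sup>2 + 3) + max 0 (- ln (cmod v))"
            using up low ln43 by linarith
        qed
        also have "\<dots> = ennreal (cmod F) * ennreal (1 / T) + ennreal (ln (4 * r\<^sup>2 + 3)) + ennreal (- ln (cmod v))"
          using T ln43 by (simp add: ennreal_plus ennreal_mult[symmetric] max_def ennreal_neg)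
        also have "\<dots> \<le> abs_gaf A x r * ennreal (1 / T) + ennreal (ln (4 * r\<^sup>2 + 3)) + log_sing v"
          using norm_random_gaf_le[OF elim, of A z] ln_le_log_sing[OF False] r
          by (intro add_mono mult_right_mono) (auto simp: F_def)
        finally show ?thesis by (simp add: F_def v_def)
      qed
    qed
  qed
  also have "\<dots> = (\<integral>\<^sup>+x. abs_gaf A x r \<partial>M) * ennreal (1 / T) + ennreal (ln (4 * r\<^sup>2 + 3)) + (\<integral>\<^sup>+x. log_sing (\<xi> k x + Y x) \<partial>M)"
    by (simp add: nn_integral_add nn_integral_multc emeasure_space_1)
  also have "\<dots> \<le> ennreal (gauss_const * T) * ennreal (1 / T) + ennreal (ln (4 * r\<^sup>2 + 3)) + 2"
    using nn_integral_abs_gaf[of r A] r indep_log_sing[OF indepY] unfolding T_def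
    by (intro add_mono mult_right_mono) auto
  also have "\<dots> = ennreal (gauss_const + 2 + ln (4 * r\<^sup>2 + 3))"
  proof -
    have "ennreal (gauss_const * T) * ennreal (1 / T) = ennreal gauss_const"
      using T gauss_const_nonneg by (simp flip: ennreal_mult)
    moreover have "(2::ennreal) = ennreal 2" by simp
    ultimately show ?thesis
      using gauss_const_nonneg ln43 by (simp only: flip: ennreal_plus) (simp add: algebra_simps)
  qed
  finally show ?thesis by (simp add: T_def)
qed

text \<open>A measurable variable dominating the number of zeros in \<open>cball 0 R\<close>: the
  Jensen-type bound with the maximum on the circle of radius \<open>3 * R\<close> estimated through
  the majorant and \<open>\<xi> 0\<close> as the value at the origin. The factor 2 comes from
  \<open>ln 2 >= 1 / 2\<close>.\<close>

definition count_bound :: "nat set \<Rightarrow> real \<Rightarrow> 'a \<Rightarrow> ennreal" where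
  "count_bound A R x = 2 * (ennreal (ln (majorant A (3 * R)))
     + abs_gaf A x (3 * R) * ennreal (1 / majorant A (3 * R)) + log_sing (\<xi> 0 x))"

lemma measurable_count_bound [measurable]: "count_bound A R \<in> borel_measurable M"
  unfolding count_bound_def[abs_def] by measurable

lemma nn_integral_count_bound:
  assumes "R > 0" "0 \<in> A"
  shows "(\<integral>\<^sup>+x. count_bound A R x \<partial>M) \<le> ennreal (36 * R\<^sup>2 + 6 + 2 * gauss_const)"
proof -
  define T where "T = majorant A (3 * R)"
  have T: "T \<ge> 1" unfolding T_def using assms by (intro majorant_ge_1) auto
  \<comment> \<open>\<open>ln_majorant_le\<close> at radius \<open>3 * R\<close>. Together with 2
    for \<open>log_sing\<close> and the outer factor 2 it accounts for
    \<open>36 * R ^ 2 + 6\<close>.\<close>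
  have lnT: "ln T \<le> 18 * R\<^sup>2 + 1" "ln T \<ge> 0"
    using ln_majorant_le[of "3 * R" A] assms T by (auto simp: T_def power_mult_distrib)
  have "(\<integral>\<^sup>+x. count_bound A R x \<partial>M)
      = 2 * (ennreal (ln T) + (\<integral>\<^sup>+x. abs_gaf A x (3 * R) \<partial>M) * ennreal (1 / T) + (\<integral>\<^sup>+x. log_sing (\<xi> 0 x) \<partial>M))"
    unfolding count_bound_def T_def[symmetric]
    by (simp add: nn_integral_cmult nn_integral_add nn_integral_multc emeasure_space_1)
  also have "\<dots> \<le> 2 * (ennreal (18 * R\<^sup>2 + 1) + ennreal (gauss_const * T) * ennreal (1 / T) + 2)"
    using nn_integral_abs_gaf[of "3 * R" A] assms nn_integral_xi[of log_sing 0] gauss_dens_log_sing[of 0] lnT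
    by (intro mult_left_mono add_mono mult_right_mono ennreal_leI) (auto simp: T_def)
  also have "\<dots> = ennreal (36 * R\<^sup>2 + 6 + 2 * gauss_const)"
  proof -
    have "ennreal (gauss_const * T) * ennreal (1 / T) = ennreal gauss_const"
      using T gauss_const_nonneg by (simp flip: ennreal_mult)
    moreover have "ennreal (18 * R\<^sup>2 + 1) + ennreal gauss_const + 2 = ennreal (18 * R\<^sup>2 + 3 + gauss_const)"
      using gauss_const_nonneg by (simp flip: ennreal_plus ennreal_numeral add: algebra_simps)
    moreover have "2 * ennreal (18 * R\<^sup>2 + 3 + gauss_const) = ennreal (2 * (18 * R\<^sup>2 + 3 + gauss_const))"
      using gauss_const_nonneg by (intro two_mult_ennreal) simp
    moreover have "2 * (18 * R\<^sup>2 + 3 + gauss_const) = 36 * R\<^sup>2 + 6 + 2 * gauss_const" by simp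
    ultimately show ?thesis by (simp only:)
  qed
  finally show ?thesis .
qed

lemma zero_count_le_count_bound:
  assumes x: "entire_event x" and A: "0 \<in> A" and R: "R > 0"
  shows "ennreal (real (entire_nonzero.zero_count (random_gaf A x) R)) \<le> count_bound A R x"
proof -
  interpret entire_nonzero "random_gaf A x" by (rule entire_nonzero_random_gaf[OF x A])
  define T where "T = majorant A (3 * R)"
  have T: "T \<ge> 1" unfolding T_def using A R by (intro majorant_ge_1) auto
  define w where "w = complex_of_real (3 * R)"
  have w: "cmod w = 3 * R" using R by (simp add: w_def norm_mult)
  define S where "S = (\<Sum>k. cmod (gaf_term A x w k))"
  have S: "abs_gaf A x (3 * R) = ennreal S" using abs_gaf_eq[OF x, of A w] w by (simp add: S_def)
  have S0: "S \<ge> 0" unfolding S_def by (intro suminf_nonneg entire_event_summable[OF x]) auto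
  define n where "n = zero_count R"
  define y where "y = \<xi> 0 x"
  have y: "y \<noteq> 0" using x by (simp add: entire_event_def y_def)
  have "cmod (random_gaf A x z) \<le> S" if "cmod z = 3 * R" for z
    using norm_random_gaf_le[OF x, of A z] S S0 that by simp
  then have "cmod y * 2 ^ n \<le> S"
    using zero_count_bound[OF R, of S] unfolding random_gaf_0[OF x A] n_def y_def by blast
  then have S1: "S > 0" using y by (smt (verit) mult_pos_pos zero_less_norm_iff zero_less_power)
  have "ln (cmod y * 2 ^ n) \<le> ln S" using \<open>cmod y * 2 ^ n \<le> S\<close> y S1 by (subst ln_le_cancel_iff) auto
  then have "real n * ln 2 \<le> ln S - ln (cmod y)"
    using y by (simp add: ln_mult_pos ln_realpow)
  moreover have "ln S \<le> ln T + S * (1 / T)"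
    using ln_le_minus_one[of "S / T"] S1 T by (simp add: ln_div)
  moreover have "real n * (1 / 2) \<le> real n * ln 2"
    using ln2_ge_two_thirds by (intro mult_left_mono) auto
  ultimately have "real n \<le> 2 * (ln T + S * (1 / T) + max 0 (- ln (cmod y)))" by argo
  then have "ennreal (real n) \<le> ennreal (2 * (ln T + S * (1 / T) + max 0 (- ln (cmod y))))"
    by (rule ennreal_leI)
  also have "\<dots> = 2 * (ennreal (ln T) + ennreal S * ennreal (1 / T) + ennreal (- ln (cmod y)))"
  proof -
    define p where "p = max 0 (- ln (cmod y))"
    have p: "p \<ge> 0" "ennreal (- ln (cmod y)) = ennreal p" by (simp_all add: p_def)
    show ?thesis
      unfolding p_def[symmetric] p(2) using T S0 p(1) by (simp add: two_mult_ennreal flip: ennreal_plus ennreal_mult)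
  qed
  also have "\<dots> \<le> count_bound A R x"
    unfolding count_bound_def T_def[symmetric] S y_def[symmetric]
    by (intro mult_left_mono add_mono order_refl ln_le_log_sing y) auto
  finally show ?thesis by (simp add: n_def)
qed

end

section \<open>Measurability of radial statistics\<close>

lemma measurable_circ [measurable]:
  assumes [measurable]: "f \<in> borel_measurable N" "g \<in> borel_measurable N"
  shows "(\<lambda>x. circ (f x) (g x)) \<in> borel_measurable N"
proof -
  have [measurable]: "(exp :: complex \<Rightarrow> complex) \<in> borel_measurable borel"
    by (intro borel_measurable_continuous_onI continuous_intros)
  show ?thesis unfolding circ_def by measurable
qed

lemma measurable_complex_powi [measurable]: "(\<lambda>z::complex. z powi m) \<in> borel_measurable borel"
  unfolding power_int_def by simp

context entire_nonzero
begin

lemma moment_diff: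
  assumes "0 < a" "a \<le> b"
  shows "moment m b - moment m a
    = (\<Sum>z | z \<in> zeros F \<and> a \<le> cmod z \<and> cmod z < b. of_int (zorder F z) * z powi m)"
proof -
  have "moment m b - moment m a
      = (\<Sum>z\<in>{z\<in>zeros F. z \<noteq> 0 \<and> cmod z < b} - {z\<in>zeros F. z \<noteq> 0 \<and> cmod z < a}. of_int (zorder F z) * z powi m)"
    unfolding moment_def using assms by (intro sum_diff[symmetric] finite_zeros_less) auto
  also have "{z\<in>zeros F. z \<noteq> 0 \<and> cmod z < b} - {z\<in>zeros F. z \<noteq> 0 \<and> cmod z < a}
      = {z. z \<in> zeros F \<and> a \<le> cmod z \<and> cmod z < b}"
    using assms by auto
  finally show ?thesis .
qed

text \<open>Recovers the power sums from values of \<open>F\<close> and its derivative, without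
  reference to single zeros; this is what brings Fubini into play.\<close>

definition circle_mean :: "int \<Rightarrow> real \<Rightarrow> complex" where
  "circle_mean m r = (LINT t:{0..1}|lborel. circ r t powi m * logderiv_circ r t)"

lemma circle_mean_eq:
  assumes "r > 0" "\<And>a. a \<in> zeros F \<Longrightarrow> cmod a \<noteq> r"
  shows "circle_mean m r = moment_offset m + moment m r"
proof -
  have "continuous_on {0..1} (\<lambda>t. circ r t powi m * logderiv_circ r t)"
    using assms(1) by (intro continuous_intros continuous_on_logderiv_circ assms) auto
  from set_borel_integral_eq_integral(2)[OF borel_integrable_atLeastAtMost'[OF this]]
  show ?thesis using integral_logderiv_circ[OF assms, of m] unfolding circle_mean_def by simp
qed

text \<open>
  The moment is left-continuous in the radius and agrees with the circle mean away from finitely many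
  radii, so left averages recover it at every radius.
\<close>

lemma left_average_circle_mean:
  assumes r: "r > 0"
  shows "(\<lambda>n. real (Suc n) *\<^sub>R (LINT s:{r - 1 / real (Suc n)..<r}|lborel. circle_mean m s))
    \<longlonglongrightarrow> moment_offset m + moment m r"
proof -
  \<comment> \<open>Inserting 0 makes the maximum \<delta> exist. No zero has modulus strictly
    between \<delta> and \<open>r\<close>, so the circle mean is constant there.\<close>
  define K where "K = insert 0 (cmod ` {z\<in>zeros F. z \<noteq> 0 \<and> cmod z < r})"
  have K: "finite K" "K \<noteq> {}" using finite_zeros_less by (auto simp: K_def)
  define \<delta> where "\<delta> = Max K"
  have \<delta>: "\<delta> < r" "\<delta> \<ge> 0" using K r by (auto simp: \<delta>_def K_def)
  have const: "circle_mean m s = moment_offset m + moment m r" if s: "\<delta> < s" "s < r" for s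
  proof -
    have no: "cmod a \<le> \<delta> \<or> r \<le> cmod a" if "a \<in> zeros F" for a
    proof (cases "a = 0 \<or> r \<le> cmod a")
      case True
      then show ?thesis using \<delta> by auto
    next
      case False
      then have "cmod a \<in> K" using that by (auto simp: K_def)
      then show ?thesis using K by (simp add: \<delta>_def)
    qed
    have "circle_mean m s = moment_offset m + moment m s"
      using s \<delta> no by (intro circle_mean_eq) force+
    also have "moment m s = moment m r"
      unfolding moment_def using s no by (intro sum.cong) force+
    finally show ?thesis .
  qed
  have "eventually (\<lambda>n. 1 / real (Suc n) < r - \<delta>) sequentially"
    using \<delta> LIMSEQ_inverse_real_of_nat[THEN order_tendstoD(2), of "r - \<delta>"]
    by (simp add: inverse_eq_divide)
  then have "eventually (\<lambda>n. real (Suc n) *\<^sub>R (LINT s:{r - 1 / real (Suc n)..<r}|lborel. circle_mean m s)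
      = moment_offset m + moment m r) sequentially"
  proof eventually_elim
    case (elim n)
    define c where "c = moment_offset m + moment m r"
    have "(LINT s:{r - 1 / real (Suc n)..<r}|lborel. circle_mean m s) = (LINT s:{r - 1 / real (Suc n)..<r}|lborel. c)"
      unfolding c_def using elim by (intro set_lebesgue_integral_cong) (auto intro: const)
    also have "\<dots> = (1 / real (Suc n)) *\<^sub>R c"
      unfolding set_lebesgue_integral_def by simp
    finally show ?case by (simp add: c_def)
  qed
  then show ?thesis by (rule tendsto_eventually)
qed

lemma finite_zeros_annulus: "finite {z. z \<in> zeros F \<and> a \<le> cmod z \<and> cmod z < b}"
  by (rule finite_subset[OF _ finite_zeros[of b]]) auto

text \<open>Riemann-Stieltjes sums of \<open>u\<close> against the moment as a function of the
  radius. The half-open cells match the strict inequality in \<open>moment\<close>; each zero falls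
  into exactly one cell and is weighted by \<open>u\<close> at the left end of that cell.\<close>

lemma riemann_sum_annulus:
  fixes u :: "real \<Rightarrow> real"
  assumes AB: "0 < A" "A < B" and u: "continuous_on {A..B} u"
  defines "t \<equiv> \<lambda>n i. A + real i * ((B - A) / real (Suc n))"
  shows "(\<lambda>n. \<Sum>i<Suc n. of_real (u (t n i)) * (moment m (t n (Suc i)) - moment m (t n i)))
    \<longlonglongrightarrow> (\<Sum>z | z \<in> zeros F \<and> A \<le> cmod z \<and> cmod z < B. of_int (zorder F z) * (of_real (u (cmod z)) * z powi m))"
proof -
  define Z where "Z = {z. z \<in> zeros F \<and> A \<le> cmod z \<and> cmod z < B}"
  have finZ: "finite Z" unfolding Z_def by (rule finite_zeros_annulus)
  define I where "I n i z \<longleftrightarrow> t n i \<le> cmod z \<and> cmod z < t n (Suc i)" for n i z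
  have t_mono: "t n i \<le> t n (Suc i)" "A \<le> t n i" for n i
    using AB by (auto simp: t_def divide_right_mono mult_right_mono)
  have t_top: "t n (Suc i) \<le> B" if "i < Suc n" for n i
  proof -
    have "real (Suc i) * ((B - A) / real (Suc n)) \<le> real (Suc n) * ((B - A) / real (Suc n))"
      using that AB by (intro mult_right_mono) auto
    then show ?thesis by (simp add: t_def)
  qed
  have eq: "(\<Sum>i<Suc n. of_real (u (t n i)) * (moment m (t n (Suc i)) - moment m (t n i)))
      = (\<Sum>z\<in>Z. of_int (zorder F z) * (of_real (\<Sum>i<Suc n. if I n i z then u (t n i) else 0) * z powi m))" for n
  proof -
    have "moment m (t n (Suc i)) - moment m (t n i)
        = (\<Sum>z\<in>Z. if I n i z then of_int (zorder F z) * z powi m else 0)" if "i < Suc n" for i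
    proof -
      have "moment m (t n (Suc i)) - moment m (t n i)
          = (\<Sum>z | z \<in> zeros F \<and> t n i \<le> cmod z \<and> cmod z < t n (Suc i). of_int (zorder F z) * z powi m)"
        using t_mono AB by (intro moment_diff) (auto intro: less_le_trans)
      also have "\<dots> = (\<Sum>z\<in>Z. if I n i z then of_int (zorder F z) * z powi m else 0)"
        using t_mono[where n = n] t_top[OF that] finZ
        by (intro sum.mono_neutral_cong_left) (auto simp: Z_def I_def intro: order_trans less_le_trans)
      finally show ?thesis .
    qed
    then have "(\<Sum>i<Suc n. of_real (u (t n i)) * (moment m (t n (Suc i)) - moment m (t n i)))
        = (\<Sum>i<Suc n. \<Sum>z\<in>Z. of_real (u (t n i)) * (if I n i z then of_int (zorder F z) * z powi m else 0))"
      by (intro sum.cong refl) (simp add: sum_distrib_left)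
    also have "\<dots> = (\<Sum>z\<in>Z. \<Sum>i<Suc n. of_real (u (t n i)) * (if I n i z then of_int (zorder F z) * z powi m else 0))"
      by (rule sum.swap)
    also have "\<dots> = (\<Sum>z\<in>Z. of_int (zorder F z) * (of_real (\<Sum>i<Suc n. if I n i z then u (t n i) else 0) * z powi m))"
    proof (intro sum.cong refl)
      fix z
      have "(\<Sum>i<Suc n. of_real (u (t n i)) * (if I n i z then of_int (zorder F z) * z powi m else 0))
          = (\<Sum>i<Suc n. of_real (if I n i z then u (t n i) else 0) * (of_int (zorder F z) * z powi m))"
        by (intro sum.cong) auto
      then show "(\<Sum>i<Suc n. of_real (u (t n i)) * (if I n i z then of_int (zorder F z) * z powi m else 0))
          = of_int (zorder F z) * (of_real (\<Sum>i<Suc n. if I n i z then u (t n i) else 0) * z powi m)"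
        by (simp only: sum_distrib_right[symmetric] of_real_sum[symmetric]) (simp add: mult_ac)
    qed
    finally show ?thesis .
  qed
  have lim: "(\<lambda>n. \<Sum>i<Suc n. if I n i z then u (t n i) else 0) \<longlonglongrightarrow> u (cmod z)" if z: "z \<in> Z" for z
  proof -
    \<comment> \<open>The cell containing \<open>cmod z\<close>, found by solving
      \<open>t n i <= cmod z\<close> for \<open>i\<close>.\<close>
    define k where "k n = nat \<lfloor>(cmod z - A) * real (Suc n) / (B - A)\<rfloor>" for n
    have zAB: "A \<le> cmod z" "cmod z < B" using z by (auto simp: Z_def)
    have k: "real (k n) \<le> (cmod z - A) * real (Suc n) / (B - A)" "(cmod z - A) * real (Suc n) / (B - A) < real (k n) + 1" for n
    proof -
      have "0 \<le> (cmod z - A) * real (Suc n) / (B - A)" using zAB AB by simp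
      then have "real (k n) = of_int \<lfloor>(cmod z - A) * real (Suc n) / (B - A)\<rfloor>" by (simp add: k_def)
      then show "real (k n) \<le> (cmod z - A) * real (Suc n) / (B - A)" "(cmod z - A) * real (Suc n) / (B - A) < real (k n) + 1"
        by linarith+
    qed
    have t_iff: "t n i \<le> cmod z \<longleftrightarrow> real i \<le> (cmod z - A) * real (Suc n) / (B - A)" for n i
      using AB by (simp add: t_def field_simps)
    have tk: "t n (k n) \<le> cmod z" "cmod z < t n (Suc (k n))" for n
      using k[of n] t_iff[of n "k n"] t_iff[of n "Suc (k n)"] by auto
    have I_iff: "I n i z \<longleftrightarrow> i = k n" for n i
    proof
      assume "I n i z"
      then have "real i \<le> (cmod z - A) * real (Suc n) / (B - A)" "(cmod z - A) * real (Suc n) / (B - A) < real (Suc i)"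
        using t_iff[of n i] t_iff[of n "Suc i"] by (auto simp: I_def)
      then have "real i < real (k n) + 1" "real (k n) < real i + 1" using k[of n] by auto
      then show "i = k n" by linarith
    qed (use tk in \<open>simp add: I_def\<close>)
    have kn: "k n < Suc n" for n
    proof -
      have "t n (Suc n) = B" by (simp add: t_def)
      have "real (k n) < real (Suc n)"
      proof (rule ccontr)
        assume "\<not> real (k n) < real (Suc n)"
        then have "real (Suc n) \<le> (cmod z - A) * real (Suc n) / (B - A)" using k(1)[of n] by linarith
        then have "t n (Suc n) \<le> cmod z" using t_iff[of n "Suc n"] by simp
        then show False using \<open>t n (Suc n) = B\<close> zAB by simp
      qed
      then show ?thesis by simp
    qed
    have "(\<Sum>i<Suc n. if I n i z then u (t n i) else 0) = u (t n (k n))" for n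
      using kn[of n] by (simp add: I_iff del: sum.lessThan_Suc)
    moreover have "(\<lambda>n. u (t n (k n))) \<longlonglongrightarrow> u (cmod z)"
    proof (rule continuous_on_tendsto_compose[OF u])
      have "(\<lambda>n. cmod z - (B - A) * inverse (real (Suc n))) \<longlonglongrightarrow> cmod z - (B - A) * 0"
        by (intro tendsto_intros LIMSEQ_inverse_real_of_nat)
      then have lower: "(\<lambda>n. cmod z - (B - A) * inverse (real (Suc n))) \<longlonglongrightarrow> cmod z" by simp
      show "(\<lambda>n. t n (k n)) \<longlonglongrightarrow> cmod z"
      proof (rule tendsto_sandwich[OF _ _ lower tendsto_const])
        show "\<forall>\<^sub>F n in sequentially. cmod z - (B - A) * inverse (real (Suc n)) \<le> t n (k n)"
        proof (rule always_eventually, rule allI)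
          fix n
          have "t n (Suc (k n)) = t n (k n) + (B - A) * inverse (real (Suc n))"
            by (simp add: t_def distrib_right divide_inverse del: of_nat_Suc) (simp add: algebra_simps)
          then show "cmod z - (B - A) * inverse (real (Suc n)) \<le> t n (k n)" using tk(2)[of n] by simp
        qed
        show "\<forall>\<^sub>F n in sequentially. t n (k n) \<le> cmod z" using tk by simp
      qed
      show "cmod z \<in> {A..B}" using zAB by simp
      show "\<forall>\<^sub>F n in sequentially. t n (k n) \<in> {A..B}"
      proof (intro always_eventually allI)
        fix n
        show "t n (k n) \<in> {A..B}" using tk(1)[of n] t_mono(2)[of n "k n"] zAB by simp
      qed
    qed
    ultimately show ?thesis by simp
  qed
  show ?thesis
    unfolding Z_def[symmetric] eq by (intro tendsto_sum tendsto_mult tendsto_of_real tendsto_const lim)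
qed

end

section \<open>Measurable dependence on the sample point\<close>

context gaussian_sequence
begin

lemma measurable_gaf_term: "(\<lambda>p. gaf_term A (fst p) (snd p) k) \<in> borel_measurable (M \<Otimes>\<^sub>M borel)"
  unfolding gaf_term_def by (cases "k \<in> A") simp_all

text \<open>A power series converging at \<open>n\<close> converges absolutely in the open disc of
  radius \<open>n\<close>, so integer points decide. The Cauchy criterion makes the condition
  accessible to countable operations.\<close>

lemma gaf_everywhere_summable_iff:
  "(\<forall>w. summable (\<lambda>k. gaf_term A x w k)) \<longleftrightarrow> (\<forall>n::nat. Cauchy (\<lambda>m. \<Sum>k<m. gaf_term A x (of_nat n) k))"
proof -
  have "(\<forall>w. summable (\<lambda>k. gaf_term A x w k)) \<longleftrightarrow> (\<forall>n::nat. summable (\<lambda>k. gaf_term A x (of_nat n) k))"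
  proof (intro iffI allI)
    fix w assume *: "\<forall>n::nat. summable (\<lambda>k. gaf_term A x (of_nat n) k)"
    obtain n :: nat where n: "cmod w < real n" using reals_Archimedean2 by blast
    have "summable (\<lambda>k. norm ((if k \<in> A then \<xi> k x else 0) / complex_of_real (sqrt (fact k)) * w ^ k))"
      by (rule powser_insidea[of _ "of_nat n"]) (use * n in \<open>auto simp: gaf_term_def\<close>)
    then show "summable (\<lambda>k. gaf_term A x w k)"
      unfolding gaf_term_def by (rule summable_norm_cancel)
  qed auto
  then show ?thesis by (simp add: summable_iff_convergent Cauchy_convergent_iff)
qed

text \<open>Stated with sample point and argument varying jointly, as integration over angles and
  radii requires.\<close>

lemma measurable_random_gaf [measurable]:
  assumes f[measurable]: "f \<in> measurable N M" and g[measurable]: "g \<in> borel_measurable N"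
  shows "(\<lambda>y. random_gaf A (f y) (g y)) \<in> borel_measurable N"
proof -
  have [measurable]: "(\<lambda>y. gaf_term A (f y) (h y) k) \<in> borel_measurable N" if "h \<in> borel_measurable N" for h k
    using measurable_compose[OF measurable_Pair[OF f that] measurable_gaf_term[of A k]] by simp
  have "Measurable.pred N (\<lambda>y. \<forall>n::nat. Cauchy (\<lambda>m. \<Sum>k<m. gaf_term A (f y) (of_nat n) k))"
    by (intro pred_intros_countable) (unfold pred_def, intro sets_Collect_Cauchy, measurable)
  then have [measurable]: "Measurable.pred N (\<lambda>y. \<forall>w. summable (\<lambda>k. gaf_term A (f y) w k))"
    unfolding gaf_everywhere_summable_iff .
  have "(\<lambda>y. random_gaf A (f y) (g y))
      = (\<lambda>y. if \<forall>w. summable (\<lambda>k. gaf_term A (f y) w k) then \<Sum>k. gaf_term A (f y) (g y) k else 0)"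
    unfolding random_gaf_def gaf_def gaf_term_def by simp
  then show ?thesis by simp
qed

lemma holomorphic_random_gaf: "random_gaf A x holomorphic_on UNIV"
  unfolding random_gaf_def by (rule gaf_holomorphic)

text \<open>The derivative is the limit of difference quotients with real steps
  \<open>1 / (n + 1)\<close>.\<close>

lemma measurable_deriv_random_gaf [measurable]:
  assumes f[measurable]: "f \<in> measurable N M" and g[measurable]: "g \<in> borel_measurable N"
  shows "(\<lambda>y. deriv (random_gaf A (f y)) (g y)) \<in> borel_measurable N"
proof -
  have "deriv (random_gaf A x) z
      = lim (\<lambda>n. (random_gaf A x (z + of_real (inverse (real (Suc n)))) - random_gaf A x z) / of_real (inverse (real (Suc n))))" for x z
  proof -
    have "(random_gaf A x has_field_derivative deriv (random_gaf A x) z) (at z)"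
      by (rule holomorphic_derivI[OF holomorphic_random_gaf open_UNIV UNIV_I])
    then have "((\<lambda>h. (random_gaf A x (z + h) - random_gaf A x z) / h) \<longlongrightarrow> deriv (random_gaf A x) z) (at 0)"
      by (simp add: DERIV_def)
    moreover have "filterlim (\<lambda>n. complex_of_real (inverse (real (Suc n)))) (at 0) sequentially"
      using tendsto_of_real[OF LIMSEQ_inverse_real_of_nat, where 'a = complex]
      by (auto simp: filterlim_at simp del: of_nat_Suc)
    ultimately show ?thesis
      by (intro limI[symmetric]) (rule filterlim_compose)
  qed
  then show ?thesis by simp
qed

definition nonzero_event :: "nat set \<Rightarrow> 'a \<Rightarrow> bool" where
  "nonzero_event A x \<longleftrightarrow> (\<exists>z. random_gaf A x z \<noteq> 0)"

lemma entire_nonzero_event: "nonzero_event A x \<Longrightarrow> entire_nonzero (random_gaf A x)"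
  unfolding nonzero_event_def entire_nonzero_def using holomorphic_random_gaf by blast

text \<open>By continuity a nonzero value already occurs on a countable dense set.\<close>

lemma measurable_nonzero_event [measurable]: "Measurable.pred M (nonzero_event A)"
proof -
  obtain D :: "complex set" where D: "countable D" and dense: "\<And>X. open X \<Longrightarrow> X \<noteq> {} \<Longrightarrow> \<exists>d\<in>D. d \<in> X"
    using countable_dense_exists by metis
  have "nonzero_event A x \<longleftrightarrow> (\<exists>d\<in>D. random_gaf A x d \<noteq> 0)" for x
  proof
    assume "nonzero_event A x"
    have "open {z. random_gaf A x z \<noteq> 0}"
      using holomorphic_on_imp_continuous_on[OF holomorphic_random_gaf, of A x]
      by (intro open_Collect_neq continuous_intros) auto
    then show "\<exists>d\<in>D. random_gaf A x d \<noteq> 0"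
      using dense[of "{z. random_gaf A x z \<noteq> 0}"] \<open>nonzero_event A x\<close> by (auto simp: nonzero_event_def)
  qed (auto simp: nonzero_event_def)
  moreover have "Measurable.pred M (\<lambda>x. \<exists>d\<in>D. random_gaf A x d \<noteq> 0)"
    using D by measurable
  ultimately show ?thesis by (simp cong: measurable_cong)
qed

definition random_circle_mean :: "nat set \<Rightarrow> int \<Rightarrow> 'a \<Rightarrow> real \<Rightarrow> complex" where
  "random_circle_mean A m x r = (LINT t:{0..1}|lborel. circ r t powi m
     * (circ r t * (deriv (random_gaf A x) (circ r t) / random_gaf A x (circ r t))))"

lemma measurable_random_circle_mean:
  "(\<lambda>p. random_circle_mean A m (fst p) (snd p)) \<in> borel_measurable (M \<Otimes>\<^sub>M lborel)"
  unfolding random_circle_mean_def set_lebesgue_integral_def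
  by (rule lborel.borel_measurable_lebesgue_integral) measurable

text \<open>The left-average limit written out for every sample point, which makes measurability
  immediate; its meaning as offset plus moment is established on
  \<open>nonzero_event\<close>.\<close>

definition random_moment :: "nat set \<Rightarrow> int \<Rightarrow> real \<Rightarrow> 'a \<Rightarrow> complex" where
  "random_moment A m r x = lim (\<lambda>n. real (Suc n) *\<^sub>R
     (LINT s:{r - 1 / real (Suc n)..<r}|lborel. random_circle_mean A m x s))"

lemma measurable_random_moment [measurable]: "random_moment A m r \<in> borel_measurable M"
proof -
  have "(\<lambda>x. (LINT s:{r - 1 / real (Suc n)..<r}|lborel. random_circle_mean A m x s)) \<in> borel_measurable M" for n
    unfolding set_lebesgue_integral_def
    using measurable_random_circle_mean[of A m]
    by (intro lborel.borel_measurable_lebesgue_integral) (simp add: case_prod_beta')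
  then show ?thesis unfolding random_moment_def[abs_def] by measurable
qed

lemma random_moment_eq:
  assumes "nonzero_event A x" "r > 0"
  shows "random_moment A m r x
    = entire_nonzero.moment_offset (random_gaf A x) m + entire_nonzero.moment (random_gaf A x) m r"
proof -
  interpret entire_nonzero "random_gaf A x" by (rule entire_nonzero_event[OF assms(1)])
  have "random_circle_mean A m x = circle_mean m"
    by (simp add: fun_eq_iff random_circle_mean_def circle_mean_def logderiv_circ_def)
  then show ?thesis
    unfolding random_moment_def using left_average_circle_mean[OF assms(2), of m] by (simp add: limI)
qed

text \<open>Pointwise limit of Stieltjes sums built from differences of
  \<open>random_moment\<close>, in which the offset cancels.\<close>

lemma measurable_radial_statistic:
  fixes u :: "real \<Rightarrow> real"
  assumes AB: "0 < a" "a < b" and u: "continuous_on {a..b} u"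
  shows "(\<lambda>x. if nonzero_event A x then \<Sum>z | z \<in> zeros (random_gaf A x) \<and> a \<le> cmod z \<and> cmod z < b.
      of_int (zorder (random_gaf A x) z) * (of_real (u (cmod z)) * z powi m) else 0) \<in> borel_measurable M"
proof -
  define t where "t n i = a + real i * ((b - a) / real (Suc n))" for n i
  show ?thesis
  proof (rule borel_measurable_LIMSEQ_metric)
    show "(\<lambda>x. if nonzero_event A x then \<Sum>i<Suc n. of_real (u (t n i)) *
        (random_moment A m (t n (Suc i)) x - random_moment A m (t n i) x) else 0) \<in> borel_measurable M" for n
      by measurable
    fix x
    show "(\<lambda>n. if nonzero_event A x then \<Sum>i<Suc n. of_real (u (t n i)) *
        (random_moment A m (t n (Suc i)) x - random_moment A m (t n i) x) else 0)
      \<longlonglongrightarrow> (if nonzero_event A x then \<Sum>z | z \<in> zeros (random_gaf A x) \<and> a \<le> cmod z \<and> cmod z < b.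
      of_int (zorder (random_gaf A x) z) * (of_real (u (cmod z)) * z powi m) else 0)"
    proof (cases "nonzero_event A x")
      case True
      interpret entire_nonzero "random_gaf A x" by (rule entire_nonzero_event[OF True])
      have "t n i > 0" for n i
      proof -
        have "0 \<le> real i * ((b - a) / real (Suc n))" using AB by simp
        then show ?thesis using AB unfolding t_def by linarith
      qed
      then show ?thesis
        using riemann_sum_annulus[OF AB u, of m, folded t_def] True
        by (simp add: random_moment_eq del: sum.lessThan_Suc of_nat_Suc)
    qed simp
  qed
qed

end

section \<open>Dyadic blocks\<close>

definition annular_block ::
    "real \<Rightarrow> (complex \<Rightarrow> real) \<Rightarrow> nat \<Rightarrow> (complex \<Rightarrow> 'b) \<Rightarrow> (complex \<Rightarrow> complex) \<Rightarrow>
     'b::{banach, second_countable_topology}" where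
  "annular_block r0 \<phi> j h F = (LINT z|zero_process F. annular_cutoff r0 \<phi> j z *\<^sub>R h z)"

lemma dyadic_block_Suc: "dyadic_block \<phi> (Suc j) h F = annular_block r0 \<phi> (Suc j) h F"
  by (simp add: dyadic_block_def annular_block_def annular_cutoff_def)

lemma zero_sum_eq: "zero_sum r0 \<phi> h F = annular_block r0 \<phi> 0 h F + zero_tail \<phi> 1 h F"
  by (simp add: zero_sum_def zero_tail_def annular_block_def annular_cutoff_def)

lemma zero_tail_eq: "k \<ge> 1 \<Longrightarrow> zero_tail \<phi> k h F = (\<Sum>j. annular_block r0 \<phi> (k + j) h F)"
  unfolding zero_tail_def
  by (intro suminf_cong) (metis Suc_le_D add_Suc dyadic_block_Suc One_nat_def)

context
  fixes r0 :: real and \<phi> :: "complex \<Rightarrow> real" and F :: "complex \<Rightarrow> complex"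
  assumes cut: "radial_cutoff r0 \<phi>" and r0: "r0 > 0" and F: "entire_nonzero F"
begin

interpretation entire_nonzero F by (rule F)

lemma annular_block_eq_sum:
  fixes h :: "complex \<Rightarrow> 'b::{banach, second_countable_topology}"
  assumes h: "h \<in> borel_measurable borel" and ab: "a \<le> 2 ^ j * r0" "2 ^ j * (3 * r0) < b"
    and Z: "Z = {z. z \<in> zeros F \<and> a \<le> cmod z \<and> cmod z < b} \<or> Z = {z. z \<in> zeros F \<and> a \<le> cmod z \<and> cmod z \<le> b}"
  shows "annular_block r0 \<phi> j h F
    = (\<Sum>z\<in>Z. of_int (zorder F z) *\<^sub>R (annular_cutoff r0 \<phi> j z *\<^sub>R h z))"
proof -
  note [measurable] = h annular_cutoff_measurable[OF cut r0]
  have supp: "annular_cutoff r0 \<phi> j z \<noteq> 0 \<Longrightarrow> a \<le> cmod z \<and> cmod z < b" for z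
    using annular_cutoff_support[OF cut r0, of j z] ab by auto
  have "annular_block r0 \<phi> j h F
      = (\<Sum>z\<in>zeros F \<inter> cball 0 b. of_int (zorder F z) *\<^sub>R (annular_cutoff r0 \<phi> j z *\<^sub>R h z))"
    unfolding annular_block_def
    by (rule integral_zero_process) (measurable, use supp in force)
  also have "\<dots> = (\<Sum>z\<in>Z. of_int (zorder F z) *\<^sub>R (annular_cutoff r0 \<phi> j z *\<^sub>R h z))"
    by (rule sum.mono_neutral_right[OF finite_zeros]) (use Z supp in force)+
  finally show ?thesis .
qed

lemma annular_block_has_sum:
  fixes h :: "complex \<Rightarrow> 'b::{banach, second_countable_topology}"
  assumes h: "h \<in> borel_measurable borel"
  shows "((\<lambda>z. annular_cutoff r0 \<phi> j z *\<^sub>R (of_int (zorder F z) *\<^sub>R h z)) has_sum annular_block r0 \<phi> j h F)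
    (zeros F \<inter> - ball 0 r0)"
proof -
  define b where "b = 2 ^ j * (4 * r0)"
  define Z where "Z = {z. z \<in> zeros F \<and> r0 \<le> cmod z \<and> cmod z < b}"
  have b: "2 ^ j * (3 * r0) < b" "r0 \<le> 2 ^ j * r0"
    using r0 by (auto simp: b_def)
  have "annular_block r0 \<phi> j h F = (\<Sum>z\<in>Z. of_int (zorder F z) *\<^sub>R (annular_cutoff r0 \<phi> j z *\<^sub>R h z))"
    by (rule annular_block_eq_sum[OF h b(2,1)]) (simp add: Z_def)
  then have *: "annular_block r0 \<phi> j h F = (\<Sum>z\<in>Z. annular_cutoff r0 \<phi> j z *\<^sub>R (of_int (zorder F z) *\<^sub>R h z))"
    by (simp add: mult.commute)
  have "finite Z" unfolding Z_def by (rule finite_zeros_annulus)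
  then have "((\<lambda>z. annular_cutoff r0 \<phi> j z *\<^sub>R (of_int (zorder F z) *\<^sub>R h z)) has_sum annular_block r0 \<phi> j h F) Z"
    unfolding * by (rule has_sum_finite)
  then show ?thesis
  proof (rule has_sum_cong_neutral[THEN iffD1, rotated -1])
    fix z assume "z \<in> zeros F \<inter> - ball 0 r0 - Z"
    then have "b \<le> cmod z" by (auto simp: Z_def)
    then have "annular_cutoff r0 \<phi> j z = 0"
      using annular_cutoff_support(2)[OF cut r0, of j z] b(1) by linarith
    then show "annular_cutoff r0 \<phi> j z *\<^sub>R (of_int (zorder F z) *\<^sub>R h z) = 0" by simp
  qed (auto simp: Z_def)
qed

text \<open>Fubini for the family indexed by zeros and cut-offs, absolutely summable because the
  cut-offs are nonnegative with sum 1. Summing over cut-offs first gives the plain sum over zeros;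
  over zeros first, the series of blocks.\<close>

lemma zero_sum_has_sum:
  fixes h :: "complex \<Rightarrow> 'b::{banach, second_countable_topology}"
  assumes h: "h \<in> borel_measurable borel"
    and abs: "(\<lambda>z. norm (of_int (zorder F z) *\<^sub>R h z)) summable_on (zeros F \<inter> - ball 0 r0)"
  shows "summable (\<lambda>j. dyadic_block \<phi> (Suc j) h F)"
    "((\<lambda>z. of_int (zorder F z) *\<^sub>R h z) has_sum zero_sum r0 \<phi> h F) (zeros F \<inter> - ball 0 r0)"
proof -
  define Z where "Z = zeros F \<inter> - ball 0 r0"
  define f where "f z = of_int (zorder F z) *\<^sub>R h z" for z
  define c where "c j z = annular_cutoff r0 \<phi> j z" for j z
  have c0: "c j z \<ge> 0" for j z using annular_cutoff_bounds[OF cut r0] by (simp add: c_def)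
  have c_sum: "((\<lambda>j. c j z *\<^sub>R y) has_sum y) UNIV" if "z \<in> Z" for z and y :: "'c::real_normed_vector"
  proof -
    have z: "r0 \<le> cmod z" using that by (simp add: Z_def)
    let ?S = "{j. c j z \<noteq> 0}"
    have fin: "finite ?S" using annular_cutoff_sums(2)[OF cut r0 z] by (simp add: c_def)
    have "(\<lambda>j. c j z) sums (\<Sum>j\<in>?S. c j z)" using fin by (rule sums_finite) auto
    then have "(\<Sum>j\<in>?S. c j z) = 1"
      using annular_cutoff_sums(1)[OF cut r0 z] by (metis c_def sums_cong sums_unique2)
    then have "(\<Sum>j\<in>?S. c j z *\<^sub>R y) = y" by (simp add: scaleR_left.sum[symmetric])
    then have "((\<lambda>j. c j z *\<^sub>R y) has_sum y) ?S" using has_sum_finite[OF fin, of "\<lambda>j. c j z *\<^sub>R y"] by simp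
    then show ?thesis by (rule has_sum_cong_neutral[THEN iffD1, rotated -1]) auto
  qed
  have "(\<lambda>p. norm (case p of (z, j) \<Rightarrow> c j z *\<^sub>R f z)) summable_on Z \<times> UNIV"
  proof (subst Infinite_Sum.abs_summable_on_Sigma_iff, intro conjI ballI)
    fix z assume z: "z \<in> Z"
    show "(\<lambda>j. norm (case (z, j) of (z, j) \<Rightarrow> c j z *\<^sub>R f z)) summable_on UNIV"
      using c_sum[OF z, of "norm (f z)"] c0 by (auto simp: summable_on_def)
  next
    have "infsum (\<lambda>j. norm (case (z, j) of (z, j) \<Rightarrow> c j z *\<^sub>R f z)) UNIV = norm (f z)" if "z \<in> Z" for z
      using c_sum[OF that, of "norm (f z)"] c0 by (intro infsumI) simp
    then show "(\<lambda>z. norm (infsum (\<lambda>j. norm (case (z, j) of (z, j) \<Rightarrow> c j z *\<^sub>R f z)) UNIV)) summable_on Z"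
      using abs by (subst summable_on_cong[where g = "\<lambda>z. norm (f z)"]) (simp_all add: f_def Z_def)
  qed
  then have "(\<lambda>(z, j). c j z *\<^sub>R f z) summable_on Z \<times> UNIV"
    by (rule Infinite_Sum.abs_summable_summable)
  then obtain S where S: "((\<lambda>(z, j). c j z *\<^sub>R f z) has_sum S) (Z \<times> UNIV)"
    by (auto simp: summable_on_def)
  have f_sum: "(f has_sum S) Z"
    using has_sum_SigmaD[OF S, of f] c_sum by auto
  have "((\<lambda>(j, z). c j z *\<^sub>R f z) has_sum S) (UNIV \<times> Z)"
    using S by (subst (asm) has_sum_swap) simp
  then have "((\<lambda>j. annular_block r0 \<phi> j h F) has_sum S) UNIV"
    using annular_block_has_sum[OF h]
    by (intro has_sum_SigmaD[of "\<lambda>(j, z). c j z *\<^sub>R f z"]) (auto simp: c_def f_def Z_def)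
  then have sums: "(\<lambda>j. annular_block r0 \<phi> j h F) sums S" by (rule has_sum_imp_sums)
  then show "summable (\<lambda>j. dyadic_block \<phi> (Suc j) h F)"
    unfolding dyadic_block_Suc[where ?r0.0 = r0]
    by (rule summable_Suc_iff[THEN iffD2, OF sums_summable])
  have "S = zero_sum r0 \<phi> h F"
    using suminf_split_head[OF sums_summable[OF sums]] sums
    by (simp add: zero_sum_eq zero_tail_eq[where ?r0.0 = r0] sums_iff)
  then show "((\<lambda>z. of_int (zorder F z) *\<^sub>R h z) has_sum zero_sum r0 \<phi> h F) (zeros F \<inter> - ball 0 r0)"
    using f_sum by (simp add: f_def[abs_def] Z_def)
qed

text \<open>The partition of unity distributes a finite partial sum over the blocks, and
  nonnegativity bounds each portion by the full block.\<close>

lemma summable_on_zeros_of_summable_blocks: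
  fixes h :: "complex \<Rightarrow> real"
  assumes h: "h \<in> borel_measurable borel" "\<And>z. h z \<ge> 0"
    and blocks: "summable (\<lambda>j. annular_block r0 \<phi> j h F)"
  shows "(\<lambda>z. of_int (zorder F z) *\<^sub>R h z) summable_on (zeros F \<inter> - ball 0 r0)"
proof (rule nonneg_bounded_partial_sums_imp_summable_on)
  let ?f = "\<lambda>z. of_int (zorder F z) *\<^sub>R h z"
  show nn: "0 \<le> ?f z" for z using h(2) zorder_nonneg by simp
  show "\<forall>\<^sub>F Y in finite_subsets_at_top (zeros F \<inter> - ball 0 r0). sum ?f Y \<le> (\<Sum>j. annular_block r0 \<phi> j h F)"
    unfolding eventually_finite_subsets_at_top
  proof (intro exI[of _ "{}"] conjI allI impI)
    fix Y assume Y: "finite Y \<and> {} \<subseteq> Y \<and> Y \<subseteq> zeros F \<inter> - ball 0 r0"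
    have "(\<lambda>j. \<Sum>z\<in>Y. annular_cutoff r0 \<phi> j z *\<^sub>R ?f z) sums (\<Sum>z\<in>Y. ?f z)"
    proof (rule sums_sum)
      fix z assume "z \<in> Y"
      then have "(\<lambda>j. annular_cutoff r0 \<phi> j z) sums 1"
        using Y by (intro annular_cutoff_sums[OF cut r0]) auto
      from sums_mult2[OF this, of "?f z"]
      show "(\<lambda>j. annular_cutoff r0 \<phi> j z *\<^sub>R ?f z) sums ?f z" by simp
    qed
    moreover have "(\<Sum>z\<in>Y. annular_cutoff r0 \<phi> j z *\<^sub>R ?f z) \<le> annular_block r0 \<phi> j h F" for j
    proof (rule has_sum_mono_neutral[OF has_sum_finite annular_block_has_sum[OF h(1)]])
      fix z
      show "annular_cutoff r0 \<phi> j z *\<^sub>R ?f z \<ge> 0"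
        using nn annular_cutoff_bounds[OF cut r0] by simp
    qed (use Y in auto)
    ultimately show "sum ?f Y \<le> (\<Sum>j. annular_block r0 \<phi> j h F)"
      using blocks by (metis (no_types, lifting) suminf_le sums_iff)
  qed auto
qed

text \<open>The outer radius of the cut-off limits the zeros involved, its inner radius the size of
  \<open>h\<close> at them.\<close>

lemma norm_annular_block_le:
  fixes h :: "complex \<Rightarrow> 'b::{banach, second_countable_topology}"
  assumes h: "h \<in> borel_measurable borel" "\<And>z. norm (h z) \<le> 1 / cmod z ^ l"
  shows "norm (annular_block r0 \<phi> j h F) \<le> real (zero_count (2 ^ j * (3 * r0))) / (2 ^ j * r0) ^ l"
proof -
  define R where "R = 2 ^ j * (3 * r0)"
  note [measurable] = h annular_cutoff_measurable[OF cut r0]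
  have "annular_block r0 \<phi> j h F
      = (\<Sum>z\<in>zeros F \<inter> cball 0 R. of_int (zorder F z) *\<^sub>R (annular_cutoff r0 \<phi> j z *\<^sub>R h z))"
    unfolding annular_block_def R_def
    by (rule integral_zero_process) (measurable, use annular_cutoff_support(2)[OF cut r0] in force)
  also have "norm \<dots> \<le> (\<Sum>z\<in>zeros F \<inter> cball 0 R. real (nat (zorder F z)) * (1 / (2 ^ j * r0) ^ l))"
  proof (rule sum_norm_le)
    fix z
    have "annular_cutoff r0 \<phi> j z * norm (h z) \<le> 1 / (2 ^ j * r0) ^ l"
    proof (cases "annular_cutoff r0 \<phi> j z = 0")
      case False
      have "annular_cutoff r0 \<phi> j z * norm (h z) \<le> 1 * (1 / cmod z ^ l)"
        using annular_cutoff_bounds[OF cut r0] h(2) by (intro mult_mono) auto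
      also have "\<dots> \<le> 1 / (2 ^ j * r0) ^ l"
        using annular_cutoff_support(1)[OF cut r0 False] r0
        by (auto intro!: divide_left_mono power_mono mult_pos_pos zero_less_power
            intro: less_le_trans[OF _ annular_cutoff_support(1)[OF cut r0 False]])
      finally show ?thesis .
    qed (use r0 in simp)
    then have "of_int (zorder F z) * (annular_cutoff r0 \<phi> j z * norm (h z))
        \<le> of_int (zorder F z) * (1 / (2 ^ j * r0) ^ l)"
      by (rule mult_left_mono) (use zorder_nonneg in simp)
    then show "norm (of_int (zorder F z) *\<^sub>R (annular_cutoff r0 \<phi> j z *\<^sub>R h z))
        \<le> real (nat (zorder F z)) * (1 / (2 ^ j * r0) ^ l)"
      using zorder_nonneg[of z] annular_cutoff_bounds(1)[OF cut r0, of j z] by simp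
  qed
  also have "\<dots> = real (zero_count R) / (2 ^ j * r0) ^ l"
    by (simp add: zero_count_def sum_distrib_right[symmetric] sum_divide_distrib)
  finally show ?thesis by (simp add: R_def)
qed

end

section \<open>Summation of random series with decaying means\<close>

definition decay_sum :: real where
  "decay_sum = (\<Sum>i. (1 + real i) * (1 / sqrt 2) ^ i)"

lemma summable_decay: "summable (\<lambda>i. (1 + real i) * (1 / sqrt 2) ^ i)"
proof (rule summable_comparison_test_bigo)
  show "summable (\<lambda>n. norm (1 / real n ^ 2))"
    using inverse_power_summable[of 2, where 'a = real] by (simp add: field_simps)
  show "(\<lambda>i. (1 + real i) * (1 / sqrt 2) ^ i) \<in> O(\<lambda>n. 1 / real n ^ 2)"
    by real_asymp
qed

text \<open>Half of \<open>i * s\<close> is at least \<open>k * s / 2\<close> and provides the rate;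
  the other half is at least \<open>i / 2\<close> and keeps the factor \<open>1 + i\<close>
  summable. This is where the 2 in the exponents of the tail bounds comes from.\<close>

lemma decay_le:
  assumes "k \<le> i" "s \<ge> 1"
  shows "(1 + real i) / 2 ^ (i * s) \<le> (1 + real i) * (1 / sqrt 2) ^ i / 2 powr (real k * real s / 2)"
proof -
  have ks: "real k * real s \<le> real i * real s" "real i \<le> real i * real s"
    using assms by (auto intro: mult_right_mono mult_left_mono[of 1 "real s", simplified])
  have "(2::real) powr real (i * s) = 2 ^ (i * s)" by (rule powr_realpow) simp
  then have "1 / 2 ^ (i * s) = (2::real) powr (- (real i * real s))"
    by (simp add: powr_minus divide_inverse)
  also have "\<dots> \<le> 2 powr (- (real i / 2) - real k * real s / 2)"
    using ks by (intro powr_mono) auto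
  also have "\<dots> = 2 powr (- (real i / 2)) / 2 powr (real k * real s / 2)"
    by (simp add: powr_diff)
  also have "2 powr (- (real i / 2)) = (1 / sqrt 2) ^ i"
  proof -
    have "2 powr (- (real i / 2)) = (2 powr (- (1 / 2))) powr real i"
      unfolding powr_powr by (rule arg_cong[where f = "(powr) 2"]) (simp only: mult_minus_left times_divide_eq_left mult_1)
    also have "\<dots> = (2 powr (- (1 / 2))) ^ i" by (rule powr_realpow) simp
    also have "2 powr (- (1 / 2)) = 1 / sqrt 2"
      unfolding powr_minus using powr_half_sqrt[of 2] by (simp only: inverse_eq_divide)
    finally show ?thesis .
  qed
  finally have "(1 + real i) * (1 / 2 ^ (i * s)) \<le> (1 + real i) * ((1 / sqrt 2) ^ i / 2 powr (real k * real s / 2))"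
    by (intro mult_left_mono) auto
  then show ?thesis by simp
qed

text \<open>The sum of the norms has finite mean, which gives almost sure absolute convergence and
  permits termwise integration.\<close>

lemma suminf_random_series:
  fixes X :: "nat \<Rightarrow> 'a \<Rightarrow> 'b::{banach, second_countable_topology}"
  assumes X[measurable]: "\<And>j. X j \<in> borel_measurable M"
    and le: "\<And>j. (\<integral>\<^sup>+x. ennreal (norm (X j x)) \<partial>M) \<le> ennreal (e j)"
    and e: "summable e" "\<And>j. e j \<ge> 0"
  shows "AE x in M. summable (\<lambda>j. norm (X j x))"
    "integrable M (\<lambda>x. \<Sum>j. X j x)"
    "(LINT x|M. norm (\<Sum>j. X j x)) \<le> suminf e"
proof -
  have int: "integrable M (X j)" for j
    using le[of j] by (intro integrableI_bounded) (auto intro: le_less_trans)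
  have norm_le: "(LINT x|M. norm (X j x)) \<le> e j" for j
  proof -
    have "ennreal (LINT x|M. norm (X j x)) = (\<integral>\<^sup>+x. ennreal (norm (X j x)) \<partial>M)"
      using int by (intro nn_integral_eq_integral[symmetric]) auto
    then show ?thesis using le[of j] e(2)[of j] by (metis ennreal_le_iff)
  qed
  have "(\<integral>\<^sup>+x. (\<Sum>j. ennreal (norm (X j x))) \<partial>M) = (\<Sum>j. \<integral>\<^sup>+x. ennreal (norm (X j x)) \<partial>M)"
    by (rule nn_integral_suminf) measurable
  also have "\<dots> \<le> (\<Sum>j. ennreal (e j))" by (intro suminf_le le) auto
  also have "\<dots> = ennreal (suminf e)" by (intro suminf_ennreal2 e)
  finally have "(\<integral>\<^sup>+x. (\<Sum>j. ennreal (norm (X j x))) \<partial>M) \<noteq> \<infinity>" by (auto simp: top_unique)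
  then have "AE x in M. (\<Sum>j. ennreal (norm (X j x))) \<noteq> \<infinity>"
    by (intro nn_integral_PInf_AE) auto
  then show sm: "AE x in M. summable (\<lambda>j. norm (X j x))"
    by eventually_elim (auto intro: summable_suminf_not_top)
  have sm2: "summable (\<lambda>j. LINT x|M. norm (X j x))"
    by (rule summable_comparison_test'[OF e(1), of 0]) (use norm_le in simp)
  show int_sum: "integrable M (\<lambda>x. \<Sum>j. X j x)"
    by (rule integrable_suminf[OF int sm sm2])
  have sm': "AE x in M. summable (\<lambda>j. norm (norm (X j x)))" using sm by simp
  have sm2': "summable (\<lambda>j. LINT x|M. norm (norm (X j x)))" using sm2 by simp
  have "(LINT x|M. norm (\<Sum>j. X j x)) \<le> (LINT x|M. (\<Sum>j. norm (X j x)))"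
  proof (rule integral_mono_AE)
    show "integrable M (\<lambda>x. \<Sum>j. norm (X j x))"
      by (rule integrable_suminf[OF integrable_norm[OF int] sm' sm2'])
    show "AE x in M. norm (\<Sum>j. X j x) \<le> (\<Sum>j. norm (X j x))"
      using sm by eventually_elim (rule summable_norm)
  qed (use int_sum in simp)
  also have "\<dots> = (\<Sum>j. LINT x|M. norm (X j x))"
    by (rule integral_suminf[OF integrable_norm[OF int] sm' sm2'])
  also have "\<dots> \<le> suminf e" by (rule suminf_le[OF norm_le sm2 e(1)])
  finally show "(LINT x|M. norm (\<Sum>j. X j x)) \<le> suminf e" .
qed

section \<open>Moment bounds for the blocks\<close>

locale gaf_statistics = gaussian_sequence M \<xi>
  for M :: "'a measure" and \<xi> :: "nat \<Rightarrow> 'a \<Rightarrow> complex" +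
  fixes r0 :: real and \<phi> :: "complex \<Rightarrow> real"
  assumes cut: "radial_cutoff r0 \<phi>" and r0: "r0 > 0"
begin

lemma annular_cutoff_of_norm: "annular_cutoff r0 \<phi> j z = annular_cutoff r0 \<phi> j (of_real (cmod z))"
proof -
  have "\<phi> (z / of_real L) = \<phi> (of_real (cmod z) / of_real L)" for L
    by (rule cutoff_radial[OF cut r0]) (simp add: norm_divide)
  moreover have "\<phi> z = \<phi> (of_real (cmod z))" by (rule cutoff_radial[OF cut r0]) simp
  ultimately show ?thesis
    by (cases j) (simp_all add: annular_cutoff_def inner_cutoff_def dilate_def del: power_Suc of_real_power)
qed

text \<open>The inner cut-off jumps from 0 to 1 at modulus \<open>r0\<close>, hence the interval
  starts exactly there; its two pieces are glued at \<open>3 * r0 / 2\<close>, where \<phi> equals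
  1.\<close>

lemma continuous_on_annular_cutoff:
  "continuous_on {2 ^ j * r0..b} (\<lambda>t. annular_cutoff r0 \<phi> j (of_real t))"
proof -
  note c = continuous_on_compose2[OF continuous_on_cutoff[OF cut r0] _ subset_UNIV]
  show ?thesis
  proof (cases j)
    case 0
    have "continuous_on ({r0..3 * r0 / 2} \<union> {3 * r0 / 2..max b (3 * r0 / 2)})
        (\<lambda>t. if t \<le> 3 * r0 / 2 then 1 else \<phi> (of_real t))"
    proof (rule continuous_on_cases)
      show "continuous_on {3 * r0 / 2..max b (3 * r0 / 2)} (\<lambda>t. \<phi> (of_real t))"
        by (intro c continuous_intros)
      show "\<forall>t. t \<in> {r0..3 * r0 / 2} \<and> \<not> t \<le> 3 * r0 / 2
          \<or> t \<in> {3 * r0 / 2..max b (3 * r0 / 2)} \<and> t \<le> 3 * r0 / 2 \<longrightarrow> 1 = \<phi> (of_real t)"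
        using cutoff_eq_1[OF cut r0] r0 by auto
    qed (auto intro: continuous_intros)
    then have "continuous_on {r0..b} (\<lambda>t. if t \<le> 3 * r0 / 2 then 1 else \<phi> (of_real t))"
      by (rule continuous_on_subset) auto
    then show ?thesis
      using 0 r0 by (subst continuous_on_cong[OF refl,
            where g = "\<lambda>t. if t \<le> 3 * r0 / 2 then 1 else \<phi> (of_real t)"])
        (auto simp: annular_cutoff_def inner_cutoff_def)
  next
    case (Suc i)
    show ?thesis
      unfolding Suc annular_cutoff_def dilate_def
      by (simp del: power_Suc, intro c continuous_intros) auto
  qed
qed

text \<open>The map \<open>T\<close> unifies two cases: the identity with \<open>m = - l\<close> for
  \<open>1 / z ^ l\<close>, and \<open>Re\<close> with \<open>m = 0\<close> for
  \<open>1 / cmod z ^ l\<close>. Off \<open>nonzero_event\<close> the block has one fixed value, so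
  measurability holds without completing \<open>M\<close>.\<close>

lemma measurable_annular_block:
  fixes h :: "complex \<Rightarrow> 'b::{banach, second_countable_topology}" and T :: "complex \<Rightarrow> 'b"
  assumes h: "h \<in> borel_measurable borel" and T: "bounded_linear T"
    and v: "continuous_on {2 ^ j * r0..2 ^ j * (4 * r0)} v"
    and hv: "\<And>z. z \<noteq> 0 \<Longrightarrow> h z = T (of_real (v (cmod z)) * z powi m)"
  shows "(\<lambda>x. annular_block r0 \<phi> j h (random_gaf A x)) \<in> borel_measurable M"
proof -
  interpret T: bounded_linear T by (rule T)
  define a b where "a = 2 ^ j * r0" and "b = 2 ^ j * (4 * r0)"
  have ab: "0 < a" "a < b" "a \<le> 2 ^ j * r0" "2 ^ j * (3 * r0) < b" using r0 by (auto simp: a_def b_def)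
  define u where "u t = annular_cutoff r0 \<phi> j (of_real t) * v t" for t
  have u: "continuous_on {a..b} u"
    unfolding u_def a_def b_def by (intro continuous_intros continuous_on_annular_cutoff v)
  define S where "S x = (if nonzero_event A x then \<Sum>z | z \<in> zeros (random_gaf A x) \<and> a \<le> cmod z \<and> cmod z < b.
      of_int (zorder (random_gaf A x) z) * (of_real (u (cmod z)) * z powi m) else 0)" for x
  have [measurable]: "S \<in> borel_measurable M"
    unfolding S_def by (rule measurable_radial_statistic[OF ab(1,2) u])
  have [measurable]: "T \<in> borel_measurable borel"
    by (intro borel_measurable_continuous_onI T.continuous_on continuous_on_id)
  have "annular_block r0 \<phi> j h (random_gaf A x)
      = (if nonzero_event A x then T (S x) else annular_block r0 \<phi> j h (\<lambda>z. 0))" for x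
  proof (cases "nonzero_event A x")
    case True
    note F = entire_nonzero_event[OF True]
    have "annular_block r0 \<phi> j h (random_gaf A x)
        = (\<Sum>z | z \<in> zeros (random_gaf A x) \<and> a \<le> cmod z \<and> cmod z < b.
          of_int (zorder (random_gaf A x) z) *\<^sub>R (annular_cutoff r0 \<phi> j z *\<^sub>R h z))"
      by (rule annular_block_eq_sum[OF cut r0 F h ab(3,4)]) simp
    also have "\<dots> = (\<Sum>z | z \<in> zeros (random_gaf A x) \<and> a \<le> cmod z \<and> cmod z < b.
          T (of_int (zorder (random_gaf A x) z) * (of_real (u (cmod z)) * z powi m)))"
    proof (intro sum.cong refl)
      fix z assume "z \<in> {z. z \<in> zeros (random_gaf A x) \<and> a \<le> cmod z \<and> cmod z < b}"
      then have "z \<noteq> 0" using ab by auto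
      have "complex_of_int (zorder (random_gaf A x) z) * (of_real (u (cmod z)) * z powi m)
          = of_int (zorder (random_gaf A x) z) *\<^sub>R (annular_cutoff r0 \<phi> j z *\<^sub>R (of_real (v (cmod z)) * z powi m))"
        by (simp add: scaleR_conv_of_real u_def annular_cutoff_of_norm[of j z])
      then show "of_int (zorder (random_gaf A x) z) *\<^sub>R (annular_cutoff r0 \<phi> j z *\<^sub>R h z)
          = T (of_int (zorder (random_gaf A x) z) * (of_real (u (cmod z)) * z powi m))"
        by (simp add: T.scaleR hv[OF \<open>z \<noteq> 0\<close>])
    qed
    also have "\<dots> = T (S x)" using True by (simp add: S_def T.sum)
    finally show ?thesis using True by simp
  next
    case False
    then have "random_gaf A x = (\<lambda>z. 0)" by (auto simp: nonzero_event_def)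
    then show ?thesis using False by simp
  qed
  then show ?thesis by simp
qed

lemma measurable_block_p: "(\<lambda>x. annular_block r0 \<phi> j (\<lambda>z. 1 / z ^ l) (random_gaf A x)) \<in> borel_measurable M"
  by (rule measurable_annular_block[where T = "\<lambda>z. z" and v = "\<lambda>_. 1" and m = "- int l"])
    (auto simp: power_int_minus divide_inverse intro: bounded_linear_ident continuous_intros)

lemma measurable_block_q: "(\<lambda>x. annular_block r0 \<phi> j (\<lambda>z. 1 / cmod z ^ l) (random_gaf A x)) \<in> borel_measurable M"
proof (rule measurable_annular_block[where T = Re and v = "\<lambda>t. 1 / t ^ l" and m = 0])
  have "0 < 2 ^ j * r0" using r0 by simp
  then show "continuous_on {2 ^ j * r0..2 ^ j * (4 * r0)} (\<lambda>t. 1 / t ^ l)"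
    by (intro continuous_intros) auto
  show "1 / cmod z ^ l = Re (of_real (1 / cmod z ^ l) * z powi 0)" for z
    by (simp only: power_int_0_right mult_1_right Re_complex_of_real)
qed (auto intro: bounded_linear_Re)

text \<open>The bound for the mean of \<open>count_bound\<close> at
  \<open>R = 2 ^ j * (3 * r0)\<close> after \<open>4 ^ j\<close> is taken out, whence
  \<open>324 = 36 * 9\<close>.\<close>

definition crude_const :: "nat \<Rightarrow> real" where
  "crude_const l = (324 * r0\<^sup>2 + 6 + 2 * gauss_const) / r0 ^ l"

lemma crude_const_nonneg: "crude_const l \<ge> 0"
  using r0 gauss_const_nonneg by (simp add: crude_const_def)

text \<open>Mean zero count times the largest value of \<open>h\<close> on the support. It also
  covers \<open>j = 0\<close>, where the cut-off is discontinuous.\<close>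

lemma annular_block_crude:
  fixes h :: "complex \<Rightarrow> 'b::{banach, second_countable_topology}"
  assumes h: "h \<in> borel_measurable borel" "\<And>z. norm (h z) \<le> 1 / cmod z ^ l" and A: "0 \<in> A"
  shows "(\<integral>\<^sup>+x. ennreal (norm (annular_block r0 \<phi> j h (random_gaf A x))) \<partial>M)
    \<le> ennreal (crude_const l * 4 ^ j / 2 ^ (j * l))"
proof -
  define R where "R = 2 ^ j * (3 * r0)"
  define d where "d = 1 / (2 ^ j * r0) ^ l"
  have R: "R > 0" and d: "d > 0" using r0 by (auto simp: R_def d_def)
  have "(\<integral>\<^sup>+x. ennreal (norm (annular_block r0 \<phi> j h (random_gaf A x))) \<partial>M)
      \<le> (\<integral>\<^sup>+x. count_bound A R x * ennreal d \<partial>M)"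
  proof (rule nn_integral_mono_AE)
    show "AE x in M. ennreal (norm (annular_block r0 \<phi> j h (random_gaf A x))) \<le> count_bound A R x * ennreal d"
      using AE_entire_event
    proof eventually_elim
      case (elim x)
      have "ennreal (norm (annular_block r0 \<phi> j h (random_gaf A x)))
          \<le> ennreal (real (entire_nonzero.zero_count (random_gaf A x) R) * d)"
        using norm_annular_block_le[OF cut r0 entire_nonzero_random_gaf[OF elim A] h]
        by (intro ennreal_leI) (simp add: R_def d_def)
      also have "\<dots> = ennreal (real (entire_nonzero.zero_count (random_gaf A x) R)) * ennreal d"
        using d by (simp add: ennreal_mult)
      also have "\<dots> \<le> count_bound A R x * ennreal d"
        by (intro mult_right_mono zero_count_le_count_bound elim A R) simp
      finally show ?case .
    qed
  qed
  also have "\<dots> = (\<integral>\<^sup>+x. count_bound A R x \<partial>M) * ennreal d"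
    by (rule nn_integral_multc) measurable
  also have "\<dots> \<le> ennreal (36 * R\<^sup>2 + 6 + 2 * gauss_const) * ennreal d"
    by (intro mult_right_mono nn_integral_count_bound R A) simp
  also have "\<dots> = ennreal ((36 * R\<^sup>2 + 6 + 2 * gauss_const) * d)"
    using d gauss_const_nonneg by (simp add: ennreal_mult del: ennreal_plus)
  also have "\<dots> \<le> ennreal (crude_const l * 4 ^ j / 2 ^ (j * l))"
  proof (rule ennreal_leI)
    have one: "(1::real) \<le> 4 ^ j" by simp
    have "R\<^sup>2 = 4 ^ j * (9 * r0\<^sup>2)"
      by (simp add: R_def power_mult_distrib power2_eq_square flip: power_mult_distrib)
    moreover have "6 + 2 * gauss_const \<le> 4 ^ j * (6 + 2 * gauss_const)"
      using mult_right_mono[OF one, of "6 + 2 * gauss_const"] gauss_const_nonneg by simp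
    ultimately have "36 * R\<^sup>2 + 6 + 2 * gauss_const \<le> 4 ^ j * (324 * r0\<^sup>2 + 6 + 2 * gauss_const)"
      by (simp add: algebra_simps)
    then have "(36 * R\<^sup>2 + 6 + 2 * gauss_const) * d \<le> 4 ^ j * (324 * r0\<^sup>2 + 6 + 2 * gauss_const) * d"
      using d by (intro mult_right_mono) auto
    then show "(36 * R\<^sup>2 + 6 + 2 * gauss_const) * d \<le> crude_const l * 4 ^ j / 2 ^ (j * l)"
      by (simp add: crude_const_def d_def power_mult_distrib power_mult mult_ac)
  qed
  finally show ?thesis .
qed

text \<open>Takes the mean of the radial integral, for \<open>j >= 1\<close>, where the cut-off is a
  dilate of the smooth \<phi>. With \<open>L = 2 ^ j\<close>, the interval has length of order
  \<open>L\<close>, the weight \<open>\<bar>w\<bar> / r ^ l\<close> is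
  \<open>O(L ^ (- 1 - l))\<close>, and the mean deviation of the logarithm is
  \<open>O(1 + j)\<close>.\<close>

lemma annular_block_p_bound:
  obtains K where "\<And>l. K l \<ge> 0"
    "\<And>A j l. 0 \<in> A \<Longrightarrow> (\<And>i j. i \<le> j \<Longrightarrow> j \<in> A \<Longrightarrow> i \<in> A) \<Longrightarrow> j \<ge> 1 \<Longrightarrow> l \<ge> 1 \<Longrightarrow>
      (\<integral>\<^sup>+x. ennreal (cmod (annular_block r0 \<phi> j (\<lambda>z. 1 / z ^ l) (random_gaf A x))) \<partial>M)
        \<le> ennreal (K l * ((1 + real j) / 2 ^ (j * l)))"
proof -
  obtain g1 g2 where g: "\<And>t. ((\<lambda>t. \<phi> (of_real t)) has_real_derivative g1 t) (at t)"
    "\<And>t. (g1 has_real_derivative g2 t) (at t)" "continuous_on UNIV g2" "g1 (r0 / 2) = 0" "g1 (4 * r0) = 0"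
    using cutoff_profile[OF cut r0] by metis
  have cont_g1: "continuous_on UNIV g1" by (meson DERIV_continuous_on has_field_derivative_at_within g(2))
  have [measurable]: "g1 \<in> borel_measurable borel" "g2 \<in> borel_measurable borel"
    by (intro borel_measurable_continuous_onI cont_g1 g(3))+
  have bdd: "\<exists>B\<ge>0. \<forall>t\<in>{r0 / 2..4 * r0}. \<bar>f t\<bar> \<le> B" if "continuous_on UNIV f" for f :: "real \<Rightarrow> real"
  proof -
    have "compact (f ` {r0 / 2..4 * r0})"
      by (intro compact_continuous_image continuous_on_subset[OF that]) auto
    then obtain B where "\<forall>y\<in>f ` {r0 / 2..4 * r0}. norm y \<le> B"
      using compact_imp_bounded bounded_iff by metis
    then show ?thesis by (intro exI[of _ "max B 0"]) auto
  qed
  obtain M1 where M1: "M1 \<ge> 0" "\<And>t. t \<in> {r0 / 2..4 * r0} \<Longrightarrow> \<bar>g1 t\<bar> \<le> M1" using bdd[OF cont_g1] by blast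
  obtain M2 where M2: "M2 \<ge> 0" "\<And>t. t \<in> {r0 / 2..4 * r0} \<Longrightarrow> \<bar>g2 t\<bar> \<le> M2" using bdd[OF g(3)] by blast
  \<comment> \<open>Chosen so that
    \<open>gauss_const + 2 + ln (4 * r ^ 2 + 3) <= c0 * (1 + j)\<close> for
    \<open>r <= 4 * r0 * 2 ^ j\<close>; the summand 4 ensures \<open>c0 >= ln 4\<close>, the growth
    per step of \<open>j\<close>.\<close>
  define c0 where "c0 = gauss_const + 4 + ln (64 * r0\<^sup>2 + 3)"
  have ln64: "ln (64 * r0\<^sup>2 + 3) \<ge> 0" using zero_le_power2[of r0] by (intro ln_ge_zero) linarith
  have c0: "c0 \<ge> 0" using gauss_const_nonneg ln64 by (simp add: c0_def)
  \<comment> \<open>In order: a bound for \<open>L * \<bar>w r\<bar>\<close>, the interval length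
    divided by \<open>L\<close>, the logarithmic factor, and \<open>L ^ l / r ^ l\<close> at the
    left end \<open>r = L * r0 / 2\<close>.\<close>
  define K where "K l = (4 * r0 * M2 + 2 * real l * M1) * (4 * r0) * c0 * (2 / r0) ^ l" for l
  have K0: "K l \<ge> 0" for l unfolding K_def using r0 M1 M2 c0 by simp
  have "(\<integral>\<^sup>+x. ennreal (cmod (annular_block r0 \<phi> j (\<lambda>z. 1 / z ^ l) (random_gaf A x))) \<partial>M)
        \<le> ennreal (K l * ((1 + real j) / 2 ^ (j * l)))"
    if A: "0 \<in> A" "\<And>i j. i \<le> j \<Longrightarrow> j \<in> A \<Longrightarrow> i \<in> A" and jl: "j \<ge> 1" "l \<ge> 1" for A j l
  proof -
    define L where "L = (2::real) ^ j"
    have L: "L \<ge> 1" by (simp add: L_def)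
    define a b where "a = L * r0 / 2" and "b = L * (4 * r0)"
    have ab: "0 < a" "a \<le> b" "a \<le> 2 ^ j * r0" "2 ^ j * (3 * r0) < b"
      using r0 L by (auto simp: a_def b_def L_def)
    define u where "u r = \<phi> (of_real (r / L))" for r
    define u1 where "u1 r = g1 (r / L) / L" for r
    define u2 where "u2 r = g2 (r / L) / L\<^sup>2" for r
    define w where "w r = r * u2 r + (1 - 2 * real l) * u1 r" for r
    define G where "G x r t = ennreal (\<bar>w r\<bar> / r ^ l * \<bar>ln (cmod (random_gaf A x (circ r t))) - ln (majorant A r)\<bar>)" for x r t
    have du: "(u has_real_derivative u1 r) (at r within S)" for r S
    proof -
      have "((\<lambda>r. r / L) has_real_derivative 1 / L) (at r)"
        using L by (auto intro!: derivative_eq_intros)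
      from DERIV_chain2[OF g(1) this] show ?thesis
        unfolding u_def u1_def by (auto intro: has_field_derivative_at_within)
    qed
    have du1: "(u1 has_real_derivative u2 r) (at r within S)" for r S
    proof -
      have "((\<lambda>r. r / L) has_real_derivative 1 / L) (at r)"
        using L by (auto intro!: derivative_eq_intros)
      from DERIV_cdivide[OF DERIV_chain2[OF g(2) this], of L] show ?thesis
        unfolding u1_def u2_def by (auto intro: has_field_derivative_at_within simp: power2_eq_square)
    qed
    have cont_u2: "continuous_on S u2" for S
      unfolding u2_def using L
      by (intro continuous_intros continuous_on_compose2[OF g(3)]) auto
    have out: "\<phi> (of_real s) = 0" if "s \<ge> 0" "s < r0 \<or> 3 * r0 < s" for s :: real
      using cutoff_support[OF cut r0, of "of_real s"] that by (cases "\<phi> (of_real s) = 0") auto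
    have aL: "a / L = r0 / 2" "b / L = 4 * r0" using L by (auto simp: a_def b_def)
    have bd: "u a = 0" "u b = 0" "u1 a = 0" "u1 b = 0"
      unfolding u_def u1_def aL using out[of "r0 / 2"] out[of "4 * r0"] g(4,5) r0 by auto
    have [measurable]: "majorant A \<in> borel_measurable borel"
      unfolding majorant_def[abs_def] majorant_term_def[abs_def] by measurable
    have [measurable]: "w \<in> borel_measurable borel"
      unfolding w_def u1_def u2_def by measurable
    have "(\<integral>\<^sup>+x. ennreal (cmod (annular_block r0 \<phi> j (\<lambda>z. 1 / z ^ l) (random_gaf A x))) \<partial>M)
        \<le> (\<integral>\<^sup>+x. (\<integral>\<^sup>+r\<in>{a..b}. \<integral>\<^sup>+t\<in>{0..1}. G x r t \<partial>lborel \<partial>lborel) \<partial>M)"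
    proof (rule nn_integral_mono_AE)
      show "AE x in M. ennreal (cmod (annular_block r0 \<phi> j (\<lambda>z. 1 / z ^ l) (random_gaf A x)))
          \<le> (\<integral>\<^sup>+r\<in>{a..b}. \<integral>\<^sup>+t\<in>{0..1}. G x r t \<partial>lborel \<partial>lborel)"
        using AE_entire_event
      proof eventually_elim
        case (elim x)
        interpret entire_nonzero "random_gaf A x" by (rule entire_nonzero_random_gaf[OF elim A(1)])
        have "annular_block r0 \<phi> j (\<lambda>z. 1 / z ^ l) (random_gaf A x)
            = (\<Sum>z | z \<in> zeros (random_gaf A x) \<and> a \<le> cmod z \<and> cmod z \<le> b.
              of_int (zorder (random_gaf A x) z) *\<^sub>R (annular_cutoff r0 \<phi> j z *\<^sub>R (1 / z ^ l)))"
          by (rule annular_block_eq_sum[OF cut r0 entire_nonzero_axioms _ ab(3,4)]) auto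
        also have "\<dots> = (\<Sum>z | z \<in> zeros (random_gaf A x) \<and> a \<le> cmod z \<and> cmod z \<le> b.
              of_int (zorder (random_gaf A x) z) * (of_real (u (cmod z)) / z ^ l))"
        proof (intro sum.cong refl)
          fix z
          have "annular_cutoff r0 \<phi> j z = u (cmod z)"
            unfolding annular_cutoff_of_norm[of j z] using jl
            by (cases j) (simp_all add: annular_cutoff_def dilate_def u_def L_def)
          then show "of_int (zorder (random_gaf A x) z) *\<^sub>R (annular_cutoff r0 \<phi> j z *\<^sub>R (1 / z ^ l))
            = of_int (zorder (random_gaf A x) z) * (of_real (u (cmod z)) / z ^ l)"
            by (simp add: scaleR_conv_of_real)
        qed
        finally show ?case
          using radial_statistic_le[OF ab(1,2) _ du du1 cont_u2 bd, of l "\<lambda>r. ln (majorant A r)"] jl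
          unfolding G_def w_def by simp
      qed
    qed
    \<comment> \<open>Tonelli moves the expectation inside, so that the estimate at a single point
      of the plane applies for each \<open>r\<close> and \<open>t\<close>.\<close>
    also have "\<dots> = (\<integral>\<^sup>+r. (\<integral>\<^sup>+x. (\<integral>\<^sup>+t\<in>{0..1}. G x r t \<partial>lborel) * indicator {a..b} r \<partial>M) \<partial>lborel)"
    proof -
      interpret P: pair_sigma_finite M "lborel :: real measure" ..
      have "(\<lambda>p. \<integral>\<^sup>+t. G (fst p) (snd p) t * indicator {0..1} t \<partial>lborel) \<in> borel_measurable (M \<Otimes>\<^sub>M lborel)"
        unfolding G_def by measurable
      then have "(\<lambda>p. (\<integral>\<^sup>+t\<in>{0..1}. G (fst p) (snd p) t \<partial>lborel) * indicator {a..b} (snd p))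
          \<in> borel_measurable (M \<Otimes>\<^sub>M lborel)"
        by measurable
      from P.Fubini[OF this] show ?thesis by simp
    qed
    also have "\<dots> \<le> (\<integral>\<^sup>+r. ennreal (K l * ((1 + real j) / 2 ^ (j * l)) / (4 * L * r0)) * indicator {a..b} r \<partial>lborel)"
    proof (rule nn_integral_mono)
      fix r :: real
      show "(\<integral>\<^sup>+x. (\<integral>\<^sup>+t\<in>{0..1}. G x r t \<partial>lborel) * indicator {a..b} r \<partial>M)
          \<le> ennreal (K l * ((1 + real j) / 2 ^ (j * l)) / (4 * L * r0)) * indicator {a..b} r"
      proof (cases "r \<in> {a..b}")
        case True
        then have r: "r > 0" "r / L \<in> {r0 / 2..4 * r0}" "a \<le> r" "r \<le> b"
          using ab L by (auto simp: a_def b_def field_simps)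
        define E where "E = gauss_const + 2 + ln (4 * r\<^sup>2 + 3)"
        have W: "\<bar>w r\<bar> / r ^ l \<ge> 0" using r by simp
        interpret P: pair_sigma_finite M "lborel :: real measure" ..
        have "(\<lambda>p. G (fst p) r (snd p) * indicator {0..1} (snd p)) \<in> borel_measurable (M \<Otimes>\<^sub>M lborel)"
          unfolding G_def by measurable
        from P.Fubini[OF this] have "(\<integral>\<^sup>+x. (\<integral>\<^sup>+t\<in>{0..1}. G x r t \<partial>lborel) \<partial>M)
            = (\<integral>\<^sup>+t. (\<integral>\<^sup>+x. G x r t * indicator {0..1} t \<partial>M) \<partial>lborel)" by simp
        also have "\<dots> \<le> (\<integral>\<^sup>+t. ennreal (\<bar>w r\<bar> / r ^ l * E) * indicator {0..1::real} t \<partial>lborel)"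
        proof (rule nn_integral_mono)
          fix t :: real
          have "(\<integral>\<^sup>+x. G x r t \<partial>M) = ennreal (\<bar>w r\<bar> / r ^ l) *
              (\<integral>\<^sup>+x. ennreal \<bar>ln (cmod (random_gaf A x (circ r t))) - ln (majorant A r)\<bar> \<partial>M)"
            unfolding G_def ennreal_mult'[OF W] by (rule nn_integral_cmult) measurable
          also have "\<dots> \<le> ennreal (\<bar>w r\<bar> / r ^ l) * ennreal E"
            unfolding E_def using r A by (intro mult_left_mono nn_integral_ln_random_gaf) auto
          also have "\<dots> = ennreal (\<bar>w r\<bar> / r ^ l * E)"
            by (rule ennreal_mult'[OF W, symmetric])
          finally show "(\<integral>\<^sup>+x. G x r t * indicator {0..1} t \<partial>M) \<le> ennreal (\<bar>w r\<bar> / r ^ l * E) * indicator {0..1} t"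
            by (auto simp: indicator_def)
        qed
        also have "\<dots> = ennreal (\<bar>w r\<bar> / r ^ l * E)"
          by (subst nn_integral_cmult_indicator) simp_all
        also have "\<dots> \<le> ennreal (K l * ((1 + real j) / 2 ^ (j * l)) / (4 * L * r0))"
        proof (rule ennreal_leI)
          have w: "\<bar>w r\<bar> \<le> (4 * r0 * M2 + 2 * real l * M1) / L"
          proof -
            have "\<bar>w r\<bar> \<le> \<bar>r * u2 r\<bar> + \<bar>(1 - 2 * real l) * u1 r\<bar>"
              unfolding w_def by (rule abs_triangle_ineq)
            also have "\<dots> = (r / L * \<bar>g2 (r / L)\<bar> + \<bar>1 - 2 * real l\<bar> * \<bar>g1 (r / L)\<bar>) / L"
              using r L by (simp add: u1_def u2_def abs_mult power2_eq_square add_divide_distrib)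
            also have "\<dots> \<le> (4 * r0 * M2 + 2 * real l * M1) / L"
              using r L M1 M2 r0 jl by (intro divide_right_mono add_mono mult_mono) auto
            finally show ?thesis .
          qed
          have E: "E \<le> c0 * (1 + real j)"
          proof -
            have "r\<^sup>2 \<le> b\<^sup>2" using r by (intro power_mono) auto
            also have "b\<^sup>2 = 16 * r0\<^sup>2 * 4 ^ j"
              by (simp add: b_def L_def power_mult_distrib power2_eq_square flip: power_mult_distrib)
            finally have "4 * r\<^sup>2 + 3 \<le> 64 * r0\<^sup>2 * 4 ^ j + 3 * 4 ^ j"
              using one_le_power[of "4::real" j] by linarith
            also have "\<dots> = (64 * r0\<^sup>2 + 3) * 4 ^ j" by (simp add: algebra_simps)
            finally have le: "4 * r\<^sup>2 + 3 \<le> (64 * r0\<^sup>2 + 3) * 4 ^ j" .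
            have pos: "4 * r\<^sup>2 + 3 > 0" "64 * r0\<^sup>2 + 3 > 0"
              using zero_le_power2[of r] zero_le_power2[of r0] by linarith+
            have "ln (4 * r\<^sup>2 + 3) \<le> ln ((64 * r0\<^sup>2 + 3) * 4 ^ j)"
              using le pos by (subst ln_le_cancel_iff) auto
            also have "\<dots> = ln (64 * r0\<^sup>2 + 3) + real j * ln 4"
              using pos by (simp add: ln_mult_pos ln_realpow)
            finally have "ln (4 * r\<^sup>2 + 3) \<le> ln (64 * r0\<^sup>2 + 3) + real j * ln 4" .
            moreover have "real j * ln 4 \<le> real j * 3"
              using ln_le_minus_one[of 4] by (intro mult_left_mono) auto
            moreover have "c0 * (1 + real j) = c0 + c0 * real j" by (simp add: algebra_simps)
            moreover have "4 * real j \<le> c0 * real j"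
              using gauss_const_nonneg ln64 by (intro mult_right_mono) (auto simp: c0_def)
            ultimately show ?thesis unfolding E_def c0_def by linarith
          qed
          have E0: "E \<ge> 0" unfolding E_def using gauss_const_nonneg zero_le_power2[of r]
            by (intro add_nonneg_nonneg ln_ge_zero) auto
          have rl: "(L * r0 / 2) ^ l \<le> r ^ l" using r L r0 by (intro power_mono) (auto simp: a_def)
          have "\<bar>w r\<bar> / r ^ l * E \<le> ((4 * r0 * M2 + 2 * real l * M1) / L) / (L * r0 / 2) ^ l * (c0 * (1 + real j))"
            using w rl E E0 r L r0 M1 M2 c0
            by (intro mult_mono frac_le) auto
          also have "\<dots> = K l * ((1 + real j) / 2 ^ (j * l)) / (4 * L * r0)"
            using L r0 by (simp add: K_def L_def power_mult_distrib power_divide field_simps flip: power_mult)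
          finally show "\<bar>w r\<bar> / r ^ l * E \<le> K l * ((1 + real j) / 2 ^ (j * l)) / (4 * L * r0)" .
        qed
        finally show ?thesis using True by simp
      qed simp
    qed
    also have "\<dots> = ennreal (K l * ((1 + real j) / 2 ^ (j * l)) / (4 * L * r0)) * ennreal (b - a)"
      using ab by (simp add: nn_integral_cmult_indicator)
    also have "\<dots> \<le> ennreal (K l * ((1 + real j) / 2 ^ (j * l)) / (4 * L * r0)) * ennreal (4 * L * r0)"
      using ab by (intro mult_left_mono ennreal_leI) (auto simp: b_def)
    also have "\<dots> = ennreal (K l * ((1 + real j) / 2 ^ (j * l)))"
      using L r0 K0[of l] by (simp flip: ennreal_mult)
    finally show ?thesis .
  qed
  then show ?thesis using that K0 by blast
qed

text \<open>The decay parameter \<open>s\<close> is \<open>l\<close> for \<open>1 / z ^ l\<close>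
  and \<open>l - 2\<close> for \<open>1 / cmod z ^ l\<close>.\<close>

lemma zero_tail_bound:
  fixes h :: "complex \<Rightarrow> 'b::{banach, second_countable_topology}"
  assumes meas: "\<And>j. (\<lambda>x. annular_block r0 \<phi> j h (random_gaf A x)) \<in> borel_measurable M"
    and K: "K \<ge> 0"
    and le: "\<forall>j\<ge>1. (\<integral>\<^sup>+x. ennreal (norm (annular_block r0 \<phi> j h (random_gaf A x))) \<partial>M)
        \<le> ennreal (K * ((1 + real j) / 2 ^ (j * s)))"
    and s: "s \<ge> 1" and k: "k \<ge> 1"
  shows "AE x in M. summable (\<lambda>j. norm (annular_block r0 \<phi> (k + j) h (random_gaf A x)))"
    "integrable M (\<lambda>x. zero_tail \<phi> k h (random_gaf A x))"
    "(LINT x|M. norm (zero_tail \<phi> k h (random_gaf A x))) \<le> K * decay_sum / 2 powr (real k * real s / 2)"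
proof -
  define d where "d i = (1 + real i) * (1 / sqrt 2) ^ i" for i
  define c where "c = K / 2 powr (real k * real s / 2)"
  have c: "c \<ge> 0" using K by (simp add: c_def)
  have d: "d i \<ge> 0" for i by (simp add: d_def)
  have sm: "summable d" unfolding d_def by (rule summable_decay)
  have sm': "summable (\<lambda>j. d (k + j))"
    using summable_ignore_initial_segment[OF sm, of k] by (simp add: add.commute)
  have "(\<integral>\<^sup>+x. ennreal (norm (annular_block r0 \<phi> (k + j) h (random_gaf A x))) \<partial>M) \<le> ennreal (c * d (k + j))" for j
  proof -
    have "(1 + real (k + j)) / 2 ^ ((k + j) * s) \<le> d (k + j) / 2 powr (real k * real s / 2)"
      unfolding d_def by (rule decay_le) (use s in auto)
    from mult_left_mono[OF this K] have "K * ((1 + real (k + j)) / 2 ^ ((k + j) * s)) \<le> c * d (k + j)"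
      by (simp add: c_def)
    then show ?thesis using le[rule_format, of "k + j"] k by (meson ennreal_leI le_add1 order_trans)
  qed
  note series = suminf_random_series[OF meas this summable_mult[OF sm']]
  have nn: "c * d (k + j) \<ge> 0" for j using c d by simp
  show "AE x in M. summable (\<lambda>j. norm (annular_block r0 \<phi> (k + j) h (random_gaf A x)))"
    using series(1) nn by simp
  show "integrable M (\<lambda>x. zero_tail \<phi> k h (random_gaf A x))"
    using series(2) nn by (simp add: zero_tail_eq[OF k, where ?r0.0 = r0])
  have "(LINT x|M. norm (zero_tail \<phi> k h (random_gaf A x))) \<le> (\<Sum>j. c * d (k + j))"
    using series(3) nn by (simp add: zero_tail_eq[OF k, where ?r0.0 = r0])
  also have "\<dots> = c * (\<Sum>j. d (k + j))" by (rule suminf_mult[OF sm'])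
  also have "\<dots> \<le> c * suminf d"
    using suminf_split_initial_segment[OF sm, of k] sum_nonneg[of "{..<k}" d] d c
    by (intro mult_left_mono) (auto simp: add.commute)
  finally show "(LINT x|M. norm (zero_tail \<phi> k h (random_gaf A x))) \<le> K * decay_sum / 2 powr (real k * real s / 2)"
    by (simp add: c_def decay_sum_def d_def[abs_def])
qed

text \<open>Block 0 gets the crude bound; the remaining blocks are the tail from
  \<open>k = 1\<close>.\<close>

lemma zero_sum_bound:
  fixes h :: "complex \<Rightarrow> 'b::{banach, second_countable_topology}"
  assumes h: "h \<in> borel_measurable borel" "\<And>z. norm (h z) \<le> 1 / cmod z ^ l" and A: "0 \<in> A"
    and meas: "\<And>j. (\<lambda>x. annular_block r0 \<phi> j h (random_gaf A x)) \<in> borel_measurable M"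
    and K: "K \<ge> 0"
    and le: "\<forall>j\<ge>1. (\<integral>\<^sup>+x. ennreal (norm (annular_block r0 \<phi> j h (random_gaf A x))) \<partial>M)
        \<le> ennreal (K * ((1 + real j) / 2 ^ (j * s)))"
    and s: "s \<ge> 1"
  shows "AE x in M. summable (\<lambda>j. dyadic_block \<phi> (Suc j) h (random_gaf A x))"
    "AE x in M. summable (\<lambda>j. annular_block r0 \<phi> j h (random_gaf A x))"
    "integrable M (\<lambda>x. zero_sum r0 \<phi> h (random_gaf A x))"
    "(LINT x|M. norm (zero_sum r0 \<phi> h (random_gaf A x))) \<le> crude_const l + K * decay_sum"
proof -
  note tail = zero_tail_bound[OF meas K le s order_refl]
  show "AE x in M. summable (\<lambda>j. dyadic_block \<phi> (Suc j) h (random_gaf A x))"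
    using tail(1) by eventually_elim (auto simp: dyadic_block_Suc[where ?r0.0 = r0] intro: summable_norm_cancel)
  then show "AE x in M. summable (\<lambda>j. annular_block r0 \<phi> j h (random_gaf A x))"
    by eventually_elim (simp add: dyadic_block_Suc[where ?r0.0 = r0], subst (asm) summable_Suc_iff)
  have nn0: "(\<integral>\<^sup>+x. ennreal (norm (annular_block r0 \<phi> 0 h (random_gaf A x))) \<partial>M) \<le> ennreal (crude_const l)"
    using annular_block_crude[OF h A, of 0] by simp
  then have int0: "integrable M (\<lambda>x. annular_block r0 \<phi> 0 h (random_gaf A x))"
    using meas[of 0] by (intro integrableI_bounded) (auto intro: le_less_trans)
  have "ennreal (LINT x|M. norm (annular_block r0 \<phi> 0 h (random_gaf A x)))
      = (\<integral>\<^sup>+x. ennreal (norm (annular_block r0 \<phi> 0 h (random_gaf A x))) \<partial>M)"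
    using int0 by (intro nn_integral_eq_integral[symmetric]) auto
  then have le0: "(LINT x|M. norm (annular_block r0 \<phi> 0 h (random_gaf A x))) \<le> crude_const l"
    using nn0 crude_const_nonneg by (metis ennreal_le_iff)
  show int: "integrable M (\<lambda>x. zero_sum r0 \<phi> h (random_gaf A x))"
    unfolding zero_sum_eq using int0 tail(2) by (rule Bochner_Integration.integrable_add)
  have "(LINT x|M. norm (zero_sum r0 \<phi> h (random_gaf A x)))
      \<le> (LINT x|M. norm (annular_block r0 \<phi> 0 h (random_gaf A x)) + norm (zero_tail \<phi> 1 h (random_gaf A x)))"
    using int int0 tail(2) unfolding zero_sum_eq by (intro integral_mono) (auto intro: norm_triangle_ineq)
  also have "\<dots> = (LINT x|M. norm (annular_block r0 \<phi> 0 h (random_gaf A x))) + (LINT x|M. norm (zero_tail \<phi> 1 h (random_gaf A x)))"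
    using int0 tail(2) by (intro Bochner_Integration.integral_add) auto
  also have "\<dots> \<le> crude_const l + K * decay_sum / 2 powr (real 1 * real s / 2)"
    using le0 tail(3) by (rule add_mono)
  also have "\<dots> \<le> crude_const l + K * decay_sum"
  proof -
    have "decay_sum \<ge> 0" unfolding decay_sum_def by (intro suminf_nonneg summable_decay) simp
    then have "K * decay_sum / 2 powr (real 1 * real s / 2) \<le> K * decay_sum / 1"
      using K by (intro divide_left_mono) (auto intro: ge_one_powr_ge_zero)
    then show ?thesis by simp
  qed
  finally show "(LINT x|M. norm (zero_sum r0 \<phi> h (random_gaf A x))) \<le> crude_const l + K * decay_sum" .
qed

end

context gaf_statistics
begin

text \<open>The growth \<open>4 ^ j\<close> of the zero count costs two powers of
  \<open>2 ^ j\<close>, leaving the decay \<open>l - 2\<close>; the factor \<open>1 + j\<close> is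
  inserted to match the form used for the tails.\<close>

lemma block_q_le:
  assumes A: "0 \<in> A" and l: "l \<ge> 3"
  shows "\<forall>j\<ge>1. (\<integral>\<^sup>+x. ennreal (norm (annular_block r0 \<phi> j (\<lambda>z. 1 / cmod z ^ l) (random_gaf A x))) \<partial>M)
        \<le> ennreal (crude_const l * ((1 + real j) / 2 ^ (j * (l - 2))))"
proof (intro allI impI)
  fix j :: nat
  have "(4::real) ^ j * 2 ^ (j * (l - 2)) = 2 ^ (j * l)"
  proof -
    have "(4::real) ^ j = 2 ^ (2 * j)" by (simp add: power_mult)
    moreover have "2 * j + j * (l - 2) = j * l" using l by (simp add: diff_mult_distrib2)
    ultimately show ?thesis by (simp flip: power_add)
  qed
  then have "(4::real) ^ j / 2 ^ (j * l) = 1 / 2 ^ (j * (l - 2))"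
    by (simp add: field_simps)
  also have "\<dots> \<le> (1 + real j) / 2 ^ (j * (l - 2))" by (intro divide_right_mono) auto
  finally have "crude_const l * (4 ^ j / 2 ^ (j * l)) \<le> crude_const l * ((1 + real j) / 2 ^ (j * (l - 2)))"
    by (rule mult_left_mono[OF _ crude_const_nonneg])
  then show "(\<integral>\<^sup>+x. ennreal (norm (annular_block r0 \<phi> j (\<lambda>z. 1 / cmod z ^ l) (random_gaf A x))) \<partial>M)
        \<le> ennreal (crude_const l * ((1 + real j) / 2 ^ (j * (l - 2))))"
    by (intro order_trans[OF annular_block_crude[where l = l]] A ennreal_leI) auto
qed

text \<open>On \<open>entire_event\<close> the polynomial has a nonzero constant coefficient, hence
  finitely many roots.\<close>

lemma finite_zeros_truncation:
  assumes "entire_event x"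
  shows "finite (zeros (random_gaf {..n} x))"
proof -
  have "zeros (random_gaf {..n} x) = {z. (\<Sum>k\<le>n. \<xi> k x / complex_of_real (sqrt (fact k)) * z ^ k) = 0}"
    unfolding random_gaf_def gaf_trunc_eq_gaf[symmetric] by (simp add: zeros_def gaf_trunc_def)
  moreover have "\<xi> 0 x / complex_of_real (sqrt (fact 0)) \<noteq> 0"
    using assms by (simp add: entire_event_def)
  ultimately show ?thesis
    unfolding polyfun_finite_roots[of "\<lambda>k. \<xi> k x / complex_of_real (sqrt (fact k))" n]
    by (simp only: polyfun_finite_roots) blast
qed

lemma AE_zero_sum_truncation:
  fixes h :: "complex \<Rightarrow> 'b::{banach, second_countable_topology}"
  assumes h: "h \<in> borel_measurable borel"
  shows "AE x in M. summable (\<lambda>j. dyadic_block \<phi> (Suc j) h (random_gaf {..n} x)) \<and>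
    ((\<lambda>z. of_int (zorder (random_gaf {..n} x) z) *\<^sub>R h z) has_sum zero_sum r0 \<phi> h (random_gaf {..n} x))
      (zeros (random_gaf {..n} x) \<inter> - ball 0 r0)"
  using AE_entire_event
proof eventually_elim
  case (elim x)
  have F: "entire_nonzero (random_gaf {..n} x)" by (rule entire_nonzero_random_gaf[OF elim]) simp
  have "(\<lambda>z. norm (of_int (zorder (random_gaf {..n} x) z) *\<^sub>R h z)) summable_on (zeros (random_gaf {..n} x) \<inter> - ball 0 r0)"
    using finite_zeros_truncation[OF elim] by (intro summable_on_finite) auto
  from zero_sum_has_sum[OF cut r0 F h this] show ?case by blast
qed

text \<open>All terms are nonnegative, so convergence of the block series already yields absolute
  summability over the zeros; the partition of unity then identifies the value.\<close>

lemma AE_zero_sum_abs: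
  assumes l: "l \<ge> 3"
  shows "AE x in M. ((\<lambda>z. of_int (zorder (random_gaf UNIV x) z) *\<^sub>R (1 / cmod z ^ l)) has_sum
      zero_sum r0 \<phi> (\<lambda>z. 1 / cmod z ^ l) (random_gaf UNIV x)) (zeros (random_gaf UNIV x) \<inter> - ball 0 r0)"
proof -
  let ?h = "\<lambda>z. 1 / cmod z ^ l"
  have h: "?h \<in> borel_measurable borel" by measurable
  have "AE x in M. summable (\<lambda>j. annular_block r0 \<phi> j ?h (random_gaf UNIV x))"
    using l by (intro zero_sum_bound(2)[OF h _ _ measurable_block_q crude_const_nonneg block_q_le]) auto
  then show ?thesis
    using AE_entire_event
  proof eventually_elim
    case (elim x)
    have F: "entire_nonzero (random_gaf UNIV x)" by (rule entire_nonzero_random_gaf[OF elim(2)]) simp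
    have "(\<lambda>z. of_int (zorder (random_gaf UNIV x) z) *\<^sub>R ?h z) summable_on (zeros (random_gaf UNIV x) \<inter> - ball 0 r0)"
      by (rule summable_on_zeros_of_summable_blocks[OF cut r0 F h _ elim(1)]) simp
    moreover have eq: "norm (of_int (zorder (random_gaf UNIV x) z) *\<^sub>R ?h z) = of_int (zorder (random_gaf UNIV x) z) *\<^sub>R ?h z" for z
      using entire_nonzero.zorder_nonneg[OF F, of z] by simp
    ultimately show ?case by (intro zero_sum_has_sum(2)[OF cut r0 F h]) (simp only: eq)
  qed
qed

end

theorem proposition10p13:
  fixes M :: "'a measure" and \<xi> :: "nat \<Rightarrow> 'a \<Rightarrow> complex"
    and r0 :: real and \<phi> :: "complex \<Rightarrow> real"
  assumes "prob_space M"
    and "prob_space.indep_vars M (\<lambda>_. borel) \<xi> UNIV"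
    and "\<And>k. std_complex_gaussian M (\<xi> k)"
    and "0 < r0"
    and "radial_cutoff r0 \<phi>"
  shows
    "let f = (\<lambda>x. gaf (\<lambda>k. \<xi> k x));
         f\<^sub>n = (\<lambda>n x. gaf_trunc n (\<lambda>k. \<xi> k x));
         p = (\<lambda>(l::nat) z. 1 / z ^ l);
         q = (\<lambda>(l::nat) z. 1 / cmod z ^ l);
         D = ball (0::complex) r0
     in
      (\<forall>l\<ge>1.
         (\<forall>n. AE x in M. summable (\<lambda>j. dyadic_block \<phi> (Suc j) (p l) (f\<^sub>n n x)) \<and>
            ((\<lambda>z. of_int (zorder (f\<^sub>n n x) z) * (1 / z ^ l)) has_sum
               zero_sum r0 \<phi> (p l) (f\<^sub>n n x)) (zeros (f\<^sub>n n x) \<inter> - D)) \<and>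
         (\<forall>n. integrable M (\<lambda>x. zero_sum r0 \<phi> (p l) (f\<^sub>n n x))) \<and>
         (\<exists>B. \<forall>n. (LINT x|M. cmod (zero_sum r0 \<phi> (p l) (f\<^sub>n n x))) \<le> B)) \<and>
      (\<forall>l\<ge>3.
         (\<forall>n. AE x in M. summable (\<lambda>j. dyadic_block \<phi> (Suc j) (q l) (f\<^sub>n n x)) \<and>
            ((\<lambda>z. of_int (zorder (f\<^sub>n n x) z) * (1 / cmod z ^ l)) has_sum
               zero_sum r0 \<phi> (q l) (f\<^sub>n n x)) (zeros (f\<^sub>n n x) \<inter> - D)) \<and>
         (\<forall>n. integrable M (\<lambda>x. zero_sum r0 \<phi> (q l) (f\<^sub>n n x))) \<and>
         (\<exists>B. \<forall>n. (LINT x|M. \<bar>zero_sum r0 \<phi> (q l) (f\<^sub>n n x)\<bar>) \<le> B)) \<and>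
      (\<forall>l\<ge>1.
         (AE x in M. summable (\<lambda>j. dyadic_block \<phi> (Suc j) (p l) (f x))) \<and>
         integrable M (\<lambda>x. zero_sum r0 \<phi> (p l) (f x))) \<and>
      (\<forall>l\<ge>3.
         (AE x in M. summable (\<lambda>j. dyadic_block \<phi> (Suc j) (q l) (f x)) \<and>
            ((\<lambda>z. of_int (zorder (f x) z) * (1 / cmod z ^ l)) has_sum
               zero_sum r0 \<phi> (q l) (f x)) (zeros (f x) \<inter> - D)) \<and>
         integrable M (\<lambda>x. zero_sum r0 \<phi> (q l) (f x))) \<and>
      (\<exists>k0\<ge>1. \<exists>C\<^sub>1 C\<^sub>2 :: nat \<Rightarrow> real.
         (\<forall>k\<ge>k0. \<forall>l\<ge>1.
            (\<forall>n. integrable M (\<lambda>x. zero_tail \<phi> k (p l) (f\<^sub>n n x)) \<and>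
               (LINT x|M. cmod (zero_tail \<phi> k (p l) (f\<^sub>n n x)))
                 \<le> C\<^sub>1 l / 2 powr (real k * real l / 2)) \<and>
            integrable M (\<lambda>x. zero_tail \<phi> k (p l) (f x)) \<and>
            (LINT x|M. cmod (zero_tail \<phi> k (p l) (f x)))
              \<le> C\<^sub>1 l / 2 powr (real k * real l / 2)) \<and>
         (\<forall>k\<ge>k0. \<forall>l\<ge>3.
            (\<forall>n. integrable M (\<lambda>x. zero_tail \<phi> k (q l) (f\<^sub>n n x)) \<and>
               (LINT x|M. \<bar>zero_tail \<phi> k (q l) (f\<^sub>n n x)\<bar>)
                 \<le> C\<^sub>2 l / 2 powr (real k * (real l - 2) / 2)) \<and>
            integrable M (\<lambda>x. zero_tail \<phi> k (q l) (f x)) \<and>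
            (LINT x|M. \<bar>zero_tail \<phi> k (q l) (f x)\<bar>)
              \<le> C\<^sub>2 l / 2 powr (real k * (real l - 2) / 2)))"
proof -
  interpret prob_space M by fact
  interpret gaf_statistics M \<xi> r0 \<phi> by unfold_locales (use assms in auto)
  have F: "gaf (\<lambda>k. \<xi> k x) = random_gaf UNIV x" "gaf_trunc n (\<lambda>k. \<xi> k x) = random_gaf {..n} x" for n x
    by (simp_all add: random_gaf_def gaf_trunc_eq_gaf)
  obtain K where K: "\<And>l. K l \<ge> 0" and block_p: "\<And>A j l. 0 \<in> A \<Longrightarrow> (\<And>i j. i \<le> j \<Longrightarrow> j \<in> A \<Longrightarrow> i \<in> A) \<Longrightarrow> j \<ge> 1 \<Longrightarrow> l \<ge> 1 \<Longrightarrow>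
      (\<integral>\<^sup>+x. ennreal (cmod (annular_block r0 \<phi> j (\<lambda>z. 1 / z ^ l) (random_gaf A x))) \<partial>M)
        \<le> ennreal (K l * ((1 + real j) / 2 ^ (j * l)))"
    using annular_block_p_bound by blast
  have p_le: "\<forall>j\<ge>1. (\<integral>\<^sup>+x. ennreal (norm (annular_block r0 \<phi> j (\<lambda>z. 1 / z ^ l) (random_gaf A x))) \<partial>M)
        \<le> ennreal (K l * ((1 + real j) / 2 ^ (j * l)))" if "A = UNIV \<or> A = {..n}" "l \<ge> 1" for A n l
    using that by (intro allI impI block_p) auto
  have p_meas: "(\<lambda>z::complex. 1 / z ^ l) \<in> borel_measurable borel" for l by measurable
  have q_meas: "(\<lambda>z. 1 / cmod z ^ l) \<in> borel_measurable borel" for l by measurable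
  have p_norm: "cmod (1 / z ^ l) \<le> 1 / cmod z ^ l" for l z by (simp add: norm_divide norm_power)
  have q_norm: "norm (1 / cmod z ^ l) \<le> 1 / cmod z ^ l" for l z by simp
  note p_sum = zero_sum_bound[OF p_meas p_norm _ measurable_block_p K p_le]
  note q_sum = zero_sum_bound[OF q_meas q_norm _ measurable_block_q crude_const_nonneg block_q_le]
  note p_tail = zero_tail_bound[OF measurable_block_p K p_le]
  note q_tail = zero_tail_bound[OF measurable_block_q crude_const_nonneg block_q_le]
  have p_trunc: "AE x in M. summable (\<lambda>j. dyadic_block \<phi> (Suc j) (\<lambda>z. 1 / z ^ l) (random_gaf {..n} x)) \<and>
      ((\<lambda>z. of_int (zorder (random_gaf {..n} x) z) * (1 / z ^ l)) has_sum
        zero_sum r0 \<phi> (\<lambda>z. 1 / z ^ l) (random_gaf {..n} x)) (zeros (random_gaf {..n} x) \<inter> - ball 0 r0)" for n l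
    using AE_zero_sum_truncation[OF p_meas[of l], of n] by (simp add: scaleR_conv_of_real)
  have q_trunc: "AE x in M. summable (\<lambda>j. dyadic_block \<phi> (Suc j) (\<lambda>z. 1 / cmod z ^ l) (random_gaf {..n} x)) \<and>
      ((\<lambda>z. of_int (zorder (random_gaf {..n} x) z) * (1 / cmod z ^ l)) has_sum
        zero_sum r0 \<phi> (\<lambda>z. 1 / cmod z ^ l) (random_gaf {..n} x)) (zeros (random_gaf {..n} x) \<inter> - ball 0 r0)" for n l
    using AE_zero_sum_truncation[OF q_meas[of l], of n] by simp
  show ?thesis
    unfolding Let_def F
  proof (intro conjI allI impI)
    fix l :: nat assume l: "1 \<le> l"
    show "AE x in M. summable (\<lambda>j. dyadic_block \<phi> (Suc j) (\<lambda>z. 1 / z ^ l) (random_gaf {..n} x)) \<and>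
      ((\<lambda>z. of_int (zorder (random_gaf {..n} x) z) * (1 / z ^ l)) has_sum
        zero_sum r0 \<phi> (\<lambda>z. 1 / z ^ l) (random_gaf {..n} x)) (zeros (random_gaf {..n} x) \<inter> - ball 0 r0)" for n
      by (rule p_trunc)
    show "integrable M (\<lambda>x. zero_sum r0 \<phi> (\<lambda>z. 1 / z ^ l) (random_gaf {..n} x))" for n
      using l by (intro p_sum(3)) auto
    show "\<exists>B. \<forall>n. (LINT x|M. cmod (zero_sum r0 \<phi> (\<lambda>z. 1 / z ^ l) (random_gaf {..n} x))) \<le> B"
      using l by (intro exI[of _ "crude_const l + K l * decay_sum"] allI p_sum(4)) auto
    show "AE x in M. summable (\<lambda>j. dyadic_block \<phi> (Suc j) (\<lambda>z. 1 / z ^ l) (random_gaf UNIV x))"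
      using l by (intro p_sum(1)) auto
    show "integrable M (\<lambda>x. zero_sum r0 \<phi> (\<lambda>z. 1 / z ^ l) (random_gaf UNIV x))"
      using l by (intro p_sum(3)) auto
  next
    fix l :: nat assume l: "3 \<le> l"
    show "AE x in M. summable (\<lambda>j. dyadic_block \<phi> (Suc j) (\<lambda>z. 1 / cmod z ^ l) (random_gaf {..n} x)) \<and>
      ((\<lambda>z. of_int (zorder (random_gaf {..n} x) z) * (1 / cmod z ^ l)) has_sum
        zero_sum r0 \<phi> (\<lambda>z. 1 / cmod z ^ l) (random_gaf {..n} x)) (zeros (random_gaf {..n} x) \<inter> - ball 0 r0)" for n
      by (rule q_trunc)
    show "integrable M (\<lambda>x. zero_sum r0 \<phi> (\<lambda>z. 1 / cmod z ^ l) (random_gaf {..n} x))" for n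
      using l by (intro q_sum(3)) auto
    show "\<exists>B. \<forall>n. (LINT x|M. \<bar>zero_sum r0 \<phi> (\<lambda>z. 1 / cmod z ^ l) (random_gaf {..n} x)\<bar>) \<le> B"
      using l by (intro exI[of _ "crude_const l + crude_const l * decay_sum"] allI q_sum(4)[unfolded real_norm_def]) auto
    show "AE x in M. summable (\<lambda>j. dyadic_block \<phi> (Suc j) (\<lambda>z. 1 / cmod z ^ l) (random_gaf UNIV x)) \<and>
      ((\<lambda>z. of_int (zorder (random_gaf UNIV x) z) * (1 / cmod z ^ l)) has_sum
        zero_sum r0 \<phi> (\<lambda>z. 1 / cmod z ^ l) (random_gaf UNIV x)) (zeros (random_gaf UNIV x) \<inter> - ball 0 r0)"
      unfolding AE_conj_iff
    proof
      show "AE x in M. summable (\<lambda>j. dyadic_block \<phi> (Suc j) (\<lambda>z. 1 / cmod z ^ l) (random_gaf UNIV x))"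
        using l by (intro q_sum(1)) auto
      show "AE x in M. ((\<lambda>z. of_int (zorder (random_gaf UNIV x) z) * (1 / cmod z ^ l)) has_sum
        zero_sum r0 \<phi> (\<lambda>z. 1 / cmod z ^ l) (random_gaf UNIV x)) (zeros (random_gaf UNIV x) \<inter> - ball 0 r0)"
        using AE_zero_sum_abs[OF l] by simp
    qed
    show "integrable M (\<lambda>x. zero_sum r0 \<phi> (\<lambda>z. 1 / cmod z ^ l) (random_gaf UNIV x))"
      using l by (intro q_sum(3)) auto
  next
    show "\<exists>k0\<ge>1. \<exists>C\<^sub>1 C\<^sub>2 :: nat \<Rightarrow> real.
         (\<forall>k\<ge>k0. \<forall>l\<ge>1.
            (\<forall>n. integrable M (\<lambda>x. zero_tail \<phi> k (\<lambda>z. 1 / z ^ l) (random_gaf {..n} x)) \<and>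
               (LINT x|M. cmod (zero_tail \<phi> k (\<lambda>z. 1 / z ^ l) (random_gaf {..n} x)))
                 \<le> C\<^sub>1 l / 2 powr (real k * real l / 2)) \<and>
            integrable M (\<lambda>x. zero_tail \<phi> k (\<lambda>z. 1 / z ^ l) (random_gaf UNIV x)) \<and>
            (LINT x|M. cmod (zero_tail \<phi> k (\<lambda>z. 1 / z ^ l) (random_gaf UNIV x)))
              \<le> C\<^sub>1 l / 2 powr (real k * real l / 2)) \<and>
         (\<forall>k\<ge>k0. \<forall>l\<ge>3.
            (\<forall>n. integrable M (\<lambda>x. zero_tail \<phi> k (\<lambda>z. 1 / cmod z ^ l) (random_gaf {..n} x)) \<and>
               (LINT x|M. \<bar>zero_tail \<phi> k (\<lambda>z. 1 / cmod z ^ l) (random_gaf {..n} x)\<bar>)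
                 \<le> C\<^sub>2 l / 2 powr (real k * (real l - 2) / 2)) \<and>
            integrable M (\<lambda>x. zero_tail \<phi> k (\<lambda>z. 1 / cmod z ^ l) (random_gaf UNIV x)) \<and>
            (LINT x|M. \<bar>zero_tail \<phi> k (\<lambda>z. 1 / cmod z ^ l) (random_gaf UNIV x)\<bar>)
              \<le> C\<^sub>2 l / 2 powr (real k * (real l - 2) / 2))"
    \<comment> \<open>\<open>k0 = 1\<close> works because the block bounds hold for every
      \<open>j >= 1\<close>; the constants are the block constants times \<open>decay_sum\<close>,
      which absorbs the sum over \<open>j\<close>.\<close>
    proof (rule exI[of _ 1], rule conjI[OF order_refl], rule exI[of _ "\<lambda>l. K l * decay_sum"],
        rule exI[of _ "\<lambda>l. crude_const l * decay_sum"], intro conjI allI impI)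
      fix k l :: nat assume kl: "1 \<le> k" "1 \<le> l"
      show "integrable M (\<lambda>x. zero_tail \<phi> k (\<lambda>z. 1 / z ^ l) (random_gaf {..n} x))"
        "(LINT x|M. cmod (zero_tail \<phi> k (\<lambda>z. 1 / z ^ l) (random_gaf {..n} x)))
                 \<le> K l * decay_sum / 2 powr (real k * real l / 2)" for n
        using kl by (intro p_tail; auto)+
      show "integrable M (\<lambda>x. zero_tail \<phi> k (\<lambda>z. 1 / z ^ l) (random_gaf UNIV x))"
        "(LINT x|M. cmod (zero_tail \<phi> k (\<lambda>z. 1 / z ^ l) (random_gaf UNIV x)))
                 \<le> K l * decay_sum / 2 powr (real k * real l / 2)"
        using kl by (intro p_tail; auto)+
    next
      fix k l :: nat assume kl: "1 \<le> k" "3 \<le> l"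
      then have l2: "real (l - 2) = real l - 2" by simp
      show "integrable M (\<lambda>x. zero_tail \<phi> k (\<lambda>z. 1 / cmod z ^ l) (random_gaf {..n} x))"
        "(LINT x|M. \<bar>zero_tail \<phi> k (\<lambda>z. 1 / cmod z ^ l) (random_gaf {..n} x)\<bar>)
                 \<le> crude_const l * decay_sum / 2 powr (real k * (real l - 2) / 2)" for n
        unfolding l2[symmetric] real_norm_def[symmetric] using kl by (intro q_tail; auto)+
      show "integrable M (\<lambda>x. zero_tail \<phi> k (\<lambda>z. 1 / cmod z ^ l) (random_gaf UNIV x))"
        "(LINT x|M. \<bar>zero_tail \<phi> k (\<lambda>z. 1 / cmod z ^ l) (random_gaf UNIV x)\<bar>)
                 \<le> crude_const l * decay_sum / 2 powr (real k * (real l - 2) / 2)"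
        unfolding l2[symmetric] real_norm_def[symmetric] using kl by (intro q_tail; auto)+
    qed
  qed
qed

end
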